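(* Let $f\in Lip(\alpha,p)$, and let $(a_{n,k})_{n,k\ge 0}$ be a matrix of real numbers such that $a_{n,k}\ge 0$ for $k\le n$, $a_{n,k}=0$ for $k>n$, and $\sum_{k=0}^{n}a_{n,k}=1$ for every $n=0,1,2,\dots$. Suppose that one of the following conditions holds: (i) $p>1$, $0<\alpha<1$ and $(a_{n,k})\in AMIMS$; (ii) $p>1$, $0<\alpha<1$, $(a_{n,k})\in AMDMS$ and $(n+1)a_{n,0}=O(1)$; (iii) $p>1$, $\alpha=1$ and $\sum_{k=0}^{n-1}|A_{n,k}-A_{n,k+1}|=O(n^{-1})$; (iv) $p=1$, $0<\alpha<1$, $\sum_{k=0}^{n-1}|a_{n,k}-a_{n,k+1}|=O(n^{-1})$ and $(n+1)a_{n,n}=O(1)$; (v) $p=1$, $0<\alpha<1$, $(a_{n,k})\in RBVS$ and $(n+1)a_{n,0}=O(1)$; (vi) $p=\alpha=1$, $\left((k+1)^{-\beta}a_{n,k}\right)\in HBVS$ for some $\beta>0$, and $(n+1)a_{n,n}=O(1)$. Then $$\|T_n(f)-f\|_{L^p}=O(n^{-\alpha}).$$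
   Context: For $p\ge 1$ and $f$ a $2\pi$-periodic function in $L^p[0,2\pi]$, put $\|f\|_{L^p}=\left\{\frac{1}{2\pi}\int_0^{2\pi}|f(x)|^p\,dx\right\}^{1/p}$ and $$\omega_p(f;\delta)=\sup_{0<|h|\le\delta}\left\{\frac{1}{2\pi}\int_0^{2\pi}|f(x+h)-f(x)|^p\,dx\right\}^{1/p}.$$ For $\alpha>0$, $f\in Lip(\alpha,p)$ means that $f$ is $2\pi$-periodic, $f\in L^p[0,2\pi]$ and $\omega_p(f;\delta)=O(\delta^\alpha)$. $S_n(f;x)=\frac{a_0}{2}+\sum_{k=1}^n(a_k\cos kx+b_k\sin kx)$ is the $n$-th partial sum of the Fourier series of $f$ (with $a_k,b_k$ the Fourier coefficients of $f$), and $T_n(f;x)=\sum_{k=0}^n a_{n,k}S_k(f;x)$. Put $A_{n,m}=\frac{1}{m+1}\sum_{k=0}^m a_{n,k}$. Classes for a lower triangular matrix $(b_{n,k})$ of nonnegative numbers ($b_{n,k}=0$ for $k>n$), with $B_{n,m}=\frac1{m+1}\sum_{k=0}^m b_{n,k}$; in each case the constant $K$ is independent of $n$: $(b_{n,k})\in AMDMS$: there is $K$ such that $B_{n,l}\le K B_{n,m}$ for all $n$ and all $0\le m\le l\le n$. $(b_{n,k})\in AMIMS$: there is $K$ such that $B_{n,m}\le K B_{n,l}$ for all $n$ and all $0\le m\le l\le n$. $(b_{n,k})\in RBVS$: there is $K$ such that $\sum_{k=m}^{\infty}|b_{n,k}-b_{n,k+1}|\le K b_{n,m}$ for all $n$ and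 all $0\le m\le n$. $(b_{n,k})\in HBVS$: there is $K$ such that $\sum_{k=0}^{m-1}|b_{n,k}-b_{n,k+1}|\le K b_{n,m}$ for all $n$ and all $0\le m\le n$. All $O(\cdot)$ relations involving $n$ are for $n\ge1$, with constants independent of $n$. *)

theory Defs
  imports "HOL-Analysis.Analysis" "HOL-Library.Landau_Symbols"
begin

definition in_Lp :: "real \<Rightarrow> (real \<Rightarrow> real) \<Rightarrow> bool" where
  "in_Lp p f \<longleftrightarrow>
     f \<in> borel_measurable (lebesgue_on {0..2 * pi}) \<and>
     integrable (lebesgue_on {0..2 * pi}) (\<lambda>x. \<bar>f x\<bar> powr p)"

definition Lp_norm :: "real \<Rightarrow> (real \<Rightarrow> real) \<Rightarrow> real" where
  "Lp_norm p f =
     (1 / (2 * pi) * (LINT x|lebesgue_on {0..2 * pi}. \<bar>f x\<bar> powr p)) powr (1 / p)"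

text \<open>
  For 2 pi-periodic functions in L^p with p at least 1 and for positive \<open>\<delta>\<close>, the set under the
  supremum is nonempty and bounded above by twice the norm of the function, so the supremum
  over the reals is the intended one.
\<close>
definition Lp_modulus :: "real \<Rightarrow> (real \<Rightarrow> real) \<Rightarrow> real \<Rightarrow> real" where
  "Lp_modulus p f \<delta> = (SUP h\<in>{h. 0 < \<bar>h\<bar> \<and> \<bar>h\<bar> \<le> \<delta>}. Lp_norm p (\<lambda>x. f (x + h) - f x))"

definition Lip :: "real \<Rightarrow> real \<Rightarrow> (real \<Rightarrow> real) set" where
  "Lip \<alpha> p =
     {f. (\<forall>x. f (x + 2 * pi) = f x) \<and> in_Lp p f \<and>
         Lp_modulus p f \<in> O[at_right 0](\<lambda>\<delta>. \<delta> powr \<alpha>)}"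

definition fourier_a :: "(real \<Rightarrow> real) \<Rightarrow> nat \<Rightarrow> real" where
  "fourier_a f k = 1 / pi * (LINT x|lebesgue_on {0..2 * pi}. f x * cos (real k * x))"

definition fourier_b :: "(real \<Rightarrow> real) \<Rightarrow> nat \<Rightarrow> real" where
  "fourier_b f k = 1 / pi * (LINT x|lebesgue_on {0..2 * pi}. f x * sin (real k * x))"

definition fourier_sum :: "(real \<Rightarrow> real) \<Rightarrow> nat \<Rightarrow> real \<Rightarrow> real" where
  "fourier_sum f n x =
     fourier_a f 0 / 2 +
     (\<Sum>k = 1..n. fourier_a f k * cos (real k * x) + fourier_b f k * sin (real k * x))"

definition matrix_mean ::
    "(nat \<Rightarrow> nat \<Rightarrow> real) \<Rightarrow> (real \<Rightarrow> real) \<Rightarrow> nat \<Rightarrow> real \<Rightarrow> real" where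
  "matrix_mean a f n x = (\<Sum>k = 0..n. a n k * fourier_sum f k x)"

definition row_avg :: "(nat \<Rightarrow> nat \<Rightarrow> real) \<Rightarrow> nat \<Rightarrow> nat \<Rightarrow> real" where
  "row_avg b n m = 1 / (real m + 1) * (\<Sum>k = 0..m. b n k)"

definition nonneg_lower_triangular :: "(nat \<Rightarrow> nat \<Rightarrow> real) \<Rightarrow> bool" where
  "nonneg_lower_triangular b \<longleftrightarrow>
     (\<forall>n k. k \<le> n \<longrightarrow> 0 \<le> b n k) \<and> (\<forall>n k. n < k \<longrightarrow> b n k = 0)"

definition AMDMS :: "(nat \<Rightarrow> nat \<Rightarrow> real) set" where
  "AMDMS = {b. nonneg_lower_triangular b \<and>
     (\<exists>K. \<forall>n m l. m \<le> l \<and> l \<le> n \<longrightarrow> row_avg b n l \<le> K * row_avg b n m)}"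

definition AMIMS :: "(nat \<Rightarrow> nat \<Rightarrow> real) set" where
  "AMIMS = {b. nonneg_lower_triangular b \<and>
     (\<exists>K. \<forall>n m l. m \<le> l \<and> l \<le> n \<longrightarrow> row_avg b n m \<le> K * row_avg b n l)}"

text \<open>The series below has finitely many nonzero terms, since the rows are finitely supported.\<close>
definition RBVS :: "(nat \<Rightarrow> nat \<Rightarrow> real) set" where
  "RBVS = {b. nonneg_lower_triangular b \<and>
     (\<exists>K. \<forall>n m. m \<le> n \<longrightarrow> (\<Sum>k. \<bar>b n (m + k) - b n (m + k + 1)\<bar>) \<le> K * b n m)}"

definition HBVS :: "(nat \<Rightarrow> nat \<Rightarrow> real) set" where
  "HBVS = {b. nonneg_lower_triangular b \<and>
     (\<exists>K. \<forall>n m. m \<le> n \<longrightarrow> (\<Sum>k<m. \<bar>b n k - b n (k + 1)\<bar>) \<le> K * b n m)}"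

text \<open>
  The relation u n = O(v n) with one constant for all n at least 1; the filter makes the bound
  hold at every such n, not only eventually.
\<close>
abbreviation bigo_ge1 :: "(nat \<Rightarrow> real) \<Rightarrow> (nat \<Rightarrow> real) \<Rightarrow> bool" where
  "bigo_ge1 u v \<equiv> u \<in> O[principal {1..}](v)"

end

theory Submission
  imports Defs "HOL-Complex_Analysis.Complex_Analysis"
begin

text \<open>Everything is reduced to two estimates. For all \<open>p \<ge> 1\<close>, a Jackson kernel (the normalised
  square of the Fejer kernel) gives trigonometric polynomials of degree \<open>n\<close> at distance
  \<open>O(n^(-\<alpha>))\<close> from \<open>f\<close>. With Fejer means being contractions, a dyadic decomposition into such
  approximants shows that \<open>\<Sum>\<^sub>j\<^sub>\<le>\<^sub>k (j + 1)^\<beta> (S\<^sub>j f - f)\<close> has norm \<open>O(k^(\<beta> + 1 - \<alpha>))\<close> as soon as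
  \<open>\<beta> + 1 > \<alpha>\<close>; Abel summation against this settles the cases with \<open>p = 1\<close> (taking \<open>\<beta> = 0\<close> when
  \<open>\<alpha> < 1\<close>). For \<open>p > 1\<close>, M. Riesz's theorem bounds the conjugation operator, hence the partial
  sums \<open>S\<^sub>n\<close>, on \<open>L^p\<close>, so that \<open>S\<^sub>n f - f = O(n^(-\<alpha>))\<close>; for \<open>\<alpha> = 1\<close> it also bounds
  \<open>\<Sum>\<^sub>k\<^sub>\<le>\<^sub>n k U\<^sub>k\<close> (\<open>U\<^sub>k\<close> the \<open>k\<close>-th harmonic of \<open>f\<close>), the conjugate of the derivative of \<open>S\<^sub>n f\<close>.
  Riesz's theorem is proved for \<open>1 < p \<le> 2\<close> by taking the mean of \<open>G powr p\<close> for an analytic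
  polynomial \<open>G\<close> with values in the right half plane, and for \<open>p > 2\<close> by duality.\<close>

section \<open>The spaces \<open>L\<^sup>p\<close> on the circle\<close>

text \<open>The split at p = 1 comes from the partial sums S_k: they are uniformly bounded on L^p
  for p > 1, but not on L^1. For p > 1 and \<alpha> < 1 the norms of S_k f - f can therefore be
  added one by one, and the averages of a row decide; for p = 1 only averaged deviations are
  controlled, so the rows must have small variation. At \<alpha> = 1 both routes meet a logarithm:
  adding norms produces the sum of 1 / (k + 1), and the dyadic series with \<beta> = 0 has ratio 1.
  For p > 1 the cure is to keep the cancellation in the sum of k U_k; for p = 1 it is an exponent
  \<beta> > 0, which makes the ratio \<open>2 powr (\<beta> + 1 - \<alpha>)\<close> exceed 1, and
  this is where the \<beta> of the HBVS condition enters. Conjugation is handled on trigonometric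
  polynomials with bounds uniform in the degree, so no singular integral occurs; positivity of the
  Fejer kernel is what puts the analytic polynomial into the right half plane.\<close>

abbreviation circ :: "real measure" where
  "circ \<equiv> lebesgue_on {0..2 * pi}"

text \<open>Borel rather than Lebesgue measurability makes \<open>f (x - t)\<close> jointly measurable in \<open>(x, t)\<close>.\<close>
definition periodic_Lp :: "real \<Rightarrow> (real \<Rightarrow> real) set" where
  "periodic_Lp p = {f. f \<in> borel_measurable borel \<and> (\<forall>x. f (x + 2 * pi) = f x) \<and> in_Lp p f}"

lemma finite_measure_circ: "finite_measure circ"
  by (rule finite_measure_lebesgue_on) auto

lemma sigma_finite_circ: "sigma_finite_measure circ"
  using finite_measure_circ by (simp add: finite_measure_def)

lemma pair_sigma_finite_circ: "pair_sigma_finite circ circ"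
  using sigma_finite_circ by (simp add: pair_sigma_finite_def)

lemma measure_circ [simp]: "measure circ {0..2 * pi} = 2 * pi"
  by (simp add: measure_restrict_space)

lemma borel_measurable_circI [measurable (raw)]:
  "f \<in> borel_measurable borel \<Longrightarrow> f \<in> borel_measurable circ"
  by (simp add: borel_measurable_if_D measurable_completion measurable_restrict_space1)

lemma integral_const_circ [simp]: "(LINT x|circ. c) = 2 * pi * (c::real)"
  by simp

lemma integrable_const_circ [simp]: "integrable circ (\<lambda>x. c::real)"
  using finite_measure.integrable_const[OF finite_measure_circ] by blast

lemma integrable_bounded_circ:
  fixes f :: "real \<Rightarrow> real"
  assumes "f \<in> borel_measurable circ" "\<And>x. x \<in> {0..2*pi} \<Longrightarrow> \<bar>f x\<bar> \<le> B"
  shows "integrable circ f"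
  by (rule finite_measure.integrable_const_bound[OF finite_measure_circ, of _ B])
     (use assms in \<open>auto intro!: AE_I2\<close>)

lemma integrable_mult_bounded_circ:
  fixes f :: "real \<Rightarrow> real"
  assumes "integrable circ f" "g \<in> borel_measurable circ" "\<And>x. x \<in> {0..2*pi} \<Longrightarrow> \<bar>g x\<bar> \<le> B"
  shows "integrable circ (\<lambda>x. f x * g x)"
proof -
  have m[measurable]: "f \<in> borel_measurable circ" "g \<in> borel_measurable circ"
    using assms by auto
  have le: "AE x in circ. norm (f x * g x) \<le> norm (B * f x)"
  proof (rule AE_I2)
    fix x assume "x \<in> space circ"
    then have "\<bar>g x\<bar> \<le> B" using assms(3) by simp
    then have "\<bar>f x\<bar> * \<bar>g x\<bar> \<le> \<bar>f x\<bar> * \<bar>B\<bar>"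
      by (intro mult_left_mono) auto
    then show "norm (f x * g x) \<le> norm (B * f x)"
      by (simp add: abs_mult mult.commute)
  qed
  have "integrable circ (\<lambda>x. B * f x)" using assms(1) by simp
  then show ?thesis
    by (rule Bochner_Integration.integrable_bound) (use le in \<open>auto\<close>)
qed

text \<open>Young's inequality with weights 1/p and (p - 1)/p, applied to \<open>y powr p\<close>
  and \<open>c powr p\<close>. In the form of a supporting line, convexity can be integrated
  directly: at the mean value the linear term drops out, which is Jensen's inequality.\<close>

lemma powr_ge_tangent:
  fixes p c y :: real
  assumes "1 \<le> p" "0 \<le> c" "0 \<le> y"
  shows "c powr p + p * c powr (p - 1) * (y - c) \<le> y powr p"
proof (cases "c = 0")
  case True
  \<comment> \<open>The left side is 0 here, also for p = 1, because \<open>0 powr 0\<close> is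
    0.\<close>
  then show ?thesis by simp
next
  case False
  then have c: "c > 0" using assms by simp
  have cc: "c powr p = c * c powr (p-1)"
    using c by (metis add.commute diff_add_cancel less_eq_real_def powr_mult_base)
  show ?thesis
  proof (cases "y = 0")
    case True
    have "(1 - p) * c powr p \<le> 0" using assms by (intro mult_nonpos_nonneg) auto
    then show ?thesis using True assms cc by (simp add: algebra_simps)
  next
    case False
    have "(y powr p) powr (1/p) * (c powr p) powr ((p-1)/p) \<le> (1/p) * y powr p + ((p-1)/p) * c powr p"
      by (rule Youngs_inequality_0) (use assms c False in \<open>auto simp: field_simps\<close>)
    moreover have "(y powr p) powr (1/p) = y" "(c powr p) powr ((p-1)/p) = c powr (p-1)"
      using assms by (auto simp: powr_powr)
    ultimately have "y * c powr (p-1) \<le> (1/p) * y powr p + ((p-1)/p) * c powr p"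
      by simp
    then have "p * (y * c powr (p-1)) \<le> p * ((1/p) * y powr p + ((p-1)/p) * c powr p)"
      using assms by (intro mult_left_mono) auto
    also have "\<dots> = y powr p + (p-1) * c powr p"
      using assms by (simp add: field_simps)
    finally have "p * (y * c powr (p-1)) \<le> y powr p + (p-1) * c powr p" .
    with cc show ?thesis by (simp add: algebra_simps)
  qed
qed

text \<open>The tangent is taken at the combination itself, so the weighted linear terms
  cancel.\<close>

lemma powr_convex_combination:
  fixes p l u v :: real
  assumes "1 \<le> p" "0 \<le> l" "l \<le> 1" "0 \<le> u" "0 \<le> v"
  shows "(l * u + (1 - l) * v) powr p \<le> l * u powr p + (1 - l) * v powr p"
proof -
  define c where "c = l * u + (1 - l) * v"
  have c: "0 \<le> c" using assms by (simp add: c_def)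
  have "l * (c powr p + p * c powr (p - 1) * (u - c)) + (1-l) * (c powr p + p * c powr (p - 1) * (v - c))
     \<le> l * u powr p + (1 - l) * v powr p"
    using assms c by (intro add_mono mult_left_mono powr_ge_tangent) auto
  moreover have "l * (c powr p + p * c powr (p - 1) * (u - c)) + (1-l) * (c powr p + p * c powr (p - 1) * (v - c))
     = c powr p + p * c powr (p - 1) * (l * u + (1 - l) * v - c)"
    by (simp add: algebra_simps)
  ultimately show ?thesis by (simp add: c_def)
qed

section \<open>Closure properties of L^p\<close>

lemma in_Lp_measurable [measurable_dest]: "in_Lp p f \<Longrightarrow> f \<in> borel_measurable circ"
  by (simp add: in_Lp_def)

lemma in_LpI_dominated:
  assumes [measurable]: "g \<in> borel_measurable circ"
    and h: "integrable circ h" and le: "\<And>x. x \<in> {0..2*pi} \<Longrightarrow> \<bar>g x\<bar> powr p \<le> h x"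
  shows "in_Lp p g"
  unfolding in_Lp_def
proof (intro conjI)
  show "integrable circ (\<lambda>x. \<bar>g x\<bar> powr p)"
  proof (rule Bochner_Integration.integrable_bound[OF h])
    show "AE x in circ. norm (\<bar>g x\<bar> powr p) \<le> norm (h x)"
    proof (rule AE_I2)
      fix x assume "x \<in> space circ"
      then have "\<bar>g x\<bar> powr p \<le> h x" using le by simp
      then show "norm (\<bar>g x\<bar> powr p) \<le> norm (h x)"
        by simp
    qed
  qed measurable
qed fact

lemma in_Lp_bounded:
  assumes "g \<in> borel_measurable circ" "0 \<le> p" "\<And>x. x \<in> {0..2*pi} \<Longrightarrow> \<bar>g x\<bar> \<le> B"
  shows "in_Lp p g"
  by (rule in_LpI_dominated[where h="\<lambda>_. B powr p"]) (use assms in \<open>auto intro!: powr_mono2\<close>)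

lemma in_Lp_add:
  assumes "in_Lp p f" "in_Lp p g" "0 \<le> p"
  shows "in_Lp p (\<lambda>x. f x + g x)"
proof (rule in_LpI_dominated)
  show "integrable circ (\<lambda>x. 2 powr p * (\<bar>f x\<bar> powr p + \<bar>g x\<bar> powr p))"
    using assms by (auto simp: in_Lp_def)
  show "\<bar>f x + g x\<bar> powr p \<le> 2 powr p * (\<bar>f x\<bar> powr p + \<bar>g x\<bar> powr p)" for x
  proof -
    have "\<bar>f x + g x\<bar> powr p \<le> (2 * max \<bar>f x\<bar> \<bar>g x\<bar>) powr p"
      using assms(3) by (intro powr_mono2) auto
    also have "\<dots> = 2 powr p * (max \<bar>f x\<bar> \<bar>g x\<bar>) powr p"
      by (simp add: powr_mult)
    also have "\<dots> \<le> 2 powr p * (\<bar>f x\<bar> powr p + \<bar>g x\<bar> powr p)"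
      by (intro mult_left_mono) (auto simp: max_def)
    finally show ?thesis .
  qed
qed (use assms in \<open>auto simp: in_Lp_def\<close>)

lemma in_Lp_cmult: "in_Lp p f \<Longrightarrow> in_Lp p (\<lambda>x. c * f x)"
  by (auto simp: in_Lp_def abs_mult powr_mult)

lemma in_Lp_uminus: "in_Lp p f \<Longrightarrow> in_Lp p (\<lambda>x. - f x)"
  using in_Lp_cmult[of p f "-1"] by simp

lemma in_Lp_diff: "in_Lp p f \<Longrightarrow> in_Lp p g \<Longrightarrow> 0 \<le> p \<Longrightarrow> in_Lp p (\<lambda>x. f x - g x)"
  using in_Lp_add[of p f "\<lambda>x. - g x"] in_Lp_uminus[of p g] by simp

lemma in_Lp_const: "0 \<le> p \<Longrightarrow> in_Lp p (\<lambda>x. c)"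
  by (rule in_Lp_bounded[where B="\<bar>c\<bar>"]) auto

lemma in_Lp_sum:
  assumes "\<And>i. i \<in> A \<Longrightarrow> in_Lp p (F i)" "0 \<le> p"
  shows "in_Lp p (\<lambda>x. \<Sum>i\<in>A. F i x)"
  using assms
proof (induction A rule: infinite_finite_induct)
  case (insert i A)
  then show ?case by (auto intro!: in_Lp_add)
qed (auto intro: in_Lp_const)

lemma in_Lp_integrable:
  assumes "in_Lp p f" "1 \<le> p"
  shows "integrable circ f"
proof (rule Bochner_Integration.integrable_bound)
  show "integrable circ (\<lambda>x. 1 + \<bar>f x\<bar> powr p)"
    using assms by (auto simp: in_Lp_def)
  show "AE x in circ. norm (f x) \<le> norm (1 + \<bar>f x\<bar> powr p)"
  proof (rule AE_I2)
    fix x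
    \<comment> \<open>The tangent at 1 gives y \<le> 1 + y^p, an integrable bound because the
      measure is finite.\<close>
    have "1 + p * (\<bar>f x\<bar> - 1) \<le> \<bar>f x\<bar> powr p"
      using powr_ge_tangent[of p 1 "\<bar>f x\<bar>"] assms by simp
    moreover have "\<bar>f x\<bar> \<le> 1 \<or> \<bar>f x\<bar> - 1 \<le> p * (\<bar>f x\<bar> - 1)"
      using assms mult_right_mono[of 1 p "\<bar>f x\<bar> - 1"] by (cases "\<bar>f x\<bar> \<le> 1") auto
    ultimately show "norm (f x) \<le> norm (1 + \<bar>f x\<bar> powr p)"
      by (smt (verit) powr_ge_zero real_norm_def)
  qed
qed (use assms in \<open>auto simp: in_Lp_def\<close>)

section \<open>The norm; the inequalities of Minkowski and Hoelder\<close>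

lemma Lp_norm_nonneg: "0 \<le> Lp_norm p f"
  by (simp add: Lp_norm_def)

lemma Lp_integral_eq:
  assumes "0 < p"
  shows "(LINT x|circ. \<bar>f x\<bar> powr p) = 2 * pi * Lp_norm p f powr p"
  using assms by (simp add: Lp_norm_def powr_powr)

lemma Lp_norm_leI:
  assumes "0 < p" "0 \<le> c" "(LINT x|circ. \<bar>f x\<bar> powr p) \<le> 2 * pi * c powr p"
  shows "Lp_norm p f \<le> c"
proof -
  have "Lp_norm p f powr p \<le> c powr p"
    using assms Lp_integral_eq[OF assms(1), of f] by simp
  then show ?thesis
    using assms(1,2) Lp_norm_nonneg[of p f] powr_less_mono2[of p c "Lp_norm p f"]
    by linarith
qed

lemma Lp_integral_leI:
  assumes "0 < p" "Lp_norm p f \<le> c"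
  shows "(LINT x|circ. \<bar>f x\<bar> powr p) \<le> 2 * pi * c powr p"
  using assms Lp_norm_nonneg[of p f] by (simp add: Lp_integral_eq powr_mono2)

lemma Lp_norm_mono:
  assumes "in_Lp p g" "0 < p" "\<And>x. x \<in> {0..2*pi} \<Longrightarrow> \<bar>f x\<bar> \<le> \<bar>g x\<bar>"
  shows "Lp_norm p f \<le> Lp_norm p g"
proof (rule Lp_norm_leI)
  have "(LINT x|circ. \<bar>f x\<bar> powr p) \<le> (LINT x|circ. \<bar>g x\<bar> powr p)"
    using assms by (intro integral_mono') (auto simp: in_Lp_def intro!: powr_mono2)
  also have "\<dots> = 2 * pi * Lp_norm p g powr p"
    using assms by (simp add: Lp_integral_eq)
  finally show "(LINT x|circ. \<bar>f x\<bar> powr p) \<le> 2 * pi * Lp_norm p g powr p" .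
qed (use assms Lp_norm_nonneg in auto)

lemma Lp_norm_cong:
  "(\<And>x. x \<in> {0..2*pi} \<Longrightarrow> f x = g x) \<Longrightarrow> Lp_norm p f = Lp_norm p g"
  unfolding Lp_norm_def
  by (rule arg_cong[where f="\<lambda>z. (1 / (2 * pi) * z) powr (1 / p)"], rule Bochner_Integration.integral_cong) auto

lemma Lp_norm_const: "0 < p \<Longrightarrow> Lp_norm p (\<lambda>x. c) = \<bar>c\<bar>"
  by (simp add: Lp_norm_def powr_powr)

lemma Lp_norm_cmult:
  assumes "0 < p"
  shows "Lp_norm p (\<lambda>x. c * f x) = \<bar>c\<bar> * Lp_norm p f"
proof -
  have "(LINT x|circ. \<bar>c * f x\<bar> powr p) = \<bar>c\<bar> powr p * (LINT x|circ. \<bar>f x\<bar> powr p)"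
    by (simp add: abs_mult powr_mult)
  then show ?thesis
    using assms unfolding Lp_norm_def
    by (simp only: powr_mult mult.assoc mult.left_commute[of "1 / (2 * pi)"]) (simp add: powr_powr powr_divide powr_mult)
qed

lemma Lp_norm_uminus: "Lp_norm p (\<lambda>x. - f x) = Lp_norm p f"
  by (simp add: Lp_norm_def)

lemma Lp_norm_minus_commute: "Lp_norm p (\<lambda>x. f x - g x) = Lp_norm p (\<lambda>x. g x - f x)"
  by (simp add: Lp_norm_def abs_minus_commute)

text \<open>Convexity: f / A and g / B lie in the unit ball, and (f + g) / (A + B) is their convex
  combination with weight A / (A + B). Positive upper bounds \<open>A\<close>, \<open>B\<close>
  stand in for the norms, so that the division is legitimate when a norm is 0.\<close>

lemma Lp_norm_add_le_aux:
  assumes fg: "in_Lp p f" "in_Lp p g" and p: "1 \<le> p"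
    and A: "Lp_norm p f \<le> A" "0 < A" and B: "Lp_norm p g \<le> B" "0 < B"
  shows "Lp_norm p (\<lambda>x. f x + g x) \<le> A + B"
proof (rule Lp_norm_leI)
  let ?l = "A / (A + B)"
  have pw: "\<bar>f x + g x\<bar> powr p \<le> (A + B) powr p * (?l * (A powr (-p) * \<bar>f x\<bar> powr p) + (1 - ?l) * (B powr (-p) * \<bar>g x\<bar> powr p))" for x
  proof -
    have l: "1 - ?l = B / (A + B)" using A B by (simp add: field_simps)
    have "\<bar>f x + g x\<bar> powr p \<le> (\<bar>f x\<bar> + \<bar>g x\<bar>) powr p"
      using p by (intro powr_mono2) auto
    also have "\<bar>f x\<bar> + \<bar>g x\<bar> = (A + B) * (?l * (\<bar>f x\<bar> / A) + (1 - ?l) * (\<bar>g x\<bar> / B))"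
      unfolding l using A B by (simp add: add_divide_distrib [symmetric])
    also have "\<dots> powr p = (A + B) powr p * (?l * (\<bar>f x\<bar> / A) + (1 - ?l) * (\<bar>g x\<bar> / B)) powr p"
      by (rule powr_mult)
    also have "\<dots> \<le> (A + B) powr p * (?l * (\<bar>f x\<bar> / A) powr p + (1 - ?l) * (\<bar>g x\<bar> / B) powr p)"
      using A B p by (intro mult_left_mono powr_convex_combination) (auto simp: field_simps)
    also have "\<dots> = (A + B) powr p * (?l * (A powr (-p) * \<bar>f x\<bar> powr p) + (1 - ?l) * (B powr (-p) * \<bar>g x\<bar> powr p))"
      using A B by (simp add: powr_divide powr_minus field_simps)
    finally show ?thesis .
  qed
  have "(LINT x|circ. \<bar>f x + g x\<bar> powr p) \<le> (LINT x|circ. (A + B) powr p * (?l * (A powr (-p) * \<bar>f x\<bar> powr p) + (1 - ?l) * (B powr (-p) * \<bar>g x\<bar> powr p)))"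
    using fg in_Lp_add[OF fg] p pw by (intro integral_mono) (auto simp: in_Lp_def)
  also have "\<dots> = (A + B) powr p * (?l * (A powr (-p) * (LINT x|circ. \<bar>f x\<bar> powr p)) + (1 - ?l) * (B powr (-p) * (LINT x|circ. \<bar>g x\<bar> powr p)))"
    using fg by (simp add: in_Lp_def)
  also have "\<dots> \<le> (A + B) powr p * (?l * (A powr (-p) * (2 * pi * A powr p)) + (1 - ?l) * (B powr (-p) * (2 * pi * B powr p)))"
    using A B p by (intro mult_left_mono add_mono Lp_integral_leI) (auto simp: field_simps)
  also have "\<dots> = 2 * pi * (A + B) powr p * (?l + (1 - ?l))"
    using A B by (simp add: powr_minus algebra_simps)
  also have "\<dots> = 2 * pi * (A + B) powr p" by simp
  finally show "(LINT x|circ. \<bar>f x + g x\<bar> powr p) \<le> 2 * pi * (A + B) powr p" .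
qed (use assms in auto)

lemma Lp_norm_add_le:
  assumes "in_Lp p f" "in_Lp p g" "1 \<le> p"
  shows "Lp_norm p (\<lambda>x. f x + g x) \<le> Lp_norm p f + Lp_norm p g"
proof (rule field_le_epsilon)
  fix e :: real assume "e > 0"
  then show "Lp_norm p (\<lambda>x. f x + g x) \<le> Lp_norm p f + Lp_norm p g + e"
    using Lp_norm_add_le_aux[OF assms, of "Lp_norm p f + e/2" "Lp_norm p g + e/2"]
      Lp_norm_nonneg[of p f] Lp_norm_nonneg[of p g] by simp
qed

lemma Lp_norm_diff_le:
  assumes "in_Lp p f" "in_Lp p g" "1 \<le> p"
  shows "Lp_norm p (\<lambda>x. f x - g x) \<le> Lp_norm p f + Lp_norm p g"
  using Lp_norm_add_le[OF assms(1) in_Lp_uminus[OF assms(2)] assms(3)] by (simp add: Lp_norm_uminus)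

lemma Lp_norm_triangle:
  assumes "in_Lp p f" "in_Lp p g" "in_Lp p h" "1 \<le> p"
  shows "Lp_norm p (\<lambda>x. f x - h x) \<le> Lp_norm p (\<lambda>x. f x - g x) + Lp_norm p (\<lambda>x. g x - h x)"
  using Lp_norm_add_le[of p "\<lambda>x. f x - g x" "\<lambda>x. g x - h x"] assms by (simp add: in_Lp_diff)

lemma Lp_norm_sum_le:
  assumes "\<And>i. i \<in> A \<Longrightarrow> in_Lp p (F i)" "1 \<le> p"
  shows "Lp_norm p (\<lambda>x. \<Sum>i\<in>A. F i x) \<le> (\<Sum>i\<in>A. Lp_norm p (F i))"
  using assms
proof (induction A rule: infinite_finite_induct)
  case (insert i A)
  then have "Lp_norm p (\<lambda>x. F i x + (\<Sum>i\<in>A. F i x)) \<le> Lp_norm p (F i) + Lp_norm p (\<lambda>x. \<Sum>i\<in>A. F i x)"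
    by (intro Lp_norm_add_le in_Lp_sum) auto
  with insert show ?case by simp
qed (auto simp: Lp_norm_const)

text \<open>Young's inequality for f / A and g / B, integrated. Again positive bounds replace the
  norms; \<open>Hoelder_circ\<close> lets them tend to the norms.\<close>

lemma Hoelder_circ_aux:
  assumes f: "in_Lp p f" and g: "in_Lp q g" and pq: "1 < p" "1 < q" "1 / p + 1 / q = 1"
    and A: "Lp_norm p f \<le> A" "0 < A" and B: "Lp_norm q g \<le> B" "0 < B"
  shows "integrable circ (\<lambda>x. f x * g x)" "(LINT x|circ. \<bar>f x * g x\<bar>) \<le> 2 * pi * (A * B)"
proof -
  have pw: "\<bar>f x * g x\<bar> \<le> A * B * (1 / p * (A powr (-p) * \<bar>f x\<bar> powr p) + 1 / q * (B powr (-q) * \<bar>g x\<bar> powr q))" for x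
  proof -
    have "(\<bar>f x\<bar> / A) * (\<bar>g x\<bar> / B) \<le> 1 / p * (\<bar>f x\<bar> / A) powr p + 1 / q * (\<bar>g x\<bar> / B) powr q"
      using Youngs_inequality[of p q "\<bar>f x\<bar> / A" "\<bar>g x\<bar> / B"] pq A B by simp
    then have "A * B * ((\<bar>f x\<bar> / A) * (\<bar>g x\<bar> / B)) \<le> A * B * (1 / p * (\<bar>f x\<bar> / A) powr p + 1 / q * (\<bar>g x\<bar> / B) powr q)"
      using A B by (intro mult_left_mono) auto
    then show ?thesis
      using A B by (simp add: abs_mult powr_divide powr_minus field_simps)
  qed
  have i: "integrable circ (\<lambda>x. A * B * (1 / p * (A powr (-p) * \<bar>f x\<bar> powr p) + 1 / q * (B powr (-q) * \<bar>g x\<bar> powr q)))"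
    using f g by (auto simp: in_Lp_def)
  show i2: "integrable circ (\<lambda>x. f x * g x)"
    by (rule Bochner_Integration.integrable_bound[OF i])
       (use f g pw in \<open>auto simp: in_Lp_def intro!: AE_I2 order_trans[OF pw]\<close>)
  have "(LINT x|circ. \<bar>f x * g x\<bar>) \<le> (LINT x|circ. A * B * (1 / p * (A powr (-p) * \<bar>f x\<bar> powr p) + 1 / q * (B powr (-q) * \<bar>g x\<bar> powr q)))"
    using i i2 pw by (intro integral_mono) auto
  also have "\<dots> = A * B * (1 / p * (A powr (-p) * (LINT x|circ. \<bar>f x\<bar> powr p)) + 1 / q * (B powr (-q) * (LINT x|circ. \<bar>g x\<bar> powr q)))"
    using f g by (simp add: in_Lp_def)
  also have "\<dots> \<le> A * B * (1 / p * (A powr (-p) * (2 * pi * A powr p)) + 1 / q * (B powr (-q) * (2 * pi * B powr q)))"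
    using A B pq by (intro mult_left_mono add_mono Lp_integral_leI) auto
  also have "\<dots> = 2 * pi * (A * B) * (1 / p + 1 / q)"
    using A B by (simp add: powr_minus field_simps)
  finally show "(LINT x|circ. \<bar>f x * g x\<bar>) \<le> 2 * pi * (A * B)" using pq by simp
qed

lemma Hoelder_circ:
  assumes f: "in_Lp p f" and g: "in_Lp q g" and pq: "1 < p" "1 < q" "1 / p + 1 / q = 1"
  shows "integrable circ (\<lambda>x. f x * g x)"
    "(LINT x|circ. \<bar>f x * g x\<bar>) \<le> 2 * pi * (Lp_norm p f * Lp_norm q g)"
proof -
  have *: "Lp_norm p f + 1 > 0" "Lp_norm q g + 1 > 0"
    using Lp_norm_nonneg[of p f] Lp_norm_nonneg[of q g] by auto
  show "integrable circ (\<lambda>x. f x * g x)"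
    by (rule Hoelder_circ_aux[OF assms, of "Lp_norm p f + 1" "Lp_norm q g + 1"]) (use * in auto)
  have "((\<lambda>e. 2 * pi * ((Lp_norm p f + e) * (Lp_norm q g + e))) \<longlongrightarrow> 2 * pi * ((Lp_norm p f + 0) * (Lp_norm q g + 0))) (at_right 0)"
    by (intro tendsto_intros)
  moreover have "eventually (\<lambda>e. (LINT x|circ. \<bar>f x * g x\<bar>) \<le> 2 * pi * ((Lp_norm p f + e) * (Lp_norm q g + e))) (at_right 0)"
    using eventually_at_right_less
  proof eventually_elim
    case (elim e)
    then show ?case
      using Lp_norm_nonneg[of p f] Lp_norm_nonneg[of q g]
      by (intro Hoelder_circ_aux[OF assms]) auto
  qed
  ultimately show "(LINT x|circ. \<bar>f x * g x\<bar>) \<le> 2 * pi * (Lp_norm p f * Lp_norm q g)"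
    using tendsto_lowerbound[of _ _ "at_right (0::real)"] by fastforce
qed

lemma L1_norm_le_Lp_norm:
  assumes f: "in_Lp p f" and p: "1 \<le> p"
  shows "(LINT x|circ. \<bar>f x\<bar>) \<le> 2 * pi * Lp_norm p f"
proof (cases "p = 1")
  case True
  then show ?thesis using Lp_integral_eq[of p f] Lp_norm_nonneg[of p f] by simp
next
  case False
  define q where "q = p / (p - 1)"
  have q: "1 < p" "1 < q" "1 / p + 1 / q = 1" using False p by (auto simp: q_def field_simps)
  show ?thesis
    using Hoelder_circ(2)[OF f in_Lp_const[of q 1] q] q by (simp add: Lp_norm_const)
qed

lemma Lp_norm_cong_AE:
  assumes "AE x in circ. f x = g x" "f \<in> borel_measurable circ" "g \<in> borel_measurable circ"
  shows "Lp_norm p f = Lp_norm p g"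
proof -
  have "(LINT x|circ. \<bar>f x\<bar> powr p) = (LINT x|circ. \<bar>g x\<bar> powr p)"
    using assms by (intro integral_cong_AE) auto
  then show ?thesis by (simp add: Lp_norm_def)
qed

lemma in_Lp_cong_AE:
  assumes "AE x in circ. f x = g x" "in_Lp p f" "g \<in> borel_measurable circ"
  shows "in_Lp p g"
proof -
  have [measurable]: "f \<in> borel_measurable circ" using assms by (simp add: in_Lp_def)
  have "integrable circ (\<lambda>x. \<bar>f x\<bar> powr p) \<longleftrightarrow> integrable circ (\<lambda>x. \<bar>g x\<bar> powr p)"
    using assms by (intro integrable_cong_AE) auto
  then show ?thesis using assms by (auto simp: in_Lp_def)
qed

section \<open>Translation invariance and Minkowski's integral inequality\<close>

lemma periodic_real_int:
  fixes f :: "real \<Rightarrow> 'a"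
  assumes "\<And>x. f (x + 2 * pi) = f x"
  shows "f (x + 2 * pi * of_int m) = f x"
proof -
  have nat: "f (x + 2 * pi * of_nat k) = f x" for x k
  proof (induction k)
    case (Suc k)
    have "f (x + 2 * pi * of_nat (Suc k)) = f ((x + 2 * pi * of_nat k) + 2 * pi)"
      by (simp add: algebra_simps)
    with Suc show ?case using assms by simp
  qed simp
  show ?thesis
  proof (cases "m \<ge> 0")
    case True
    then show ?thesis using nat[of x "nat m"] by simp
  next
    case False
    then show ?thesis using nat[of "x + 2 * pi * of_int m" "nat (-m)"] by simp
  qed
qed

text \<open>Half-open intervals of length 2 pi tile the line without overlap, so shifts by a period
  become exact identities of indicators; the dropped endpoint is null.\<close>

lemma nn_integral_circ:
  assumes [measurable]: "f \<in> borel_measurable borel"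
  shows "(\<integral>\<^sup>+x. f x \<partial>circ) = (\<integral>\<^sup>+x. f x * indicator {0..<2*pi} x \<partial>lborel)"
proof -
  have "(\<integral>\<^sup>+x. f x \<partial>circ) = (\<integral>\<^sup>+x. f x * indicator {0..2*pi} x \<partial>lborel)"
    by (subst nn_integral_restrict_space) (auto simp: nn_integral_completion)
  also have "\<dots> = (\<integral>\<^sup>+x. f x * indicator {0..<2*pi} x \<partial>lborel)"
    by (intro nn_integral_cong_AE) (use AE_lborel_singleton[of "2*pi"] in eventually_elim, auto simp: indicator_def)
  finally show ?thesis .
qed

lemma nn_integral_periodic_interval:
  fixes f :: "real \<Rightarrow> ennreal"
  assumes [measurable]: "f \<in> borel_measurable borel" and per: "\<And>x. f (x + 2 * pi) = f x"
  shows "(\<integral>\<^sup>+x. f x * indicator {c..<c + 2*pi} x \<partial>lborel) = (\<integral>\<^sup>+x. f x \<partial>circ)"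
proof -
  have shift: "(\<integral>\<^sup>+x. f x * indicator {a..<b} x \<partial>lborel) =
      (\<integral>\<^sup>+x. f x * indicator {a - 2*pi * of_int m..<b - 2*pi * of_int m} x \<partial>lborel)" for a b m
  proof -
    have "(\<integral>\<^sup>+x. f x * indicator {a..<b} x \<partial>lborel) =
      (\<integral>\<^sup>+x. f (2*pi * of_int m + 1 * x) * indicator {a..<b} (2*pi * of_int m + 1 * x) \<partial>lborel)"
      by (subst nn_integral_real_affine[where c=1 and t="2*pi * of_int m"]) auto
    also have "\<dots> = (\<integral>\<^sup>+x. f x * indicator {a - 2*pi * of_int m..<b - 2*pi * of_int m} x \<partial>lborel)"
      using periodic_real_int[of f, OF per]
      by (intro nn_integral_cong) (auto simp: indicator_def add.commute)
    finally show ?thesis .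
  qed
  \<comment> \<open>Whole periods are removed from c, leaving an offset r in [0, 2 pi). The part of
    the window beyond 2 pi is then moved back by one period to fill [0, r).\<close>
  define m where "m = \<lfloor>c / (2*pi)\<rfloor>"
  define r where "r = c - 2*pi * of_int m"
  have "of_int m \<le> c / (2*pi)" "c / (2*pi) < of_int m + 1"
    unfolding m_def by linarith+
  then have r: "0 \<le> r" "r < 2*pi"
    by (auto simp: r_def field_simps)
  have split: "(\<integral>\<^sup>+x. f x * indicator {a..<b'} x \<partial>lborel) =
      (\<integral>\<^sup>+x. f x * indicator {a..<b} x \<partial>lborel) + (\<integral>\<^sup>+x. f x * indicator {b..<b'} x \<partial>lborel)"
    if "a \<le> b" "b \<le> b'" for a b b'
    using that by (subst nn_integral_add[symmetric]) (auto intro!: nn_integral_cong simp: indicator_def)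
  have "(\<integral>\<^sup>+x. f x * indicator {c..<c + 2*pi} x \<partial>lborel) =
      (\<integral>\<^sup>+x. f x * indicator {r..<r + 2*pi} x \<partial>lborel)"
    using shift[of c "c + 2*pi" m] by (simp add: r_def algebra_simps)
  also have "\<dots> = (\<integral>\<^sup>+x. f x * indicator {r..<2*pi} x \<partial>lborel) + (\<integral>\<^sup>+x. f x * indicator {2*pi..<r + 2*pi} x \<partial>lborel)"
    using r by (intro split) auto
  also have "(\<integral>\<^sup>+x. f x * indicator {2*pi..<r + 2*pi} x \<partial>lborel) = (\<integral>\<^sup>+x. f x * indicator {0..<r} x \<partial>lborel)"
    using shift[of "2*pi" "r + 2*pi" 1] by simp
  also have "(\<integral>\<^sup>+x. f x * indicator {r..<2*pi} x \<partial>lborel) + (\<integral>\<^sup>+x. f x * indicator {0..<r} x \<partial>lborel)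
     = (\<integral>\<^sup>+x. f x * indicator {0..<2*pi} x \<partial>lborel)"
    using r split[of 0 r "2*pi"] by (simp add: add.commute)
  also have "\<dots> = (\<integral>\<^sup>+x. f x \<partial>circ)"
    by (simp add: nn_integral_circ)
  finally show ?thesis .
qed

lemma nn_integral_translate_circ:
  fixes f :: "real \<Rightarrow> ennreal"
  assumes [measurable]: "f \<in> borel_measurable borel" and per: "\<And>x. f (x + 2 * pi) = f x"
  shows "(\<integral>\<^sup>+x. f (x + h) \<partial>circ) = (\<integral>\<^sup>+x. f x \<partial>circ)"
proof -
  have "(\<integral>\<^sup>+x. f x \<partial>circ) = (\<integral>\<^sup>+x. f x * indicator {h..<h + 2*pi} x \<partial>lborel)"
    using nn_integral_periodic_interval[OF assms] by simp
  also have "\<dots> = (\<integral>\<^sup>+x. f (h + 1 * x) * indicator {h..<h + 2*pi} (h + 1 * x) \<partial>lborel)"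
    by (subst nn_integral_real_affine[where c=1 and t=h]) auto
  also have "\<dots> = (\<integral>\<^sup>+x. f (x + h) * indicator {0..<2*pi} x \<partial>lborel)"
    by (intro nn_integral_cong) (auto simp: indicator_def add.commute)
  also have "\<dots> = (\<integral>\<^sup>+x. f (x + h) \<partial>circ)"
    by (subst nn_integral_circ) auto
  finally show ?thesis ..
qed

lemma nn_integral_reflect_circ:
  fixes f :: "real \<Rightarrow> ennreal"
  assumes [measurable]: "f \<in> borel_measurable borel" and per: "\<And>x. f (x + 2 * pi) = f x"
  shows "(\<integral>\<^sup>+x. f (h - x) \<partial>circ) = (\<integral>\<^sup>+x. f x \<partial>circ)"
proof -
  have "(\<integral>\<^sup>+x. f (h - x) \<partial>circ) = (\<integral>\<^sup>+x. f (h - x) * indicator {0..<2*pi} x \<partial>lborel)"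
    by (subst nn_integral_circ) auto
  also have "\<dots> = (\<integral>\<^sup>+x. f (h - (h + (-1) * x)) * indicator {0..<2*pi} (h + (-1) * x) \<partial>lborel)"
    by (subst nn_integral_real_affine[where c="-1" and t=h]) auto
  \<comment> \<open>The reflected window is half-open at the other end, from h - 2 pi (excluded) to
    h (included), hence equality only off these two points.\<close>
  also have "\<dots> = (\<integral>\<^sup>+x. f x * indicator {h - 2*pi..<(h - 2*pi) + 2*pi} x \<partial>lborel)"
    by (intro nn_integral_cong_AE)
       (use AE_lborel_singleton[of "h - 2*pi"] AE_lborel_singleton[of "h"] in eventually_elim, auto simp: indicator_def)
  also have "\<dots> = (\<integral>\<^sup>+x. f x \<partial>circ)"
    by (rule nn_integral_periodic_interval[OF assms])
  finally show ?thesis .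
qed

text \<open>The hypothesis says that f and g have the same distribution. Three choices of
  \<open>F\<close> compare the absolute values and the positive and negative parts; when neither
  function is integrable, both integrals are 0 by convention.\<close>

lemma integral_circ_cong_nn:
  fixes f g :: "real \<Rightarrow> real"
  assumes [measurable]: "f \<in> borel_measurable borel" "g \<in> borel_measurable borel"
    and nn: "\<And>F :: real \<Rightarrow> ennreal. F \<in> borel_measurable borel \<Longrightarrow> (\<integral>\<^sup>+x. F (f x) \<partial>circ) = (\<integral>\<^sup>+x. F (g x) \<partial>circ)"
  shows "integrable circ f \<longleftrightarrow> integrable circ g" "(LINT x|circ. f x) = (LINT x|circ. g x)"
proof -
  have 1: "(\<integral>\<^sup>+x. ennreal (norm (f x)) \<partial>circ) = (\<integral>\<^sup>+x. ennreal (norm (g x)) \<partial>circ)"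
    by (rule nn[of "\<lambda>y. ennreal (norm y)"]) auto
  show i: "integrable circ f \<longleftrightarrow> integrable circ g"
    unfolding integrable_iff_bounded 1 by simp
  have 2: "(\<integral>\<^sup>+x. ennreal (f x) \<partial>circ) = (\<integral>\<^sup>+x. ennreal (g x) \<partial>circ)"
    by (rule nn[of "\<lambda>y. ennreal y"]) auto
  have 3: "(\<integral>\<^sup>+x. ennreal (- f x) \<partial>circ) = (\<integral>\<^sup>+x. ennreal (- g x) \<partial>circ)"
    by (rule nn[of "\<lambda>y. ennreal (- y)"]) auto
  show "(LINT x|circ. f x) = (LINT x|circ. g x)"
  proof (cases "integrable circ f")
    case True
    with i show ?thesis by (simp add: real_lebesgue_integral_def 2 3)
  next
    case False
    with i show ?thesis by (simp add: not_integrable_integral_eq)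
  qed
qed

lemma
  fixes f :: "real \<Rightarrow> real"
  assumes [measurable]: "f \<in> borel_measurable borel" and per: "\<And>x. f (x + 2 * pi) = f x"
  shows integrable_translate_circ: "integrable circ (\<lambda>x. f (x + h)) \<longleftrightarrow> integrable circ f"
    and integral_translate_circ: "(LINT x|circ. f (x + h)) = (LINT x|circ. f x)"
    and integrable_reflect_circ: "integrable circ (\<lambda>x. f (h - x)) \<longleftrightarrow> integrable circ f"
    and integral_reflect_circ: "(LINT x|circ. f (h - x)) = (LINT x|circ. f x)"
proof -
  have "(\<integral>\<^sup>+x. F (f (x + h)) \<partial>circ) = (\<integral>\<^sup>+x. F (f x) \<partial>circ)"
    if [measurable]: "F \<in> borel_measurable borel" for F :: "real \<Rightarrow> ennreal"
    by (rule nn_integral_translate_circ[of "\<lambda>x. F (f x)"]) (auto simp: per)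
  then show "integrable circ (\<lambda>x. f (x + h)) \<longleftrightarrow> integrable circ f"
    "(LINT x|circ. f (x + h)) = (LINT x|circ. f x)"
    using integral_circ_cong_nn[of "\<lambda>x. f (x + h)" f] by simp_all
  have "(\<integral>\<^sup>+x. F (f (h - x)) \<partial>circ) = (\<integral>\<^sup>+x. F (f x) \<partial>circ)"
    if [measurable]: "F \<in> borel_measurable borel" for F :: "real \<Rightarrow> ennreal"
    by (rule nn_integral_reflect_circ[of "\<lambda>x. F (f x)"]) (auto simp: per)
  then show "integrable circ (\<lambda>x. f (h - x)) \<longleftrightarrow> integrable circ f"
    "(LINT x|circ. f (h - x)) = (LINT x|circ. f x)"
    using integral_circ_cong_nn[of "\<lambda>x. f (h - x)" f] by simp_all
qed

section \<open>Periodic functions under translation and reflection\<close>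

lemma periodic_LpD:
  assumes "f \<in> periodic_Lp p"
  shows "f \<in> borel_measurable borel" "f (x + 2 * pi) = f x" "in_Lp p f"
  using assms by (auto simp: periodic_Lp_def)

lemma periodic_Lp_integrable: "f \<in> periodic_Lp p \<Longrightarrow> 1 \<le> p \<Longrightarrow> integrable circ f"
  using in_Lp_integrable periodic_LpD(3) by blast

lemma
  assumes f: "f \<in> periodic_Lp p"
  shows periodic_Lp_translate: "(\<lambda>x. f (x + h)) \<in> periodic_Lp p"
    and Lp_norm_translate: "Lp_norm p (\<lambda>x. f (x + h)) = Lp_norm p f"
    and periodic_Lp_reflect: "(\<lambda>x. f (h - x)) \<in> periodic_Lp p"
proof -
  note [measurable] = periodic_LpD(1)[OF f] and per = periodic_LpD(2)[OF f]
  have 1: "f (x + 2 * pi + h) = f (x + h)" for x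
    using per[of "x + h"] by (simp add: algebra_simps)
  have 2: "f (h - (x + 2 * pi)) = f (h - x)" for x
    using per[of "h - (x + 2*pi)"] by (simp add: algebra_simps)
  note t = integrable_translate_circ[of "\<lambda>x. \<bar>f x\<bar> powr p" h] integral_translate_circ[of "\<lambda>x. \<bar>f x\<bar> powr p" h]
    integrable_reflect_circ[of "\<lambda>x. \<bar>f x\<bar> powr p" h] integral_reflect_circ[of "\<lambda>x. \<bar>f x\<bar> powr p" h]
  show "(\<lambda>x. f (x + h)) \<in> periodic_Lp p" "(\<lambda>x. f (h - x)) \<in> periodic_Lp p"
    using f t per 1 2 by (auto simp: periodic_Lp_def in_Lp_def)
  show "Lp_norm p (\<lambda>x. f (x + h)) = Lp_norm p f"
    unfolding Lp_norm_def using t per by auto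
qed

lemma periodic_Lp_diff:
  "f \<in> periodic_Lp p \<Longrightarrow> g \<in> periodic_Lp p \<Longrightarrow> 0 \<le> p \<Longrightarrow> (\<lambda>x. f x - g x) \<in> periodic_Lp p"
  by (auto simp: periodic_Lp_def in_Lp_diff)

text \<open>\<open>\<omega>\<close> is a continuous majorant of the fibre norms, hence integrable in
  \<open>t\<close>, and its positivity permits division. Jensen's inequality for the measure with
  density K \<omega> is followed by an exchange of the integrals.\<close>

lemma Minkowski_integral:
  fixes \<Phi> :: "real \<Rightarrow> real \<Rightarrow> real" and K \<omega> :: "real \<Rightarrow> real"
  assumes p: "1 \<le> p"
    and meas [measurable]: "(\<lambda>(x, t). \<Phi> x t) \<in> borel_measurable (circ \<Otimes>\<^sub>M circ)"
    and fibre: "\<And>x. x \<in> {0..2*pi} \<Longrightarrow> in_Lp p (\<lambda>t. \<Phi> x t)"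
    and fibre': "\<And>t. t \<in> {0..2*pi} \<Longrightarrow> in_Lp p (\<lambda>x. \<Phi> x t)"
    and le: "\<And>t. t \<in> {0..2*pi} \<Longrightarrow> Lp_norm p (\<lambda>x. \<Phi> x t) \<le> \<omega> t"
    and K: "continuous_on {0..2*pi} K" "\<And>t. 0 \<le> K t"
    and \<omega>: "continuous_on {0..2*pi} \<omega>" "\<And>t. 0 < \<omega> t"
  shows "in_Lp p (\<lambda>x. LINT t|circ. K t * \<Phi> x t)"
    and "Lp_norm p (\<lambda>x. LINT t|circ. K t * \<Phi> x t) \<le> (LINT t|circ. K t * \<omega> t)"
proof -
  have cont_meas: "g \<in> borel_measurable circ" if "continuous_on {0..2*pi} g" for g :: "real \<Rightarrow> real"
    using that by (intro continuous_imp_measurable_on_sets_lebesgue) auto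
  have [measurable]: "K \<in> borel_measurable circ" "\<omega> \<in> borel_measurable circ"
    using K \<omega> by (auto intro: cont_meas)
  have cont_int: "integrable circ g" and cont_bdd: "\<exists>B. \<forall>x\<in>{0..2*pi}. \<bar>g x\<bar> \<le> B"
    if "continuous_on {0..2*pi} g" for g :: "real \<Rightarrow> real"
  proof -
    have "bounded (g ` {0..2*pi})"
      using that by (intro compact_imp_bounded compact_continuous_image) auto
    then obtain B where B: "\<forall>x\<in>{0..2*pi}. \<bar>g x\<bar> \<le> B"
      by (auto simp: bounded_iff)
    then show "\<exists>B. \<forall>x\<in>{0..2*pi}. \<bar>g x\<bar> \<le> B" by blast
    show "integrable circ g"
      using B cont_meas[OF that] by (intro integrable_bounded_circ[of g B]) auto
  qed
  define \<Omega> where "\<Omega> = (LINT t|circ. K t * \<omega> t)"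
  have cK\<omega>: "continuous_on {0..2*pi} (\<lambda>t. K t * \<omega> t)"
    using K \<omega> by (intro continuous_intros)
  have cKw: "continuous_on {0..2*pi} (\<lambda>t. K t * \<omega> t powr (1 - p))"
  proof -
    have "\<omega> t \<noteq> 0" for t using \<omega>(2)[of t] by simp
    then show ?thesis using K \<omega> by (intro continuous_intros) auto
  qed
  have iK\<omega>: "integrable circ (\<lambda>t. K t * \<omega> t)" using cont_int[OF cK\<omega>] .
  have \<Omega>0: "0 \<le> \<Omega>" unfolding \<Omega>_def using K \<omega> by (intro integral_nonneg_AE AE_I2) (auto simp: less_imp_le)
  \<comment> \<open>This is K \<omega> (|\<Phi>| / \<omega>)^p, the integrand that Jensen's
    inequality for the density K \<omega> produces.\<close>
  define H where "H x t = K t * \<omega> t powr (1 - p) * \<bar>\<Phi> x t\<bar> powr p" for x t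
  have H0: "0 \<le> H x t" for x t using K by (simp add: H_def)
  have H_meas [measurable]: "(\<lambda>(x, t). H x t) \<in> borel_measurable (circ \<Otimes>\<^sub>M circ)"
    unfolding H_def by measurable
  have H_fibre: "integrable circ (\<lambda>t. H x t)" if "x \<in> {0..2*pi}" for x
  proof -
    obtain B where "\<forall>t\<in>{0..2*pi}. \<bar>K t * \<omega> t powr (1 - p)\<bar> \<le> B"
      using cont_bdd[OF cKw] by blast
    then have "integrable circ (\<lambda>t. \<bar>\<Phi> x t\<bar> powr p * (K t * \<omega> t powr (1 - p)))"
      using fibre[OF that] by (intro integrable_mult_bounded_circ[where B=B]) (auto simp: in_Lp_def)
    then show ?thesis by (simp add: H_def mult_ac)
  qed
  \<comment> \<open>Jensen's inequality for the weight \<open>K \<omega>\<close>, read off from the tangent at the mean value.\<close>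
  have jensen: "\<bar>LINT t|circ. K t * \<Phi> x t\<bar> powr p \<le> \<Omega> powr (p - 1) * (LINT t|circ. H x t)"
    if x: "x \<in> {0..2*pi}" for x
  proof -
    have i\<Phi>: "integrable circ (\<lambda>t. \<Phi> x t)"
      using fibre[OF x] p by (rule in_Lp_integrable)
    obtain B where B: "\<forall>t\<in>{0..2*pi}. \<bar>K t\<bar> \<le> B"
      using cont_bdd K by blast
    have "integrable circ (\<lambda>t. \<bar>\<Phi> x t\<bar> * K t)"
      using i\<Phi> B by (intro integrable_mult_bounded_circ[where B=B]) auto
    then have iK\<Phi>: "integrable circ (\<lambda>t. K t * \<bar>\<Phi> x t\<bar>)" by (simp add: mult.commute)
    define m where "m = (LINT t|circ. K t * \<bar>\<Phi> x t\<bar>)"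
    have m0: "0 \<le> m" unfolding m_def using K by (intro integral_nonneg_AE AE_I2) auto
    have "\<bar>LINT t|circ. K t * \<Phi> x t\<bar> \<le> (LINT t|circ. \<bar>K t * \<Phi> x t\<bar>)"
      by (rule integral_abs_bound)
    also have "\<dots> = m" using K by (simp add: m_def abs_mult)
    finally have m: "\<bar>LINT t|circ. K t * \<Phi> x t\<bar> \<le> m" .
    have R0: "0 \<le> \<Omega> powr (p - 1) * (LINT t|circ. H x t)"
      using H0 by (intro mult_nonneg_nonneg integral_nonneg_AE AE_I2) auto
    show ?thesis
    proof (cases "m = 0")
      case True
      with m R0 show ?thesis by simp
    next
      case False
      \<comment> \<open>Total mass 0 would force K = 0 almost everywhere, since \<omega> > 0, and
        then m = 0.\<close>
      have "\<Omega> \<noteq> 0"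
      proof
        assume "\<Omega> = 0"
        moreover have "AE t in circ. 0 \<le> K t * \<omega> t"
          by (rule AE_I2) (simp add: K(2) less_imp_le[OF \<omega>(2)])
        ultimately have "AE t in circ. K t * \<omega> t = 0"
          using integral_nonneg_eq_0_iff_AE[OF iK\<omega>] unfolding \<Omega>_def by simp
        then have "AE t in circ. K t * \<bar>\<Phi> x t\<bar> = 0"
        proof eventually_elim
          case (elim t)
          then show ?case using \<omega>(2)[of t] by simp
        qed
        then have "m = 0" unfolding m_def by (rule integral_eq_zero_AE)
        with False show False by simp
      qed
      with \<Omega>0 have \<Omega>: "\<Omega> > 0" by simp
      define c where "c = m / \<Omega>"
      have c: "c > 0" using m0 False \<Omega> by (simp add: c_def)
      have pw: "c powr p * (K t * \<omega> t) + p * c powr (p - 1) * (K t * \<bar>\<Phi> x t\<bar> - c * (K t * \<omega> t)) \<le> H x t" for t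
      proof -
        have "K t * \<omega> t * (c powr p + p * c powr (p - 1) * (\<bar>\<Phi> x t\<bar> / \<omega> t - c)) \<le> K t * \<omega> t * (\<bar>\<Phi> x t\<bar> / \<omega> t) powr p"
          using p c K \<omega>(2)[of t] by (intro mult_left_mono powr_ge_tangent) auto
        moreover have "K t * \<omega> t * (\<bar>\<Phi> x t\<bar> / \<omega> t) powr p = H x t"
          using \<omega>(2)[of t] by (simp add: H_def powr_divide powr_diff field_simps)
        moreover have "K t * \<omega> t * (c powr p + p * c powr (p - 1) * (\<bar>\<Phi> x t\<bar> / \<omega> t - c)) =
           c powr p * (K t * \<omega> t) + p * c powr (p - 1) * (K t * \<bar>\<Phi> x t\<bar> - c * (K t * \<omega> t))"
          using \<omega>(2)[of t] by (simp add: field_simps)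
        ultimately show ?thesis by simp
      qed
      have "(LINT t|circ. c powr p * (K t * \<omega> t) + p * c powr (p - 1) * (K t * \<bar>\<Phi> x t\<bar> - c * (K t * \<omega> t))) \<le> (LINT t|circ. H x t)"
        using iK\<omega> iK\<Phi> H_fibre[OF x] pw by (intro integral_mono) auto
      moreover have "(LINT t|circ. c powr p * (K t * \<omega> t) + p * c powr (p - 1) * (K t * \<bar>\<Phi> x t\<bar> - c * (K t * \<omega> t)))
         = c powr p * \<Omega> + p * c powr (p - 1) * (m - c * \<Omega>)"
        using iK\<omega> iK\<Phi> by (simp add: m_def \<Omega>_def)
      moreover have "m - c * \<Omega> = 0" using \<Omega> by (simp add: c_def)
      ultimately have *: "c powr p * \<Omega> \<le> (LINT t|circ. H x t)" by simp
      have "m powr p = \<Omega> powr (p - 1) * (c powr p * \<Omega>)"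
        using \<Omega> m0 by (simp add: c_def powr_divide powr_diff)
      also have "\<dots> \<le> \<Omega> powr (p - 1) * (LINT t|circ. H x t)"
        using * by (intro mult_left_mono) auto
      finally have "m powr p \<le> \<Omega> powr (p - 1) * (LINT t|circ. H x t)" .
      moreover have "\<bar>LINT t|circ. K t * \<Phi> x t\<bar> powr p \<le> m powr p"
        using m p by (intro powr_mono2) auto
      ultimately show ?thesis by linarith
    qed
  qed
  interpret P: pair_sigma_finite circ circ by (rule pair_sigma_finite_circ)
  have swap_le: "(LINT x|circ. H x t) \<le> 2 * pi * (K t * \<omega> t)" if t: "t \<in> {0..2*pi}" for t
  proof -
    have "(LINT x|circ. H x t) = K t * \<omega> t powr (1 - p) * (LINT x|circ. \<bar>\<Phi> x t\<bar> powr p)"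
      unfolding H_def by simp
    also have "\<dots> \<le> K t * \<omega> t powr (1 - p) * (2 * pi * \<omega> t powr p)"
      using K p le[OF t] by (intro mult_left_mono Lp_integral_leI) auto
    also have "\<dots> = 2 * pi * (K t * \<omega> t)"
      using \<omega>(2)[of t] by (simp add: powr_diff field_simps)
    finally show ?thesis .
  qed
  have swap_int: "integrable circ (\<lambda>t. LINT x|circ. H x t)"
  proof (rule Bochner_Integration.integrable_bound)
    show "integrable circ (\<lambda>t. 2 * pi * (K t * \<omega> t))" using iK\<omega> by simp
    show "(\<lambda>t. LINT x|circ. H x t) \<in> borel_measurable circ"
      using P.sigma_finite_measure_axioms P.M1.sigma_finite_measure_axioms
      by (intro sigma_finite_measure.borel_measurable_lebesgue_integral) (auto simp: case_prod_beta)
    show "AE t in circ. norm (LINT x|circ. H x t) \<le> norm (2 * pi * (K t * \<omega> t))"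
    proof (rule AE_I2)
      fix t assume "t \<in> space circ"
      then have "(LINT x|circ. H x t) \<le> 2 * pi * (K t * \<omega> t)" using swap_le by simp
      moreover have "0 \<le> (LINT x|circ. H x t)" using H0 by (intro integral_nonneg_AE AE_I2) auto
      ultimately show "norm (LINT x|circ. H x t) \<le> norm (2 * pi * (K t * \<omega> t))" by simp
    qed
  qed
  \<comment> \<open>Integrability on the product is obtained with \<open>t\<close> as the outer
    variable, because the bound on the inner integral is available in that order; the variables are
    swapped afterwards.\<close>
  have H'_int: "integrable (circ \<Otimes>\<^sub>M circ) (\<lambda>(t, x). H x t)"
  proof (rule P.Fubini_integrable)
    show "(\<lambda>(t, x). H x t) \<in> borel_measurable (circ \<Otimes>\<^sub>M circ)" by measurable
    show "integrable circ (\<lambda>t. LINT x|circ. norm (case (t, x) of (t, x) \<Rightarrow> H x t))"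
      using swap_int H0 by simp
    show "AE t in circ. integrable circ (\<lambda>x. case (t, x) of (t, x) \<Rightarrow> H x t)"
    proof (rule AE_I2)
      fix t assume "t \<in> space circ"
      then show "integrable circ (\<lambda>x. case (t, x) of (t, x) \<Rightarrow> H x t)"
        using fibre' by (auto simp: H_def in_Lp_def)
    qed
  qed
  have H_int: "integrable (circ \<Otimes>\<^sub>M circ) (\<lambda>(x, t). H x t)"
    using P.integrable_product_swap_iff[of "\<lambda>(t, x). H x t"] H'_int by simp
  have fub: "(LINT x|circ. LINT t|circ. H x t) = (LINT t|circ. LINT x|circ. H x t)"
    using P.Fubini_integral[OF H_int] by simp
  have iH: "integrable circ (\<lambda>x. LINT t|circ. H x t)"
    using P.integrable_fst'[OF H_int] by simp
  have mI: "(\<lambda>x. LINT t|circ. K t * \<Phi> x t) \<in> borel_measurable circ"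
    using P.M1.sigma_finite_measure_axioms
    by (intro sigma_finite_measure.borel_measurable_lebesgue_integral) auto
  show in_Lp: "in_Lp p (\<lambda>x. LINT t|circ. K t * \<Phi> x t)"
    by (rule in_LpI_dominated[OF mI _ jensen]) (use iH in auto)
  show "Lp_norm p (\<lambda>x. LINT t|circ. K t * \<Phi> x t) \<le> (LINT t|circ. K t * \<omega> t)"
    unfolding \<Omega>_def[symmetric]
  proof (rule Lp_norm_leI)
    have "(LINT x|circ. \<bar>LINT t|circ. K t * \<Phi> x t\<bar> powr p) \<le> (LINT x|circ. \<Omega> powr (p - 1) * (LINT t|circ. H x t))"
      using iH in_Lp jensen by (intro integral_mono) (auto simp: in_Lp_def)
    also have "\<dots> = \<Omega> powr (p - 1) * (LINT t|circ. LINT x|circ. H x t)"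
      by (simp add: fub)
    also have "\<dots> \<le> \<Omega> powr (p - 1) * (LINT t|circ. 2 * pi * (K t * \<omega> t))"
      using swap_int iK\<omega> swap_le by (intro mult_left_mono integral_mono) auto
    also have "\<dots> = 2 * pi * \<Omega> powr p"
      using \<Omega>0 by (cases "\<Omega> = 0") (auto simp: \<Omega>_def powr_diff)
    finally show "(LINT x|circ. \<bar>LINT t|circ. K t * \<Phi> x t\<bar> powr p) \<le> 2 * pi * \<Omega> powr p" .
  qed (use p \<Omega>0 in auto)
qed

section \<open>Trigonometric polynomials\<close>

text \<open>The sine at k = 0 vanishes, so \<open>b 0\<close> is arbitrary; keeping it gives both
  families the same index range.\<close>

definition trig_poly :: "nat \<Rightarrow> (real \<Rightarrow> real) set" where
  "trig_poly n = {g. \<exists>a b. \<forall>x. g x = (\<Sum>k\<le>n. a k * cos (real k * x) + b k * sin (real k * x))}"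

lemma trig_polyI:
  "(\<And>x. g x = (\<Sum>k\<le>n. a k * cos (real k * x) + b k * sin (real k * x))) \<Longrightarrow> g \<in> trig_poly n"
  by (auto simp: trig_poly_def)

lemma trig_poly_mono:
  assumes "g \<in> trig_poly n" "n \<le> m"
  shows "g \<in> trig_poly m"
proof -
  obtain a b where ab: "\<And>x. g x = (\<Sum>k\<le>n. a k * cos (real k * x) + b k * sin (real k * x))"
    using assms(1) by (auto simp: trig_poly_def)
  have "g x = (\<Sum>k\<le>m. (if k \<le> n then a k else 0) * cos (real k * x) + (if k \<le> n then b k else 0) * sin (real k * x))" for x
    unfolding ab by (rule sum.mono_neutral_cong_left) (use assms(2) in auto)
  then show ?thesis by (rule trig_polyI)
qed

lemma trig_poly_add: "g \<in> trig_poly n \<Longrightarrow> h \<in> trig_poly n \<Longrightarrow> (\<lambda>x. g x + h x) \<in> trig_poly n"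
proof -
  assume "g \<in> trig_poly n" "h \<in> trig_poly n"
  then obtain a b c d where "\<And>x. g x = (\<Sum>k\<le>n. a k * cos (real k * x) + b k * sin (real k * x))"
     "\<And>x. h x = (\<Sum>k\<le>n. c k * cos (real k * x) + d k * sin (real k * x))"
    by (auto simp: trig_poly_def)
  then have "g x + h x = (\<Sum>k\<le>n. (a k + c k) * cos (real k * x) + (b k + d k) * sin (real k * x))" for x
    by (simp add: sum.distrib[symmetric] algebra_simps)
  then show ?thesis by (rule trig_polyI)
qed

lemma trig_poly_cmult: "g \<in> trig_poly n \<Longrightarrow> (\<lambda>x. c * g x) \<in> trig_poly n"
proof -
  assume "g \<in> trig_poly n"
  then obtain a b where "\<And>x. g x = (\<Sum>k\<le>n. a k * cos (real k * x) + b k * sin (real k * x))"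
    by (auto simp: trig_poly_def)
  then have "c * g x = (\<Sum>k\<le>n. (c * a k) * cos (real k * x) + (c * b k) * sin (real k * x))" for x
    by (simp add: sum_distrib_left algebra_simps)
  then show ?thesis by (rule trig_polyI)
qed

lemma trig_poly_diff: "g \<in> trig_poly n \<Longrightarrow> h \<in> trig_poly n \<Longrightarrow> (\<lambda>x. g x - h x) \<in> trig_poly n"
  using trig_poly_add[of g n "\<lambda>x. (-1) * h x"] trig_poly_cmult[of h n "-1"] by simp

lemma trig_poly_cos: "k \<le> n \<Longrightarrow> (\<lambda>x. cos (real k * x)) \<in> trig_poly n"
  by (rule trig_polyI[where a="\<lambda>j. if j = k then 1 else 0" and b="\<lambda>_. 0"]) (simp add: if_distrib[of "\<lambda>z. z * _"] cong: if_cong)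

lemma trig_poly_sin: "k \<le> n \<Longrightarrow> (\<lambda>x. sin (real k * x)) \<in> trig_poly n"
  by (rule trig_polyI[where b="\<lambda>j. if j = k then 1 else 0" and a="\<lambda>_. 0"]) (simp add: if_distrib[of "\<lambda>z. z * _"] cong: if_cong)

lemma trig_poly_const: "(\<lambda>x. c) \<in> trig_poly n"
  using trig_poly_cmult[OF trig_poly_cos[of 0 n], of c] by simp

lemma trig_poly_sum: "(\<And>i. i \<in> A \<Longrightarrow> F i \<in> trig_poly n) \<Longrightarrow> (\<lambda>x. \<Sum>i\<in>A. F i x) \<in> trig_poly n"
  by (induction A rule: infinite_finite_induct) (auto intro!: trig_poly_const trig_poly_add)

text \<open>Many facts below are linear in the polynomial, so only the pure frequencies have to be
  computed. Membership is supplied in the \<open>add\<close> case since additivity of an integral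
  asks for integrable summands.\<close>

lemma trig_poly_induct [consumes 1, case_names cos sin add cmult]:
  assumes g: "g \<in> trig_poly n"
    and cos: "\<And>k. k \<le> n \<Longrightarrow> P (\<lambda>x. cos (real k * x))"
    and sin: "\<And>k. k \<le> n \<Longrightarrow> P (\<lambda>x. sin (real k * x))"
    and add: "\<And>g h. g \<in> trig_poly n \<Longrightarrow> h \<in> trig_poly n \<Longrightarrow> P g \<Longrightarrow> P h \<Longrightarrow> P (\<lambda>x. g x + h x)"
    and cmult: "\<And>c g. g \<in> trig_poly n \<Longrightarrow> P g \<Longrightarrow> P (\<lambda>x. c * g x)"
  shows "P g"
proof -
  obtain a b where ab: "\<And>x. g x = (\<Sum>k\<le>n. a k * cos (real k * x) + b k * sin (real k * x))"
    using g by (auto simp: trig_poly_def)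
  have summand: "P (\<lambda>x. a k * cos (real k * x) + b k * sin (real k * x)) \<and>
      (\<lambda>x. a k * cos (real k * x) + b k * sin (real k * x)) \<in> trig_poly n" if "k \<le> n" for k
    using that by (intro conjI add cmult cos sin trig_poly_add trig_poly_cmult trig_poly_cos trig_poly_sin)
  have "P (\<lambda>x. \<Sum>k\<le>m. a k * cos (real k * x) + b k * sin (real k * x)) \<and>
     (\<lambda>x. \<Sum>k\<le>m. a k * cos (real k * x) + b k * sin (real k * x)) \<in> trig_poly n" if "m \<le> n" for m
    using that
  proof (induction m)
    case 0
    then show ?case using summand[of 0] by simp
  next
    case (Suc m)
    then show ?case using summand[of "Suc m"] add trig_poly_add by simp
  qed
  moreover have "g = (\<lambda>x. \<Sum>k\<le>n. a k * cos (real k * x) + b k * sin (real k * x))"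
    using ab by (rule ext)
  ultimately show ?thesis by simp
qed

text \<open>Frequencies are natural numbers, so a difference k - l with k < l is folded back by
  parity, here and for the sine.\<close>

lemma cos_nat_diff: "cos (real k * x - real l * x) = cos (real (if k \<ge> l then k - l else l - k) * x)"
proof (cases "k \<ge> l")
  case False
  then have "cos (real (l - k) * x) = cos (- (real k * x - real l * x))"
    by (simp add: of_nat_diff left_diff_distrib)
  with False show ?thesis by (simp only: cos_minus if_False)
qed (simp add: of_nat_diff left_diff_distrib)

lemma sin_nat_diff: "sin (real k * x - real l * x) = (if k \<ge> l then sin (real (k - l) * x) else - sin (real (l - k) * x))"
proof (cases "k \<ge> l")
  case True
  then show ?thesis by (simp add: of_nat_diff left_diff_distrib)
next
  case False
  then have "- sin (real (l - k) * x) = sin (- (real (l - k) * x))" by simp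
  also have "- (real (l - k) * x) = real k * x - real l * x"
    using False by (simp add: of_nat_diff left_diff_distrib)
  finally show ?thesis using False by simp
qed

lemma trig_poly_mult:
  assumes g: "g \<in> trig_poly n" and h: "h \<in> trig_poly m"
  shows "(\<lambda>x. g x * h x) \<in> trig_poly (n + m)"
proof -
  have half: "(\<lambda>x. (u x + v x) / 2) \<in> trig_poly N" "(\<lambda>x. (u x - v x) / 2) \<in> trig_poly N"
    if "u \<in> trig_poly N" "v \<in> trig_poly N" for u v N
    using trig_poly_cmult[OF trig_poly_add[OF that], of "1/2"] trig_poly_cmult[OF trig_poly_diff[OF that], of "1/2"]
    by simp_all
  have sum: "(\<lambda>x. cos (real k * x + real l * x)) \<in> trig_poly (n + m)"
     "(\<lambda>x. sin (real k * x + real l * x)) \<in> trig_poly (n + m)" if "k \<le> n" "l \<le> m" for k l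
    using that trig_poly_cos[of "k + l" "n + m"] trig_poly_sin[of "k + l" "n + m"]
    by (simp_all add: distrib_right)
  have diff: "(\<lambda>x. cos (real k * x - real l * x)) \<in> trig_poly (n + m)"
     "(\<lambda>x. sin (real k * x - real l * x)) \<in> trig_poly (n + m)" if "k \<le> n" "l \<le> m" for k l
  proof -
    show "(\<lambda>x. cos (real k * x - real l * x)) \<in> trig_poly (n + m)"
      unfolding cos_nat_diff using that by (intro trig_poly_cos) auto
    show "(\<lambda>x. sin (real k * x - real l * x)) \<in> trig_poly (n + m)"
      unfolding sin_nat_diff
      using that trig_poly_sin[of "k - l" "n + m"] trig_poly_cmult[OF trig_poly_sin[of "l - k" "n + m"], of "-1"]
      by (cases "k \<ge> l") simp_all
  qed
  have basis: "(\<lambda>x. cos (real k * x) * h x) \<in> trig_poly (n + m) \<and> (\<lambda>x. sin (real k * x) * h x) \<in> trig_poly (n + m)"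
    if k: "k \<le> n" for k
    using h
  proof (induction h rule: trig_poly_induct)
    case (cos l)
    then show ?case unfolding cos_times_cos sin_times_cos using sum diff k by (auto intro!: half)
  next
    case (sin l)
    then show ?case unfolding cos_times_sin sin_times_sin using sum diff k by (auto intro!: half)
  next
    case (add u v)
    then show ?case by (auto simp: distrib_left intro: trig_poly_add)
  next
    case (cmult c u)
    then show ?case using trig_poly_cmult[of _ "n + m" c] by (auto simp: mult.left_commute)
  qed
  from g show ?thesis
  proof (induction g rule: trig_poly_induct)
    case (add u v)
    then show ?case by (auto simp: distrib_right intro: trig_poly_add)
  next
    case (cmult c u)
    then show ?case using trig_poly_cmult[of _ "n + m" c] by (auto simp: mult.assoc)
  qed (use basis in auto)
qed

lemma trig_poly_continuous: "g \<in> trig_poly n \<Longrightarrow> continuous_on S g"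
  by (induction g rule: trig_poly_induct) (auto intro!: continuous_intros)

lemma trig_poly_measurable: "g \<in> trig_poly n \<Longrightarrow> g \<in> borel_measurable borel"
  using trig_poly_continuous by (intro borel_measurable_continuous_onI)

lemma trig_poly_periodic: "g \<in> trig_poly n \<Longrightarrow> g (x + 2 * pi) = g x"
proof (induction g rule: trig_poly_induct)
  case (cos k)
  have "cos (real k * (x + 2 * pi)) = cos (real k * x + of_nat k * (2 * pi))" by (simp add: algebra_simps)
  then show ?case using cos.plus_of_nat[of "real k * x" k] by simp
next
  case (sin k)
  have "sin (real k * (x + 2 * pi)) = sin (real k * x + of_nat k * (2 * pi))" by (simp add: algebra_simps)
  then show ?case using sin.plus_of_nat[of "real k * x" k] by simp
qed auto

lemma trig_poly_bounded: "g \<in> trig_poly n \<Longrightarrow> \<exists>B\<ge>0. \<forall>x. \<bar>g x\<bar> \<le> B"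
proof (induction g rule: trig_poly_induct)
  case (add g h)
  then obtain B C where "B \<ge> 0" "C \<ge> 0" "\<forall>x. \<bar>g x\<bar> \<le> B" "\<forall>x. \<bar>h x\<bar> \<le> C" by blast
  then have "\<bar>g x + h x\<bar> \<le> B + C" for x by (meson abs_triangle_ineq add_mono order_trans)
  then show ?case using \<open>B \<ge> 0\<close> \<open>C \<ge> 0\<close> by (metis add_nonneg_nonneg)
next
  case (cmult c g)
  then obtain B where "B \<ge> 0" "\<forall>x. \<bar>g x\<bar> \<le> B" by blast
  then show ?case by (intro exI[of _ "\<bar>c\<bar> * B"]) (auto simp: abs_mult mult_left_mono)
qed (auto intro!: exI[of _ 1])

lemma trig_poly_periodic_Lp:
  assumes "g \<in> trig_poly n" "0 \<le> p"
  shows "g \<in> periodic_Lp p"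
proof -
  obtain B where "\<forall>x. \<bar>g x\<bar> \<le> B" using trig_poly_bounded[OF assms(1)] by blast
  then have "in_Lp p g"
    using trig_poly_measurable[OF assms(1)] assms(2) by (intro in_Lp_bounded) auto
  then show ?thesis
    using trig_poly_measurable[OF assms(1)] trig_poly_periodic[OF assms(1)] by (simp add: periodic_Lp_def)
qed

lemma trig_poly_integrable: "g \<in> trig_poly n \<Longrightarrow> integrable circ g"
  using trig_poly_periodic_Lp[of g n 1] periodic_Lp_integrable[of g 1] by simp

lemma integrable_mult_trig_poly:
  assumes "integrable circ f" "g \<in> trig_poly n"
  shows "integrable circ (\<lambda>x. f x * g x)"
proof -
  obtain B where "\<forall>x. \<bar>g x\<bar> \<le> B" using trig_poly_bounded[OF assms(2)] by blast
  then show ?thesis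
    using assms trig_poly_measurable[OF assms(2)] by (intro integrable_mult_bounded_circ[where B=B]) auto
qed

lemma trig_poly_translate:
  "g \<in> trig_poly n \<Longrightarrow> (\<lambda>x. g (x + c)) \<in> trig_poly n"
proof (induction g rule: trig_poly_induct)
  case (cos k)
  have "(\<lambda>x. cos (real k * c) * cos (real k * x) - sin (real k * c) * sin (real k * x)) \<in> trig_poly n"
    using cos by (intro trig_poly_diff trig_poly_cmult trig_poly_cos trig_poly_sin)
  then show ?case by (simp add: distrib_left cos_add mult.commute)
next
  case (sin k)
  have "(\<lambda>x. cos (real k * c) * sin (real k * x) + sin (real k * c) * cos (real k * x)) \<in> trig_poly n"
    using sin by (intro trig_poly_add trig_poly_cmult trig_poly_cos trig_poly_sin)
  then show ?case by (simp add: distrib_left sin_add mult.commute)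
qed (auto intro: trig_poly_add trig_poly_cmult)

lemma trig_poly_reflect:
  "g \<in> trig_poly n \<Longrightarrow> (\<lambda>x. g (- x)) \<in> trig_poly n"
proof (induction g rule: trig_poly_induct)
  case (sin k)
  then show ?case using trig_poly_cmult[OF trig_poly_sin, of k n "-1"] by simp
qed (auto intro: trig_poly_add trig_poly_cmult trig_poly_cos)

lemma trig_poly_reflect':
  assumes "g \<in> trig_poly n" shows "(\<lambda>x. g (c - x)) \<in> trig_poly n"
  using trig_poly_reflect[OF trig_poly_translate[OF assms, of c]] by simp

lemma integrable_mult_translate_trig_poly:
  assumes "integrable circ f" "w \<in> trig_poly n"
  shows "integrable circ (\<lambda>t. f t * w (x - t))"
  using assms by (intro integrable_mult_trig_poly[where n=n] trig_poly_reflect') auto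

text \<open>The addition formulas separate x from t, so the degree of the kernel alone bounds the
  degree of the convolution, whatever f is.\<close>

lemma trig_poly_convolution:
  assumes f: "integrable circ f" and w: "w \<in> trig_poly n"
  shows "(\<lambda>x. LINT t|circ. f t * w (x - t)) \<in> trig_poly n"
  using w
proof (induction w rule: trig_poly_induct)
  case (cos k)
  note i = integrable_mult_trig_poly[OF f trig_poly_cos[of k k]] integrable_mult_trig_poly[OF f trig_poly_sin[of k k]]
  have "(LINT t|circ. f t * cos (real k * (x - t))) =
     (LINT t|circ. f t * cos (real k * t)) * cos (real k * x) + (LINT t|circ. f t * sin (real k * t)) * sin (real k * x)" for x
  proof -
    have "(LINT t|circ. f t * cos (real k * (x - t))) =
      (LINT t|circ. (f t * cos (real k * t)) * cos (real k * x) + (f t * sin (real k * t)) * sin (real k * x))"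
      by (simp add: right_diff_distrib cos_diff algebra_simps)
    then show ?thesis using i by simp
  qed
  then show ?case
    using cos by (auto intro!: trig_poly_add trig_poly_cmult trig_poly_cos trig_poly_sin)
next
  case (sin k)
  note i = integrable_mult_trig_poly[OF f trig_poly_cos[of k k]] integrable_mult_trig_poly[OF f trig_poly_sin[of k k]]
  have "(LINT t|circ. f t * sin (real k * (x - t))) =
     (LINT t|circ. f t * cos (real k * t)) * sin (real k * x) - (LINT t|circ. f t * sin (real k * t)) * cos (real k * x)" for x
  proof -
    have "(LINT t|circ. f t * sin (real k * (x - t))) =
      (LINT t|circ. (f t * cos (real k * t)) * sin (real k * x) - (f t * sin (real k * t)) * cos (real k * x))"
      by (simp add: right_diff_distrib sin_diff algebra_simps)
    then show ?thesis using i by simp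
  qed
  then show ?case
    using sin by (auto intro!: trig_poly_diff trig_poly_cmult trig_poly_cos trig_poly_sin)
next
  case (add g h)
  then show ?case
    using integrable_mult_translate_trig_poly[OF f] by (simp add: distrib_left trig_poly_add)
next
  case (cmult c g)
  then show ?case by (simp add: mult.left_commute trig_poly_cmult)
qed

lemma convolution_commute:
  fixes f w :: "real \<Rightarrow> real"
  assumes [measurable]: "f \<in> borel_measurable borel" "w \<in> borel_measurable borel"
    and per: "\<And>x. f (x + 2 * pi) = f x" "\<And>x. w (x + 2 * pi) = w x"
  shows "(LINT t|circ. f t * w (x - t)) = (LINT t|circ. w t * f (x - t))"
proof -
  have w': "w (x - (t + 2 * pi)) = w (x - t)" for t
    using per(2)[of "x - (t + 2 * pi)"] by (simp add: algebra_simps)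
  have "(LINT t|circ. f (x - t) * w (x - (x - t))) = (LINT t|circ. f t * w (x - t))"
    by (rule integral_reflect_circ[of "\<lambda>t. f t * w (x - t)" x]) (auto simp: per w')
  then show ?thesis by (simp add: mult.commute)
qed

section \<open>Fourier coefficients\<close>

lemma integral_cos_int: "(LINT x|circ. cos (of_int m * x)) = (if m = 0 then 2 * pi else 0)"
proof (cases "m = 0")
  case False
  have i: "integrable circ (\<lambda>x. cos (of_int m * x))"
    by (rule integrable_bounded_circ[where B=1]) auto
  have "((\<lambda>x. cos (of_int m * x)) has_integral (sin (of_int m * (2*pi)) / of_int m - sin (of_int m * 0) / of_int m)) {0..2*pi}"
    by (rule fundamental_theorem_of_calculus)
       (use False in \<open>auto intro!: derivative_eq_intros simp flip: has_real_derivative_iff_has_vector_derivative\<close>)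
  moreover have "sin (of_int m * (2*pi)) = 0"
    using sin_int_2pin[of m] by (simp add: mult_ac)
  ultimately have "integral {0..2*pi} (\<lambda>x. cos (of_int m * x)) = 0" by (simp add: integral_unique)
  then show ?thesis using False lebesgue_integral_eq_integral[OF i] by simp
qed simp

lemma integral_sin_int: "(LINT x|circ. sin (of_int m * x)) = 0"
proof (cases "m = 0")
  case False
  have i: "integrable circ (\<lambda>x. sin (of_int m * x))"
    by (rule integrable_bounded_circ[where B=1]) auto
  have "((\<lambda>x. sin (of_int m * x)) has_integral (- cos (of_int m * (2*pi)) / of_int m - (- cos (of_int m * 0) / of_int m))) {0..2*pi}"
    by (rule fundamental_theorem_of_calculus)
       (use False in \<open>auto intro!: derivative_eq_intros simp flip: has_real_derivative_iff_has_vector_derivative\<close>)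
  moreover have "cos (of_int m * (2*pi)) = 1"
    using cos_int_2pin[of m] by (simp add: mult_ac)
  ultimately have "integral {0..2*pi} (\<lambda>x. sin (of_int m * x)) = 0" by (simp add: integral_unique)
  then show ?thesis using lebesgue_integral_eq_integral[OF i] by simp
qed simp

lemma
  shows integral_cos_cos: "(LINT x|circ. cos (real j * x) * cos (real k * x)) = (if j = k then if k = 0 then 2 * pi else pi else 0)"
    and integral_sin_sin: "(LINT x|circ. sin (real j * x) * sin (real k * x)) = (if j = k \<and> k \<noteq> 0 then pi else 0)"
    and integral_cos_sin: "(LINT x|circ. cos (real j * x) * sin (real k * x)) = 0"
    and integral_sin_cos: "(LINT x|circ. sin (real j * x) * cos (real k * x)) = 0"
proof -
  have e: "real j * x - real k * x = of_int (int j - int k) * x" "real j * x + real k * x = of_int (int j + int k) * x" for x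
    by (auto simp: algebra_simps)
  have i: "integrable circ (\<lambda>x. cos (of_int m * x))" "integrable circ (\<lambda>x. sin (of_int m * x))" for m
    by (rule integrable_bounded_circ[where B=1]; auto)+
  show "(LINT x|circ. cos (real j * x) * cos (real k * x)) = (if j = k then if k = 0 then 2 * pi else pi else 0)"
    unfolding cos_times_cos e
    by (subst integral_divide_zero, subst Bochner_Integration.integral_add[OF i(1) i(1)], simp only: integral_cos_int) auto
  show "(LINT x|circ. sin (real j * x) * sin (real k * x)) = (if j = k \<and> k \<noteq> 0 then pi else 0)"
    unfolding sin_times_sin e
    by (subst integral_divide_zero, subst Bochner_Integration.integral_diff[OF i(1) i(1)], simp only: integral_cos_int) auto
  show "(LINT x|circ. cos (real j * x) * sin (real k * x)) = 0"
    unfolding cos_times_sin e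
    by (subst integral_divide_zero, subst Bochner_Integration.integral_diff[OF i(2) i(2)], simp only: integral_sin_int) auto
  show "(LINT x|circ. sin (real j * x) * cos (real k * x)) = 0"
    unfolding sin_times_cos e
    by (subst integral_divide_zero, subst Bochner_Integration.integral_add[OF i(2) i(2)], simp only: integral_sin_int) auto
qed

definition harmonic :: "(real \<Rightarrow> real) \<Rightarrow> nat \<Rightarrow> real \<Rightarrow> real" where
  "harmonic f k x = fourier_a f k * cos (real k * x) + fourier_b f k * sin (real k * x)"

text \<open>\<open>harmonic\<close> and \<open>conj_harmonic\<close> are the real and imaginary
  parts of (a - i b) e^(ikx), which makes them boundary values of one analytic monomial.\<close>

definition conj_harmonic :: "(real \<Rightarrow> real) \<Rightarrow> nat \<Rightarrow> real \<Rightarrow> real" where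
  "conj_harmonic f k x = fourier_a f k * sin (real k * x) - fourier_b f k * cos (real k * x)"

lemma fourier_sum_harmonic: "fourier_sum f n x = fourier_a f 0 / 2 + (\<Sum>k = 1..n. harmonic f k x)"
  by (simp add: fourier_sum_def harmonic_def)

lemma fourier_sum_Suc: "fourier_sum f (Suc n) x = fourier_sum f n x + harmonic f (Suc n) x"
  by (simp add: fourier_sum_harmonic)

lemma harmonic_trig_poly: "k \<le> n \<Longrightarrow> harmonic f k \<in> trig_poly n"
  unfolding harmonic_def [abs_def] by (intro trig_poly_add trig_poly_cmult trig_poly_cos trig_poly_sin)

lemma conj_harmonic_trig_poly: "k \<le> n \<Longrightarrow> conj_harmonic f k \<in> trig_poly n"
  unfolding conj_harmonic_def [abs_def] by (intro trig_poly_diff trig_poly_cmult trig_poly_cos trig_poly_sin)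

lemma fourier_sum_trig_poly: "n \<le> m \<Longrightarrow> fourier_sum f n \<in> trig_poly m"
  unfolding fourier_sum_harmonic [abs_def]
  by (intro trig_poly_add trig_poly_const trig_poly_sum harmonic_trig_poly) auto

lemma integrable_mult_cos_sin:
  assumes "integrable circ f"
  shows "integrable circ (\<lambda>t. f t * cos (real k * t))" "integrable circ (\<lambda>t. f t * sin (real k * t))"
  using integrable_mult_trig_poly[OF assms trig_poly_cos[of k k]] integrable_mult_trig_poly[OF assms trig_poly_sin[of k k]]
  by auto

lemma
  assumes f: "integrable circ f"
  shows harmonic_eq_integral: "harmonic f k x = 1 / pi * (LINT t|circ. f t * cos (real k * (x - t)))"
    and conj_harmonic_eq_integral: "conj_harmonic f k x = 1 / pi * (LINT t|circ. f t * sin (real k * (x - t)))"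
proof -
  note i = integrable_mult_cos_sin[OF f, of k]
  have "(LINT t|circ. f t * cos (real k * (x - t))) =
      (LINT t|circ. (f t * cos (real k * t)) * cos (real k * x) + (f t * sin (real k * t)) * sin (real k * x))"
    by (simp add: right_diff_distrib cos_diff algebra_simps)
  also have "\<dots> = (LINT t|circ. f t * cos (real k * t)) * cos (real k * x) + (LINT t|circ. f t * sin (real k * t)) * sin (real k * x)"
    using i by simp
  finally show "harmonic f k x = 1 / pi * (LINT t|circ. f t * cos (real k * (x - t)))"
    by (simp only: harmonic_def fourier_a_def fourier_b_def distrib_left mult.assoc)
  have "(LINT t|circ. f t * sin (real k * (x - t))) =
      (LINT t|circ. (f t * cos (real k * t)) * sin (real k * x) - (f t * sin (real k * t)) * cos (real k * x))"
    by (simp add: right_diff_distrib sin_diff algebra_simps)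
  also have "\<dots> = (LINT t|circ. f t * cos (real k * t)) * sin (real k * x) - (LINT t|circ. f t * sin (real k * t)) * cos (real k * x)"
    using i by simp
  finally show "conj_harmonic f k x = 1 / pi * (LINT t|circ. f t * sin (real k * (x - t)))"
    by (simp only: conj_harmonic_def fourier_a_def fourier_b_def right_diff_distrib mult.assoc)
qed

lemma
  assumes f: "integrable circ f" and g: "integrable circ g"
  shows fourier_a_add: "fourier_a (\<lambda>x. f x + g x) k = fourier_a f k + fourier_a g k"
    and fourier_b_add: "fourier_b (\<lambda>x. f x + g x) k = fourier_b f k + fourier_b g k"
    and fourier_a_diff: "fourier_a (\<lambda>x. f x - g x) k = fourier_a f k - fourier_a g k"
    and fourier_b_diff: "fourier_b (\<lambda>x. f x - g x) k = fourier_b f k - fourier_b g k"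
  using integrable_mult_cos_sin[OF f, of k] integrable_mult_cos_sin[OF g, of k]
  by (simp_all add: fourier_a_def fourier_b_def distrib_right left_diff_distrib distrib_left right_diff_distrib add_divide_distrib diff_divide_distrib)

lemma
  shows fourier_a_cmult: "fourier_a (\<lambda>x. c * f x) k = c * fourier_a f k"
    and fourier_b_cmult: "fourier_b (\<lambda>x. c * f x) k = c * fourier_b f k"
  by (simp_all add: fourier_a_def fourier_b_def mult.assoc)

lemma
  assumes f: "integrable circ f" and g: "integrable circ g"
  shows fourier_sum_add: "fourier_sum (\<lambda>x. f x + g x) n x = fourier_sum f n x + fourier_sum g n x"
    and fourier_sum_diff: "fourier_sum (\<lambda>x. f x - g x) n x = fourier_sum f n x - fourier_sum g n x"
  by (simp_all add: fourier_sum_def fourier_a_add[OF f g] fourier_b_add[OF f g] fourier_a_diff[OF f g] fourier_b_diff[OF f g]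
      sum.distrib[symmetric] sum_subtractf[symmetric] algebra_simps add_divide_distrib diff_divide_distrib)

lemma fourier_sum_cmult: "fourier_sum (\<lambda>x. c * f x) n x = c * fourier_sum f n x"
  by (simp add: fourier_sum_def fourier_a_cmult fourier_b_cmult distrib_left sum_distrib_left mult.assoc)

text \<open>The 2 at k = 0 undoes the convention a_0 / 2, and \<open>b 0\<close> leaves no trace
  because its sine vanishes.\<close>

lemma
  assumes g: "\<And>x. g x = (\<Sum>k\<le>n. a k * cos (real k * x) + b k * sin (real k * x))"
  shows fourier_a_trig_poly: "fourier_a g k = (if k \<le> n then if k = 0 then 2 * a 0 else a k else 0)"
    and fourier_b_trig_poly: "fourier_b g k = (if 1 \<le> k \<and> k \<le> n then b k else 0)"
proof -
  have ic: "integrable circ (\<lambda>x. cos (real j * x))" and isn: "integrable circ (\<lambda>x. sin (real j * x))" for j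
    using trig_poly_integrable[OF trig_poly_cos[of j j]] trig_poly_integrable[OF trig_poly_sin[of j j]] by auto
  note ii = integrable_mult_cos_sin[OF ic] integrable_mult_cos_sin[OF isn]
  have "(LINT x|circ. g x * cos (real k * x)) =
     (LINT x|circ. (\<Sum>j\<le>n. a j * (cos (real j * x) * cos (real k * x)) + b j * (sin (real j * x) * cos (real k * x))))"
    by (simp add: g sum_distrib_right distrib_right mult.assoc)
  also have "\<dots> = (\<Sum>j\<le>n. a j * (if j = k then if k = 0 then 2 * pi else pi else 0))"
    using ii by (simp add: integral_cos_cos integral_sin_cos)
  also have "\<dots> = (\<Sum>j\<le>n. if j = k then a j * (if k = 0 then 2 * pi else pi) else 0)"
    by (intro sum.cong) auto
  also have "\<dots> = (if k \<le> n then a k * (if k = 0 then 2 * pi else pi) else 0)"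
    by simp
  finally show "fourier_a g k = (if k \<le> n then if k = 0 then 2 * a 0 else a k else 0)"
    by (auto simp: fourier_a_def)
  have "(LINT x|circ. g x * sin (real k * x)) =
     (LINT x|circ. (\<Sum>j\<le>n. a j * (cos (real j * x) * sin (real k * x)) + b j * (sin (real j * x) * sin (real k * x))))"
    by (simp add: g sum_distrib_right distrib_right mult.assoc)
  also have "\<dots> = (\<Sum>j\<le>n. b j * (if j = k \<and> k \<noteq> 0 then pi else 0))"
    using ii by (simp add: integral_cos_sin integral_sin_sin)
  also have "\<dots> = (\<Sum>j\<le>n. if j = k then b j * (if k \<noteq> 0 then pi else 0) else 0)"
    by (intro sum.cong) auto
  also have "\<dots> = (if k \<le> n then b k * (if k \<noteq> 0 then pi else 0) else 0)"
    by simp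
  finally show "fourier_b g k = (if 1 \<le> k \<and> k \<le> n then b k else 0)"
    by (auto simp: fourier_b_def)
qed

lemma fourier_trig_poly_zero:
  assumes "g \<in> trig_poly n" "n < k"
  shows "fourier_a g k = 0" "fourier_b g k = 0"
proof -
  obtain a b where ab: "\<And>x. g x = (\<Sum>k\<le>n. a k * cos (real k * x) + b k * sin (real k * x))"
    using assms(1) by (auto simp: trig_poly_def)
  show "fourier_a g k = 0" "fourier_b g k = 0"
    using fourier_a_trig_poly[OF ab, of k] fourier_b_trig_poly[OF ab, of k] assms(2) by auto
qed

lemma fourier_sum_trig_poly_eq:
  assumes g: "g \<in> trig_poly n" and nm: "n \<le> m"
  shows "fourier_sum g m x = g x"
proof -
  obtain a b where ab: "\<And>x. g x = (\<Sum>k\<le>m. a k * cos (real k * x) + b k * sin (real k * x))"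
    using trig_poly_mono[OF g nm] by (auto simp: trig_poly_def)
  have "fourier_sum g m x = a 0 + (\<Sum>k=1..m. a k * cos (real k * x) + b k * sin (real k * x))"
    unfolding fourier_sum_def fourier_a_trig_poly[OF ab] fourier_b_trig_poly[OF ab]
    by (auto intro!: sum.cong)
  also have "\<dots> = (\<Sum>k\<in>insert 0 {1..m}. a k * cos (real k * x) + b k * sin (real k * x))"
    by (subst sum.insert) auto
  also have "insert 0 {1..m} = {..m}" by auto
  finally show ?thesis by (rule trans) (rule ab[symmetric])
qed

section \<open>The Fejer kernel and Jackson's theorem\<close>

text \<open>The sum of e^(iks) over |k| \<le> n. It has mean value 1, which explains the factor 1 /
  (2 pi) in the convolution formulas.\<close>

definition dirichlet_kernel :: "nat \<Rightarrow> real \<Rightarrow> real" where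
  "dirichlet_kernel n s = 1 + 2 * (\<Sum>k=1..n. cos (real k * s))"

definition fejer_kernel :: "nat \<Rightarrow> real \<Rightarrow> real" where
  "fejer_kernel n s = (\<Sum>j\<le>n. dirichlet_kernel j s) / (real n + 1)"

definition fejer_mean :: "(real \<Rightarrow> real) \<Rightarrow> nat \<Rightarrow> real \<Rightarrow> real" where
  "fejer_mean f n x = (\<Sum>j\<le>n. fourier_sum f j x) / (real n + 1)"

lemma dirichlet_kernel_trig_poly: "n \<le> m \<Longrightarrow> dirichlet_kernel n \<in> trig_poly m"
  unfolding dirichlet_kernel_def [abs_def]
  by (intro trig_poly_add trig_poly_const trig_poly_cmult trig_poly_sum trig_poly_cos) auto

lemma fejer_kernel_trig_poly: "fejer_kernel n \<in> trig_poly n"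
  using trig_poly_cmult[of "\<lambda>s. \<Sum>j\<le>n. dirichlet_kernel j s" n "1 / (real n + 1)"]
  by (auto simp: fejer_kernel_def [abs_def] intro!: trig_poly_sum dirichlet_kernel_trig_poly)

lemma fejer_mean_trig_poly: "fejer_mean f n \<in> trig_poly n"
  using trig_poly_cmult[of "\<lambda>s. \<Sum>j\<le>n. fourier_sum f j s" n "1 / (real n + 1)"]
  by (auto simp: fejer_mean_def [abs_def] intro!: trig_poly_sum fourier_sum_trig_poly)

lemma sum_taper:
  fixes u :: "nat \<Rightarrow> real"
  shows "(\<Sum>j\<le>n. \<Sum>k=1..j. u k) = (\<Sum>k=1..n. (real n + 1 - real k) * u k)"
proof (induction n)
  case (Suc n)
  have "(\<Sum>k=1..Suc n. (real (Suc n) + 1 - real k) * u k) =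
     (\<Sum>k=1..Suc n. (real n + 1 - real k) * u k + u k)"
    by (intro sum.cong) (auto simp: algebra_simps)
  also have "\<dots> = (\<Sum>k=1..n. (real n + 1 - real k) * u k) + (\<Sum>k=1..Suc n. u k)"
    by (simp add: sum.distrib)
  finally show ?case using Suc by simp
qed simp

lemma sum_taper_divide:
  fixes u :: "nat \<Rightarrow> real"
  shows "(\<Sum>j\<le>n. c + (\<Sum>k=1..j. u k)) / (real n + 1) = c + (\<Sum>k=1..n. (1 - real k / (real n + 1)) * u k)"
proof -
  have "(\<Sum>j\<le>n. c + (\<Sum>k=1..j. u k)) / (real n + 1) = c + (\<Sum>k=1..n. (real n + 1 - real k) * u k) / (real n + 1)"
    using sum_taper[of u n] by (simp add: sum.distrib add_divide_distrib add.commute[of 1])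
  also have "(\<Sum>k=1..n. (real n + 1 - real k) * u k) / (real n + 1) = (\<Sum>k=1..n. (1 - real k / (real n + 1)) * u k)"
    by (subst sum_divide_distrib) (intro sum.cong, auto simp: field_simps)
  finally show ?thesis .
qed

lemma fejer_mean_eq: "fejer_mean f n x = fourier_a f 0 / 2 + (\<Sum>k=1..n. (1 - real k / (real n + 1)) * harmonic f k x)"
  unfolding fejer_mean_def fourier_sum_harmonic by (rule sum_taper_divide)

lemma fejer_kernel_eq: "fejer_kernel n s = 1 + 2 * (\<Sum>k=1..n. (1 - real k / (real n + 1)) * cos (real k * s))"
  using sum_taper_divide[of 1 "\<lambda>k. 2 * cos (real k * s)" n]
  unfolding fejer_kernel_def dirichlet_kernel_def by (simp add: sum_distrib_left mult.left_commute)

lemma fourier_sum_eq_integral: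
  assumes f: "integrable circ f"
  shows "fourier_sum f n x = 1 / (2 * pi) * (LINT t|circ. f t * dirichlet_kernel n (x - t))"
proof -
  have i: "integrable circ (\<lambda>t. f t * cos (real k * (x - t)))" for k
    by (rule integrable_mult_translate_trig_poly[OF f trig_poly_cos[of k k]]) auto
  have "(LINT t|circ. f t * dirichlet_kernel n (x - t)) =
     (LINT t|circ. f t + 2 * (\<Sum>k=1..n. f t * cos (real k * (x - t))))"
    unfolding dirichlet_kernel_def by (simp add: distrib_left sum_distrib_left mult.left_commute)
  also have "\<dots> = (LINT t|circ. f t) + 2 * (\<Sum>k=1..n. (LINT t|circ. f t * cos (real k * (x - t))))"
    using i f by simp
  finally show ?thesis
    unfolding fourier_sum_harmonic harmonic_eq_integral[OF f]
    by (simp add: fourier_a_def sum_distrib_left[symmetric] field_simps sum_divide_distrib[symmetric])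
qed

lemma fejer_mean_eq_integral:
  assumes f: "integrable circ f"
  shows "fejer_mean f n x = 1 / (2 * pi) * (LINT t|circ. f t * fejer_kernel n (x - t))"
proof -
  have i: "integrable circ (\<lambda>t. f t * dirichlet_kernel j (x - t))" for j
    by (rule integrable_mult_translate_trig_poly[OF f dirichlet_kernel_trig_poly[of j j]]) auto
  have "(LINT t|circ. f t * fejer_kernel n (x - t)) = (LINT t|circ. (\<Sum>j\<le>n. f t * dirichlet_kernel j (x - t)) / (real n + 1))"
    by (simp add: fejer_kernel_def sum_distrib_left)
  also have "\<dots> = (\<Sum>j\<le>n. (LINT t|circ. f t * dirichlet_kernel j (x - t))) / (real n + 1)"
    using i by simp
  finally show ?thesis
    unfolding fejer_mean_def fourier_sum_eq_integral[OF f]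
    by (simp only: sum_distrib_left[symmetric]) simp
qed

lemma fourier_sum_eq_integral':
  assumes "f \<in> periodic_Lp p" "1 \<le> p"
  shows "fourier_sum f n x = 1 / (2 * pi) * (LINT t|circ. dirichlet_kernel n t * f (x - t))"
  unfolding fourier_sum_eq_integral[OF periodic_Lp_integrable[OF assms]]
  using assms(1) dirichlet_kernel_trig_poly[of n n]
  by (subst convolution_commute) (auto intro: trig_poly_measurable trig_poly_periodic simp: periodic_Lp_def)

lemma fejer_mean_eq_integral':
  assumes "f \<in> periodic_Lp p" "1 \<le> p"
  shows "fejer_mean f n x = 1 / (2 * pi) * (LINT t|circ. fejer_kernel n t * f (x - t))"
  unfolding fejer_mean_eq_integral[OF periodic_Lp_integrable[OF assms]]
  using assms(1) fejer_kernel_trig_poly[of n]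
  by (subst convolution_commute) (auto intro: trig_poly_measurable trig_poly_periodic simp: periodic_Lp_def)

lemma sin_half_dirichlet_kernel: "sin (s / 2) * dirichlet_kernel n s = sin ((2 * real n + 1) * (s / 2))"
proof (induction n)
  case 0
  then show ?case by (simp add: dirichlet_kernel_def)
next
  case (Suc n)
  have "dirichlet_kernel (Suc n) s = dirichlet_kernel n s + 2 * cos (real (Suc n) * s)"
    by (simp add: dirichlet_kernel_def)
  then have "sin (s / 2) * dirichlet_kernel (Suc n) s = sin ((2 * real n + 1) * (s / 2)) + 2 * (sin (s/2) * cos (real (Suc n) * s))"
    using Suc by (simp add: algebra_simps)
  also have "2 * (sin (s/2) * cos (real (Suc n) * s)) = sin (s/2 + real (Suc n) * s) + sin (s/2 - real (Suc n) * s)"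
    by (simp only: sin_times_cos) simp
  also have "s/2 + real (Suc n) * s = (2 * real (Suc n) + 1) * (s/2)"
    by (simp add: field_simps)
  also have "s/2 - real (Suc n) * s = - ((2 * real n + 1) * (s/2))"
    by (simp add: field_simps)
  finally show ?case by simp
qed

text \<open>The closed form is kept multiplied out, so it also holds at the zeros of sin (s / 2). It
  yields both the positivity of the kernel and its decay away from 0.\<close>

lemma sin_half_sq_fejer_kernel:
  "(sin (s / 2))\<^sup>2 * fejer_kernel n s = (sin ((real n + 1) * (s / 2)))\<^sup>2 / (real n + 1)"
proof -
  have "sin (s / 2) * (\<Sum>j\<le>n. sin ((2 * real j + 1) * (s / 2))) = (sin ((real n + 1) * (s / 2)))\<^sup>2"
  proof (induction n)
    case 0
    then show ?case by (simp add: power2_eq_square)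
  next
    case (Suc n)
    define y where "y = s / 2"
    have sq: "(sin z)\<^sup>2 = (1 - cos (2 * z)) / 2" for z :: real
      by (simp add: cos_double_sin)
    have "sin y * (\<Sum>j\<le>Suc n. sin ((2 * real j + 1) * y)) = (sin ((real n + 1) * y))\<^sup>2 + sin ((2 * real (Suc n) + 1) * y) * sin y"
      using Suc by (simp add: y_def algebra_simps)
    also have "sin ((2 * real (Suc n) + 1) * y) * sin y = (cos ((2 * real (Suc n) + 1) * y - y) - cos ((2 * real (Suc n) + 1) * y + y)) / 2"
      by (rule sin_times_sin)
    also have "(2 * real (Suc n) + 1) * y - y = 2 * ((real n + 1) * y)"
      by (simp add: algebra_simps)
    also have "(2 * real (Suc n) + 1) * y + y = 2 * ((real (Suc n) + 1) * y)"
      by (simp add: algebra_simps)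
    finally show ?case unfolding sq y_def[symmetric] by (simp add: field_simps)
  qed
  moreover have "(sin (s / 2))\<^sup>2 * fejer_kernel n s = sin (s / 2) * (\<Sum>j\<le>n. sin (s / 2) * dirichlet_kernel j s) / (real n + 1)"
    by (simp add: fejer_kernel_def sum_distrib_left power2_eq_square mult.assoc)
  ultimately show ?thesis by (simp only: sin_half_dirichlet_kernel)
qed

lemma fejer_kernel_nonneg: "0 \<le> fejer_kernel n s"
proof (cases "sin (s / 2) = 0")
  case False
  have "0 \<le> (sin (s / 2))\<^sup>2 * fejer_kernel n s"
    by (simp add: sin_half_sq_fejer_kernel)
  with False show ?thesis by (simp add: zero_le_mult_iff)
next
  \<comment> \<open>The closed form reads 0 = 0 here; instead s is a multiple of 2 pi and every
    cosine equals 1.\<close>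
  case True
  then obtain m :: int where "s / 2 = of_int m * pi" by (auto simp: sin_zero_iff_int2)
  then have "real k * s = 2 * pi * of_int (int k * m)" for k by simp
  then have "cos (real k * s) = 1" for k by (simp only: cos_int_2pin)
  then have "dirichlet_kernel j s \<ge> 0" for j by (simp add: dirichlet_kernel_def)
  then show ?thesis by (simp add: fejer_kernel_def sum_nonneg)
qed

lemma integral_fejer_kernel_cos:
  assumes "k \<le> n"
  shows "(LINT t|circ. fejer_kernel n t * cos (real k * t)) = 2 * pi * (1 - real k / (real n + 1))"
proof -
  let ?a = "\<lambda>j. if j = 0 then 1 else 2 * (1 - real j / (real n + 1))"
  have "fejer_kernel n s = (\<Sum>j\<le>n. ?a j * cos (real j * s) + 0 * sin (real j * s))" for s
  proof -
    have "(\<Sum>j\<le>n. ?a j * cos (real j * s)) = (\<Sum>j\<in>insert 0 {1..n}. ?a j * cos (real j * s))"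
      by (intro sum.cong) auto
    also have "\<dots> = 1 + (\<Sum>j=1..n. 2 * ((1 - real j / (real n + 1)) * cos (real j * s)))"
      by (subst sum.insert) (auto intro!: sum.cong)
    finally show ?thesis by (simp add: fejer_kernel_eq sum_distrib_left)
  qed
  from fourier_a_trig_poly[of "fejer_kernel n" ?a "\<lambda>_. 0" n, OF this, of k] assms
  have "1 / pi * (LINT t|circ. fejer_kernel n t * cos (real k * t)) = (if k = 0 then 2 else 2 * (1 - real k / (real n + 1)))"
    by (simp add: fourier_a_def)
  then have "pi * (1 / pi * (LINT t|circ. fejer_kernel n t * cos (real k * t))) = pi * (if k = 0 then 2 else 2 * (1 - real k / (real n + 1)))"
    by (rule arg_cong)
  then show ?thesis by (cases "k = 0") simp_all
qed

lemma integral_fejer_kernel: "(LINT t|circ. fejer_kernel n t) = 2 * pi"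
  using integral_fejer_kernel_cos[of 0 n] by simp

text \<open>Parseval's identity, obtained by expanding one of the two factors: the squares of the
  tapered coefficients add up to about n / 3. This linear growth is what the normalisation of the
  squared kernel relies on.\<close>

lemma integral_fejer_kernel_sq_ge: "2 * pi * (real n + 1) / 3 \<le> (LINT t|circ. (fejer_kernel n t)\<^sup>2)"
proof -
  let ?c = "\<lambda>k. 1 - real k / (real n + 1)"
  have i: "integrable circ (\<lambda>t. fejer_kernel n t * cos (real k * t))" for k
    using integrable_mult_cos_sin(1)[OF trig_poly_integrable[OF fejer_kernel_trig_poly]] .
  have ik: "integrable circ (fejer_kernel n)"
    by (rule trig_poly_integrable[OF fejer_kernel_trig_poly])
  have "(LINT t|circ. (fejer_kernel n t)\<^sup>2) = (LINT t|circ. fejer_kernel n t * fejer_kernel n t)"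
    by (simp add: power2_eq_square)
  also have "\<dots> = (LINT t|circ. fejer_kernel n t * (1 + 2 * (\<Sum>k=1..n. ?c k * cos (real k * t))))"
    by (subst (2) fejer_kernel_eq) rule
  also have "\<dots> = (LINT t|circ. fejer_kernel n t + 2 * (\<Sum>k=1..n. ?c k * (fejer_kernel n t * cos (real k * t))))"
    by (simp add: distrib_left sum_distrib_left mult_ac)
  also have "\<dots> = (LINT t|circ. fejer_kernel n t) + 2 * (\<Sum>k=1..n. ?c k * (LINT t|circ. fejer_kernel n t * cos (real k * t)))"
    using i ik by simp
  also have "\<dots> = 2 * pi + 2 * (\<Sum>k=1..n. ?c k * (2 * pi * ?c k))"
    by (simp add: integral_fejer_kernel integral_fejer_kernel_cos)
  also have "(\<Sum>k=1..n. ?c k * (2 * pi * ?c k)) = 2 * pi * (\<Sum>k=1..n. (?c k)\<^sup>2)"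
    by (subst sum_distrib_left) (intro sum.cong, auto simp: power2_eq_square)
  also have "2 * pi + 2 * (2 * pi * (\<Sum>k=1..n. (?c k)\<^sup>2)) = 2 * pi * (1 + 2 * (\<Sum>k=1..n. (?c k)\<^sup>2))"
    by (simp add: algebra_simps)
  finally have eq: "(LINT t|circ. (fejer_kernel n t)\<^sup>2) = 2 * pi * (1 + 2 * (\<Sum>k=1..n. (?c k)\<^sup>2))" .
  \<comment> \<open>Stated for a free m, since an induction on n would break with m tied to n +
    1.\<close>
  have sq: "(\<Sum>k=1..n. (m - real k)\<^sup>2) = real n * m\<^sup>2 - m * real n * (real n + 1) + real n * (real n + 1) * (2 * real n + 1) / 6" for m
    by (induction n) (auto simp: field_simps power2_eq_square)
  have "(\<Sum>k=1..n. (?c k)\<^sup>2) = (\<Sum>k=1..n. (real n + 1 - real k)\<^sup>2 / (real n + 1)\<^sup>2)"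
    by (intro sum.cong) (auto simp: field_simps)
  also have "\<dots> = (real n * (real n + 1) * (2 * real n + 1) / 6) / (real n + 1)\<^sup>2"
    unfolding sum_divide_distrib[symmetric] sq by (simp add: power2_eq_square algebra_simps)
  also have "\<dots> = real n * (2 * real n + 1) / (6 * (real n + 1))"
    by (simp add: power2_eq_square)
  finally have s: "(\<Sum>k=1..n. (?c k)\<^sup>2) = real n * (2 * real n + 1) / (6 * (real n + 1))" .
  have "(real n + 1) * (real n + 1) \<le> 3 * (real n + 1) + real n * (2 * real n + 1)"
    by (simp add: algebra_simps)
  then have "(real n + 1) / 3 \<le> 1 + 2 * (\<Sum>k=1..n. (?c k)\<^sup>2)"
    unfolding s by (simp add: field_simps)
  then have "2 * pi * ((real n + 1) / 3) \<le> 2 * pi * (1 + 2 * (\<Sum>k=1..n. (?c k)\<^sup>2))"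
    by (intro mult_left_mono) auto
  with eq show ?thesis by simp
qed

lemma measurable_translate_diff:
  fixes f :: "real \<Rightarrow> real"
  assumes [measurable]: "f \<in> borel_measurable borel"
  shows "(\<lambda>(x, t). f (x - t) - c * f x) \<in> borel_measurable (circ \<Otimes>\<^sub>M circ)"
proof -
  have [measurable]: "(\<lambda>x. x) \<in> borel_measurable circ" by simp
  have "fst \<in> borel_measurable (circ \<Otimes>\<^sub>M circ)" "snd \<in> borel_measurable (circ \<Otimes>\<^sub>M circ)"
    using measurable_compose[OF measurable_fst, of "\<lambda>x. x" circ borel circ]
      measurable_compose[OF measurable_snd, of "\<lambda>x. x" circ borel circ] by simp_all
  then show ?thesis
    unfolding case_prod_beta
    by (intro borel_measurable_diff borel_measurable_times borel_measurable_const
        measurable_compose[OF _ assms]) auto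
qed

text \<open>The parameter \<open>c\<close> covers two uses: c = 0 bounds a convolution by its
  kernel, c = 1 bounds the distance to \<open>f\<close> when the kernel has mass 1.\<close>

lemma convolution_norm_le:
  assumes f: "f \<in> periodic_Lp p" and p: "1 \<le> p"
    and K: "K \<in> trig_poly n" "\<And>t. 0 \<le> K t"
    and \<omega>: "\<omega> \<in> trig_poly m" "\<And>t. 0 < \<omega> t"
    and le: "\<And>t. t \<in> {0..2*pi} \<Longrightarrow> Lp_norm p (\<lambda>x. f (x - t) - c * f x) \<le> \<omega> t"
  shows "Lp_norm p (\<lambda>x. LINT t|circ. K t * (f (x - t) - c * f x)) \<le> (LINT t|circ. K t * \<omega> t)"
proof (rule Minkowski_integral(2)[OF p])
  show "(\<lambda>(x, t). f (x - t) - c * f x) \<in> borel_measurable (circ \<Otimes>\<^sub>M circ)"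
    by (rule measurable_translate_diff[OF periodic_LpD(1)[OF f]])
  show "in_Lp p (\<lambda>t. f (x - t) - c * f x)" for x
    using periodic_LpD(3)[OF periodic_Lp_reflect[OF f, of x]] p by (intro in_Lp_diff in_Lp_const) auto
  show "in_Lp p (\<lambda>x. f (x - t) - c * f x)" for t
    using periodic_LpD(3)[OF periodic_Lp_translate[OF f, of "-t"]] periodic_LpD(3)[OF f] p
    by (intro in_Lp_diff in_Lp_cmult) auto
qed (use le K \<omega> trig_poly_continuous in auto)

lemma fejer_mean_norm_le:
  assumes f: "f \<in> periodic_Lp p" and p: "1 \<le> p"
  shows "Lp_norm p (fejer_mean f n) \<le> Lp_norm p f"
proof (rule field_le_epsilon)
  \<comment> \<open>The majorant has to be strictly positive, whereas the norm of f may be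
    0.\<close>
  fix e :: real assume e: "e > 0"
  have "Lp_norm p (\<lambda>x. LINT t|circ. fejer_kernel n t * (f (x - t) - 0 * f x)) \<le> (LINT t|circ. fejer_kernel n t * (Lp_norm p f + e))"
  proof (rule convolution_norm_le[OF f p fejer_kernel_trig_poly fejer_kernel_nonneg trig_poly_const[of _ 0]])
    show "0 < Lp_norm p f + e" using Lp_norm_nonneg[of p f] e by simp
    show "Lp_norm p (\<lambda>x. f (x - t) - 0 * f x) \<le> Lp_norm p f + e" for t
      using Lp_norm_translate[OF f, of "-t"] e by simp
  qed
  also have "\<dots> = 2 * pi * (Lp_norm p f + e)" by (simp add: integral_fejer_kernel)
  finally have "1 / (2 * pi) * Lp_norm p (\<lambda>x. LINT t|circ. fejer_kernel n t * f (x - t)) \<le> Lp_norm p f + e"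
    by (simp add: field_simps)
  moreover have "Lp_norm p (fejer_mean f n) = 1 / (2 * pi) * Lp_norm p (\<lambda>x. LINT t|circ. fejer_kernel n t * f (x - t))"
    unfolding fejer_mean_eq_integral'[OF f p, abs_def] using p by (subst Lp_norm_cmult) auto
  ultimately show "Lp_norm p (fejer_mean f n) \<le> Lp_norm p f + e" by simp
qed

section \<open>Hoelder condition and approximation by trigonometric polynomials\<close>

lemma sin_half_ge:
  assumes "0 \<le> t" "t \<le> pi"
  shows "t / pi \<le> sin (t / 2)"
proof -
  have "concave_on {0..pi} sin"
    by (rule f''_le0_imp_concave[where f'=cos and f''="\<lambda>x. - sin x"])
       (auto intro!: derivative_eq_intros sin_ge_zero)
  then have "(1 - t/pi) * sin 0 + (t/pi) * sin (pi/2) \<le> sin ((1 - t/pi) *\<^sub>R 0 + (t/pi) *\<^sub>R (pi/2))"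
    using assms by (intro concave_onD) (auto simp: field_simps)
  then show ?thesis by simp
qed

text \<open>Shifts with |h| \<le> pi represent all shifts modulo the period. The explicit constant
  \<open>L\<close> replaces the modulus of continuity, so that later bounds are plain
  inequalities.\<close>

definition Lp_hoelder :: "real \<Rightarrow> real \<Rightarrow> real \<Rightarrow> (real \<Rightarrow> real) \<Rightarrow> bool" where
  "Lp_hoelder p \<alpha> L f \<longleftrightarrow> (\<forall>h. \<bar>h\<bar> \<le> pi \<longrightarrow> Lp_norm p (\<lambda>x. f (x + h) - f x) \<le> L * \<bar>h\<bar> powr \<alpha>)"

text \<open>sin (t / 2) is comparable with the distance from t to the nearest multiple of 2 pi,
  treats both ends of [0, 2 pi] alike, and its square is a trigonometric polynomial. The constant
  comes from pi^\<alpha> \<le> pi.\<close>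

lemma Lp_hoelder_sin_half:
  assumes f: "f \<in> periodic_Lp p" and hoelder: "Lp_hoelder p \<alpha> L f" and L: "0 \<le> L"
    and \<alpha>: "0 < \<alpha>" "\<alpha> \<le> 1" and t: "t \<in> {0..2*pi}"
  shows "Lp_norm p (\<lambda>x. f (x - t) - f x) \<le> L * pi * sin (t / 2) powr \<alpha>"
proof -
  have "\<exists>h. \<bar>h\<bar> \<le> pi \<and> \<bar>h\<bar> \<le> pi * sin (t / 2) \<and> (\<forall>x. f (x - t) = f (x + h))"
  proof (cases "t \<le> pi")
    case True
    then show ?thesis using t sin_half_ge[of t] by (intro exI[of _ "-t"]) (auto simp: field_simps)
  next
    case False
    have "sin ((2 * pi - t) / 2) = sin (t / 2)" by (simp add: diff_divide_distrib sin_diff)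
    moreover have "f (x - t) = f (x + (2 * pi - t))" for x
      using periodic_LpD(2)[OF f, of "x - t"] by (simp add: algebra_simps)
    ultimately show ?thesis
      using False t sin_half_ge[of "2 * pi - t"] by (intro exI[of _ "2 * pi - t"]) (auto simp: field_simps)
  qed
  then obtain h where h: "\<bar>h\<bar> \<le> pi" "\<bar>h\<bar> \<le> pi * sin (t / 2)" "\<And>x. f (x - t) = f (x + h)" by blast
  have s: "0 \<le> sin (t / 2)" using t by (intro sin_ge_zero) auto
  have "Lp_norm p (\<lambda>x. f (x - t) - f x) \<le> L * \<bar>h\<bar> powr \<alpha>"
    using hoelder h by (simp add: Lp_hoelder_def)
  also have "\<dots> \<le> L * (pi * sin (t / 2)) powr \<alpha>"
    using h L \<alpha> by (intro mult_left_mono powr_mono2) auto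
  also have "(pi * sin (t / 2)) powr \<alpha> = pi powr \<alpha> * sin (t / 2) powr \<alpha>"
    by (rule powr_mult)
  also have "pi powr \<alpha> \<le> pi powr 1" using \<alpha> pi_gt3 by (intro powr_mono) auto
  finally show ?thesis using L by (simp add: mult_left_mono mult_right_mono mult.assoc)
qed

text \<open>Below the scale l the constant term dominates, above it the square. At s = sin (t / 2)
  the majorant is a trigonometric polynomial, so the approximation error is reduced to a second
  moment of the kernel.\<close>

lemma powr_le_square_majorant:
  fixes s l \<alpha> :: real
  assumes "0 < l" "0 \<le> s" "0 < \<alpha>" "\<alpha> \<le> 1"
  shows "s powr \<alpha> \<le> l powr \<alpha> * (1 + s\<^sup>2 / l\<^sup>2)"
proof -
  have "(s / l) powr \<alpha> \<le> 1 + (s / l)\<^sup>2"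
  proof (cases "s \<le> l")
    case True
    then have "(s / l) powr \<alpha> \<le> 1" using assms by (intro powr_le1) auto
    then show ?thesis using zero_le_power2[of "s / l"] by linarith
  next
    case False
    then have "(s / l) powr \<alpha> \<le> (s / l) powr 2" using assms by (intro powr_mono) auto
    then show ?thesis using assms False by (simp add: powr_numeral)
  qed
  then have "l powr \<alpha> * (s / l) powr \<alpha> \<le> l powr \<alpha> * (1 + (s / l)\<^sup>2)"
    by (intro mult_left_mono) auto
  then show ?thesis using assms by (simp add: powr_divide power_divide)
qed

text \<open>
  The kernel is the normalised square of the Fejer kernel \<open>F\<close>: its second moment is
  controlled by \<open>F sin\<^sup>2(t/2) \<le> 1/(n+1)\<close>, its mass by Parseval.
\<close>
lemma Jackson:
  assumes f: "f \<in> periodic_Lp p" and p: "1 \<le> p" and hoelder: "Lp_hoelder p \<alpha> L f" and L: "0 < L"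
    and \<alpha>: "0 < \<alpha>" "\<alpha> \<le> 1"
  shows "\<exists>g\<in>trig_poly (2 * n). Lp_norm p (\<lambda>x. f x - g x) \<le> 4 * pi * L * (real n + 1) powr (- \<alpha>)"
proof -
  define F where "F = fejer_kernel n"
  define c where "c = (LINT t|circ. (F t)\<^sup>2)"
  have c_ge: "2 * pi * (real n + 1) / 3 \<le> c" unfolding c_def F_def by (rule integral_fejer_kernel_sq_ge)
  moreover have "0 < 2 * pi * (real n + 1) / 3" by (intro divide_pos_pos mult_pos_pos) auto
  ultimately have c0: "c > 0" by linarith
  define w where "w t = (1 / c) * (F t * F t)" for t
  have F: "F \<in> trig_poly n" unfolding F_def by (rule fejer_kernel_trig_poly)
  have w: "w \<in> trig_poly (2 * n)"
    using trig_poly_cmult[OF trig_poly_mult[OF F F], of "1/c"] by (simp add: w_def[abs_def] mult_2)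
  have w0: "0 \<le> w t" for t using c0 by (simp add: w_def)
  have int_w: "(LINT t|circ. w t) = 1" using c0 by (simp add: w_def c_def power2_eq_square)
  \<comment> \<open>The width on which the kernel concentrates; the majorant is split at this
    scale.\<close>
  define l where "l = 1 / (real n + 1)"
  have l: "l > 0" by (simp add: l_def)
  define S where "S t = (1 / 2) * (1 - cos (real 1 * t))" for t
  have S_eq: "S t = (sin (t / 2))\<^sup>2" for t
    using cos_double_sin[of "t / 2"] by (simp add: S_def)
  have S: "S \<in> trig_poly 1" unfolding S_def[abs_def]
    by (intro trig_poly_cmult trig_poly_diff trig_poly_const trig_poly_cos) auto
  define \<omega> where "\<omega> t = L * pi * l powr \<alpha> * (1 + (1 / l\<^sup>2) * S t)" for t
  have \<omega>: "\<omega> \<in> trig_poly 1" unfolding \<omega>_def[abs_def]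
    by (intro trig_poly_cmult trig_poly_add trig_poly_const S)
  have \<omega>0: "0 < \<omega> t" for t
    using L l by (auto simp: \<omega>_def S_eq intro!: mult_pos_pos add_pos_nonneg)
  have iwS: "integrable circ (\<lambda>t. w t * S t)" and iw: "integrable circ w"
    using trig_poly_integrable[OF trig_poly_mult[OF w S]] trig_poly_integrable[OF w] by auto
  have "(LINT t|circ. w t * S t) \<le> (LINT t|circ. (1 / c) * (l * F t))"
  proof (rule integral_mono[OF iwS])
    show "integrable circ (\<lambda>t. (1 / c) * (l * F t))" using trig_poly_integrable[OF F] by simp
    fix t
    have "F t * S t = (sin ((real n + 1) * (t / 2)))\<^sup>2 * l"
      using sin_half_sq_fejer_kernel[of t n] by (simp add: S_eq F_def l_def mult.commute)
    also have "\<dots> \<le> 1 * l" using l by (intro mult_right_mono) (auto simp: abs_square_le_1)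
    finally have "F t * (F t * S t) \<le> F t * (1 * l)"
      by (intro mult_left_mono) (auto simp: F_def fejer_kernel_nonneg)
    then have "(1 / c) * (F t * (F t * S t)) \<le> (1 / c) * (F t * (1 * l))"
      by (rule mult_left_mono) (use c0 in simp)
    then show "w t * S t \<le> (1 / c) * (l * F t)" by (simp only: w_def mult_ac mult_1_left)
  qed
  also have "\<dots> = 2 * pi * l / c" by (simp add: F_def integral_fejer_kernel)
  \<comment> \<open>The lower bound for the mass makes 1 / c of order l, so the second moment is
    O(l^2).\<close>
  also have "\<dots> \<le> 2 * pi * l / (2 * pi * (real n + 1) / 3)"
    using c_ge c0 l by (intro divide_left_mono mult_pos_pos) auto
  also have "\<dots> = 3 * l / (real n + 1)"
    using mult_divide_mult_cancel_left[of "2 * pi" l "(real n + 1) / 3"] by simp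
  also have "\<dots> = 3 * l\<^sup>2" by (simp add: l_def power2_eq_square)
  finally have mom: "(LINT t|circ. w t * S t) \<le> 3 * l\<^sup>2" .
  \<comment> \<open>Mass 1, plus l^(-2) times a second moment of at most 3 l^2: this is the factor
    4.\<close>
  have int_w\<omega>: "(LINT t|circ. w t * \<omega> t) \<le> 4 * pi * L * l powr \<alpha>"
  proof -
    have "(LINT t|circ. w t * \<omega> t) = (LINT t|circ. L * pi * l powr \<alpha> * (w t + (1 / l\<^sup>2) * (w t * S t)))"
      by (simp add: \<omega>_def algebra_simps)
    also have "\<dots> = L * pi * l powr \<alpha> * ((LINT t|circ. w t) + (1 / l\<^sup>2) * (LINT t|circ. w t * S t))"
      using iw iwS by simp
    also have "\<dots> \<le> L * pi * l powr \<alpha> * (1 + (1 / l\<^sup>2) * (3 * l\<^sup>2))"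
      unfolding int_w using mom L by (intro mult_left_mono add_mono) auto
    also have "\<dots> = 4 * pi * L * l powr \<alpha>" using l by (simp add: algebra_simps)
    finally show ?thesis .
  qed
  define g where "g x = (LINT t|circ. f t * w (x - t))" for x
  have g: "g \<in> trig_poly (2 * n)" unfolding g_def[abs_def]
    by (rule trig_poly_convolution[OF periodic_Lp_integrable[OF f p] w])
  have g': "g x = (LINT t|circ. w t * f (x - t))" for x
    unfolding g_def using f w
    by (intro convolution_commute) (auto intro: trig_poly_measurable trig_poly_periodic simp: periodic_Lp_def)
  have diff: "g x - f x = (LINT t|circ. w t * (f (x - t) - 1 * f x))" for x
  proof -
    have "integrable circ (\<lambda>t. f (x - t) * w t)"
      using periodic_Lp_integrable[OF periodic_Lp_reflect[OF f] p] w by (rule integrable_mult_trig_poly)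
    then show ?thesis using iw int_w by (simp add: g' right_diff_distrib mult.commute[of _ "w _"])
  qed
  have "Lp_norm p (\<lambda>x. g x - f x) \<le> (LINT t|circ. w t * \<omega> t)"
    unfolding diff
  proof (rule convolution_norm_le[OF f p w w0 \<omega> \<omega>0])
    fix t :: real assume t: "t \<in> {0..2*pi}"
    have "Lp_norm p (\<lambda>x. f (x - t) - 1 * f x) \<le> L * pi * sin (t / 2) powr \<alpha>"
      using Lp_hoelder_sin_half[OF f hoelder _ \<alpha> t] L by simp
    also have "\<dots> \<le> L * pi * (l powr \<alpha> * (1 + (sin (t / 2))\<^sup>2 / l\<^sup>2))"
      using L l \<alpha> t by (intro mult_left_mono powr_le_square_majorant sin_ge_zero) auto
    also have "\<dots> = \<omega> t" by (simp add: \<omega>_def S_eq)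
    finally show "Lp_norm p (\<lambda>x. f (x - t) - 1 * f x) \<le> \<omega> t" .
  qed
  also note int_w\<omega>
  also have "l powr \<alpha> = (real n + 1) powr (- \<alpha>)"
    by (simp add: l_def powr_divide powr_minus_divide)
  finally show ?thesis unfolding Lp_norm_minus_commute[of p g f] using g by blast
qed

text \<open>All degrees are reached by halving m; replacing n + 1 by (m + 1) / 2 costs at most
  2^\<alpha> \<le> 2.\<close>

lemma Jackson':
  assumes f: "f \<in> periodic_Lp p" and p: "1 \<le> p" and hoelder: "Lp_hoelder p \<alpha> L f" and L: "0 < L"
    and \<alpha>: "0 < \<alpha>" "\<alpha> \<le> 1"
  shows "\<exists>g\<in>trig_poly m. Lp_norm p (\<lambda>x. f x - g x) \<le> 8 * pi * L * (real m + 1) powr (- \<alpha>)"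
proof -
  define n where "n = m div 2"
  obtain g where g: "g \<in> trig_poly (2 * n)" "Lp_norm p (\<lambda>x. f x - g x) \<le> 4 * pi * L * (real n + 1) powr (- \<alpha>)"
    using Jackson[OF assms] by blast
  have "m \<le> 2 * n + 1" unfolding n_def by linarith
  then have "real m \<le> 2 * real n + 1" by linarith
  then have "(real m + 1) / 2 \<le> real n + 1" by simp
  then have "(real n + 1) powr (- \<alpha>) \<le> ((real m + 1) / 2) powr (- \<alpha>)"
    using \<alpha> by (intro powr_mono2') auto
  also have "\<dots> = 2 powr \<alpha> * (real m + 1) powr (- \<alpha>)"
    by (simp add: powr_divide powr_minus field_simps)
  also have "\<dots> \<le> 2 powr 1 * (real m + 1) powr (- \<alpha>)"
    using \<alpha> by (intro mult_right_mono powr_mono) auto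
  finally have "4 * pi * L * (real n + 1) powr (- \<alpha>) \<le> 4 * pi * L * (2 powr 1 * (real m + 1) powr (- \<alpha>))"
    using L by (intro mult_left_mono) auto
  moreover have "g \<in> trig_poly m" using g(1) by (rule trig_poly_mono) (simp add: n_def)
  ultimately show ?thesis using g(2) by (intro bexI[of _ g]) (auto intro: order_trans)
qed

section \<open>Weighted sums of partial sum deviations\<close>

lemma abel_summation:
  fixes c s :: "nat \<Rightarrow> real"
  shows "(\<Sum>j\<le>k. c j * s j) = (\<Sum>j<k. (c j - c (j + 1)) * (\<Sum>i\<le>j. s i)) + c k * (\<Sum>i\<le>k. s i)"
  by (induction k) (simp_all add: algebra_simps)

lemma Lp_norm_abel_le:
  fixes k :: nat
  assumes s: "\<And>j. j \<le> k \<Longrightarrow> in_Lp p (s j)" and p: "1 \<le> p"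
  shows "Lp_norm p (\<lambda>x. \<Sum>j\<le>k. c j * s j x)
    \<le> (\<Sum>j<k. \<bar>c j - c (j + 1)\<bar> * Lp_norm p (\<lambda>x. \<Sum>i\<le>j. s i x)) + \<bar>c k\<bar> * Lp_norm p (\<lambda>x. \<Sum>i\<le>k. s i x)"
proof -
  have P: "in_Lp p (\<lambda>x. \<Sum>i\<le>j. s i x)" if "j \<le> k" for j
  proof (rule in_Lp_sum)
    show "in_Lp p (s i)" if "i \<in> {..j}" for i
      using that \<open>j \<le> k\<close> by (intro s) simp
  qed (use p in simp)
  have "Lp_norm p (\<lambda>x. \<Sum>j\<le>k. c j * s j x) \<le>
    Lp_norm p (\<lambda>x. \<Sum>j<k. (c j - c (j + 1)) * (\<Sum>i\<le>j. s i x)) + Lp_norm p (\<lambda>x. c k * (\<Sum>i\<le>k. s i x))"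
    unfolding abel_summation using s p by (intro Lp_norm_add_le in_Lp_sum in_Lp_cmult) auto
  also have "Lp_norm p (\<lambda>x. \<Sum>j<k. (c j - c (j + 1)) * (\<Sum>i\<le>j. s i x))
     \<le> (\<Sum>j<k. Lp_norm p (\<lambda>x. (c j - c (j + 1)) * (\<Sum>i\<le>j. s i x)))"
    using P p by (intro Lp_norm_sum_le in_Lp_cmult) auto
  finally show ?thesis using p by (simp only: Lp_norm_cmult)
qed

lemma in_Lp_trig_poly: "g \<in> trig_poly n \<Longrightarrow> 1 \<le> p \<Longrightarrow> in_Lp p g"
  using trig_poly_periodic_Lp[of g n p] periodic_LpD(3) by simp

lemma in_Lp_fourier_sum_diff:
  "in_Lp p f \<Longrightarrow> 1 \<le> p \<Longrightarrow> in_Lp p (\<lambda>x. fourier_sum f j x - f x)"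
  using in_Lp_trig_poly[OF fourier_sum_trig_poly[of j j f]] by (intro in_Lp_diff) auto

lemma sum_fourier_sum_diff:
  "(\<Sum>i\<le>j. fourier_sum f i x - f x) = (real j + 1) * (fejer_mean f j x - f x)"
proof -
  have "(real j + 1) * fejer_mean f j x = (\<Sum>i\<le>j. fourier_sum f i x)"
    by (simp add: fejer_mean_def)
  then show ?thesis by (simp add: sum_subtractf right_diff_distrib)
qed

text \<open>The sum is j + 1 times the error of a Fejer mean, so contractivity bounds it for every p
  \<ge> 1, while the single partial sums are not uniformly bounded on L^1.\<close>

lemma sum_fourier_sum_diff_norm_le:
  assumes f: "f \<in> periodic_Lp p" and p: "1 \<le> p"
  shows "Lp_norm p (\<lambda>x. \<Sum>i\<le>j. fourier_sum f i x - f x) \<le> 2 * (real j + 1) * Lp_norm p f"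
proof -
  have "Lp_norm p (\<lambda>x. fejer_mean f j x - f x) \<le> Lp_norm p (fejer_mean f j) + Lp_norm p f"
    using f p in_Lp_trig_poly[OF fejer_mean_trig_poly] by (intro Lp_norm_diff_le) (auto simp: periodic_Lp_def)
  then have "Lp_norm p (\<lambda>x. fejer_mean f j x - f x) \<le> 2 * Lp_norm p f"
    using fejer_mean_norm_le[OF f p, of j] by simp
  then have "(real j + 1) * Lp_norm p (\<lambda>x. fejer_mean f j x - f x) \<le> (real j + 1) * (2 * Lp_norm p f)"
    by (intro mult_left_mono) auto
  then show ?thesis
    unfolding sum_fourier_sum_diff using p by (simp add: Lp_norm_cmult mult_ac)
qed

text \<open>For \<beta> = 0 this is k + 1 times the error of the Fejer mean; the weight anticipates
  rows of the form (k + 1)^\<beta> b.\<close>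

definition weighted_deviation :: "real \<Rightarrow> (real \<Rightarrow> real) \<Rightarrow> nat \<Rightarrow> real \<Rightarrow> real" where
  "weighted_deviation \<beta> f k x = (\<Sum>j\<le>k. (real j + 1) powr \<beta> * (fourier_sum f j x - f x))"

lemma in_Lp_weighted_deviation:
  "in_Lp p f \<Longrightarrow> 1 \<le> p \<Longrightarrow> in_Lp p (weighted_deviation \<beta> f k)"
  unfolding weighted_deviation_def [abs_def] by (intro in_Lp_sum in_Lp_cmult in_Lp_fourier_sum_diff) auto

lemma weighted_deviation_add:
  assumes "integrable circ f" "integrable circ g"
  shows "weighted_deviation \<beta> (\<lambda>x. f x + g x) k x = weighted_deviation \<beta> f k x + weighted_deviation \<beta> g k x"
  unfolding weighted_deviation_def fourier_sum_add[OF assms]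
  by (simp add: sum.distrib[symmetric] algebra_simps)

lemma weighted_deviation_trig_poly:
  assumes "g \<in> trig_poly m" "m \<le> k"
  shows "weighted_deviation \<beta> g k x = weighted_deviation \<beta> g m x"
  unfolding weighted_deviation_def
  by (rule sum.mono_neutral_right) (use assms fourier_sum_trig_poly_eq[OF assms(1)] in auto)

text \<open>The weights increase, so their variation telescopes and is at most the last
  weight.\<close>

lemma weighted_deviation_norm_le:
  assumes f: "f \<in> periodic_Lp p" and p: "1 \<le> p" and \<beta>: "0 \<le> \<beta>"
  shows "Lp_norm p (weighted_deviation \<beta> f k) \<le> 4 * (real k + 1) powr (\<beta> + 1) * Lp_norm p f"
proof -
  define c where "c j = (real j + 1) powr \<beta>" for j
  have mono: "c j \<le> c (j + 1)" for j using \<beta> by (auto simp: c_def intro!: powr_mono2)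
  have tele: "(\<Sum>j<k. \<bar>c j - c (j + 1)\<bar>) = c k - c 0"
  proof (induction k)
    case (Suc k)
    then show ?case using mono[of k] by simp
  qed simp
  let ?M = "2 * (real k + 1) * Lp_norm p f"
  have P: "Lp_norm p (\<lambda>x. \<Sum>i\<le>j. fourier_sum f i x - f x) \<le> ?M" if "j \<le> k" for j
  proof -
    have "2 * (real j + 1) * Lp_norm p f \<le> ?M"
      using that Lp_norm_nonneg by (intro mult_right_mono) auto
    with sum_fourier_sum_diff_norm_le[OF f p, of j] show ?thesis by linarith
  qed
  have "Lp_norm p (weighted_deviation \<beta> f k) \<le>
      (\<Sum>j<k. \<bar>c j - c (j + 1)\<bar> * Lp_norm p (\<lambda>x. \<Sum>i\<le>j. fourier_sum f i x - f x))
      + \<bar>c k\<bar> * Lp_norm p (\<lambda>x. \<Sum>i\<le>k. fourier_sum f i x - f x)"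
    unfolding weighted_deviation_def [abs_def] c_def
    by (rule Lp_norm_abel_le) (use p f in \<open>auto intro!: in_Lp_fourier_sum_diff simp: periodic_Lp_def\<close>)
  also have "\<dots> \<le> (\<Sum>j<k. \<bar>c j - c (j + 1)\<bar> * ?M) + \<bar>c k\<bar> * ?M"
    using P by (intro add_mono sum_mono mult_left_mono) auto
  also have "\<dots> = (c k - c 0 + c k) * ?M"
    unfolding sum_distrib_right[symmetric] tele by (simp only: distrib_right[symmetric]) (simp add: c_def)
  also have "\<dots> \<le> (2 * c k) * ?M"
    using Lp_norm_nonneg[of p f] by (intro mult_right_mono) (auto simp: c_def)
  also have "\<dots> = 4 * (real k + 1) powr (\<beta> + 1) * Lp_norm p f"
    by (simp add: c_def powr_add)
  finally show ?thesis .
qed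

text \<open>
  Split \<open>f\<close> into a dyadic telescoping sum of Jackson approximants. A block of degree \<open>2^i\<close> has
  norm \<open>O(2^(-i \<alpha>))\<close> and its deviations vanish from index \<open>2^i\<close> on, so it contributes
  \<open>O(2^(i (\<beta> + 1 - \<alpha>)))\<close>, which is summed geometrically.
\<close>
lemma weighted_deviation_bound:
  assumes f: "f \<in> periodic_Lp p" and p: "1 \<le> p" and hoelder: "Lp_hoelder p \<alpha> L f" and L: "0 < L"
    and \<alpha>: "0 < \<alpha>" "\<alpha> \<le> 1" and \<beta>: "0 \<le> \<beta>" and \<gamma>: "0 < \<beta> + 1 - \<alpha>"
  shows "\<exists>C\<ge>0. \<forall>k. Lp_norm p (weighted_deviation \<beta> f k) \<le> C * (real k + 1) powr (\<beta> + 1 - \<alpha>)"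
proof -
  define \<gamma> where "\<gamma> = \<beta> + 1 - \<alpha>"
  have \<gamma>0: "\<gamma> > 0" using \<gamma> by (simp add: \<gamma>_def)
  define M where "M = 8 * pi * L"
  have M: "M > 0" using L by (simp add: M_def)
  have "\<exists>g. g \<in> trig_poly (2 ^ i) \<and> Lp_norm p (\<lambda>x. f x - g x) \<le> M * (2 ^ i) powr (- \<alpha>)" for i :: nat
  proof -
    obtain g where g: "g \<in> trig_poly (2 ^ i)" "Lp_norm p (\<lambda>x. f x - g x) \<le> M * (real (2 ^ i) + 1) powr (- \<alpha>)"
      using Jackson'[OF f p hoelder L \<alpha>, of "2 ^ i"] by (auto simp: M_def)
    have "(real (2 ^ i) + 1) powr (- \<alpha>) \<le> (2 ^ i) powr (- \<alpha>)"
      using \<alpha> by (intro powr_mono2') auto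
    then have "M * (real (2 ^ i) + 1) powr (- \<alpha>) \<le> M * (2 ^ i) powr (- \<alpha>)"
      using M by (intro mult_left_mono) auto
    then show ?thesis using g by (intro exI[of _ g]) auto
  qed
  then obtain t where t: "\<And>i. t i \<in> trig_poly (2 ^ i)"
    and ft: "\<And>i. Lp_norm p (\<lambda>x. f x - t i x) \<le> M * (2 ^ i) powr (- \<alpha>)" by metis
  have fL: "in_Lp p f" using f by (simp add: periodic_Lp_def)
  have tL: "in_Lp p (t i)" for i using in_Lp_trig_poly[OF t p] .
  have tint: "integrable circ (t i)" for i using trig_poly_integrable[OF t] .
  \<comment> \<open>The 4 is from \<open>weighted_deviation_norm_le\<close>, the power of 4 from
    2^(i + 1) + 1 \<le> 4 2^i, and 2 M bounds the two approximation errors in a block.\<close>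
  define D where "D = 4 * 4 powr (\<beta> + 1) * (2 * M)"
  have D: "D > 0" using M by (simp add: D_def)
  have block: "Lp_norm p (weighted_deviation \<beta> (\<lambda>x. t (Suc i) x - t i x) k) \<le> D * (2 ^ i) powr \<gamma>"
    if k: "2 ^ Suc i \<le> k" for i k
  proof -
    define d where "d x = t (Suc i) x - t i x" for x
    have d: "d \<in> trig_poly (2 ^ Suc i)"
      unfolding d_def[abs_def] using trig_poly_mono[OF t[of i], of "2 ^ Suc i"] by (intro trig_poly_diff t) auto
    have "Lp_norm p d \<le> Lp_norm p (\<lambda>x. t (Suc i) x - f x) + Lp_norm p (\<lambda>x. f x - t i x)"
      unfolding d_def using fL tL p by (intro Lp_norm_triangle) auto
    also have "\<dots> \<le> M * (2 ^ Suc i) powr (- \<alpha>) + M * (2 ^ i) powr (- \<alpha>)"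
      using ft[of "Suc i"] ft[of i] by (intro add_mono) (simp_all add: Lp_norm_minus_commute[of p "t _" f])
    also have "(2 ^ Suc i) powr (- \<alpha>) \<le> (2 ^ i) powr (- \<alpha>)"
      using \<alpha> by (intro powr_mono2') auto
    finally have dn: "Lp_norm p d \<le> 2 * M * (2 ^ i) powr (- \<alpha>)" using M by simp
    have "Lp_norm p (weighted_deviation \<beta> d k) = Lp_norm p (weighted_deviation \<beta> d (2 ^ Suc i))"
      using weighted_deviation_trig_poly[OF d k] by (intro Lp_norm_cong) auto
    also have "\<dots> \<le> 4 * (real (2 ^ Suc i) + 1) powr (\<beta> + 1) * Lp_norm p d"
      using trig_poly_periodic_Lp[OF d, of p] p \<beta> by (intro weighted_deviation_norm_le) auto
    also have "\<dots> \<le> 4 * (4 * 2 ^ i) powr (\<beta> + 1) * (2 * M * (2 ^ i) powr (- \<alpha>))"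
    proof (intro mult_mono powr_mono2)
      have "(1::real) \<le> 2 ^ i" by simp
      then have "2 * 2 ^ i + 1 \<le> (4 * 2 ^ i :: real)" by linarith
      then show "real (2 ^ Suc i) + 1 \<le> 4 * 2 ^ i" by simp
    qed (use dn \<beta> Lp_norm_nonneg in auto)
    also have "\<dots> = D * ((2 ^ i) powr (\<beta> + 1) * (2 ^ i) powr (- \<alpha>))"
      by (simp add: D_def powr_mult)
    also have "(2 ^ i) powr (\<beta> + 1) * (2 ^ i) powr (- \<alpha>) = (2 ^ i :: real) powr \<gamma>"
      by (simp add: \<gamma>_def powr_add[symmetric])
    finally show ?thesis unfolding d_def .
  qed
  have g1: "2 powr \<gamma> > 1" using \<gamma>0 by simp
  \<comment> \<open>Chosen so that C0 + D \<le> C0 2^\<gamma>: the geometric series is summed by the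
    induction itself. The first argument of the maximum serves i = 0.\<close>
  define C0 where "C0 = max (Lp_norm p (weighted_deviation \<beta> (t 0) 1)) (D / (2 powr \<gamma> - 1))"
  have C0: "C0 \<ge> 0" "D \<le> C0 * (2 powr \<gamma> - 1)"
    using g1 Lp_norm_nonneg[of p "weighted_deviation \<beta> (t 0) 1"] by (auto simp: C0_def pos_divide_le_eq[symmetric])
  have V: "Lp_norm p (weighted_deviation \<beta> (t i) k) \<le> C0 * (2 ^ i) powr \<gamma>" if "2 ^ i \<le> k" for i k
    using that
  proof (induction i)
    case 0
    then have "Lp_norm p (weighted_deviation \<beta> (t 0) k) = Lp_norm p (weighted_deviation \<beta> (t 0) 1)"
      using weighted_deviation_trig_poly[OF t[of 0], of k] by (intro Lp_norm_cong) auto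
    then show ?case by (simp add: C0_def)
  next
    case (Suc i)
    have "Lp_norm p (weighted_deviation \<beta> (t (Suc i)) k) =
       Lp_norm p (\<lambda>x. weighted_deviation \<beta> (\<lambda>x. t (Suc i) x - t i x) k x + weighted_deviation \<beta> (t i) k x)"
      using weighted_deviation_add[OF Bochner_Integration.integrable_diff[OF tint tint] tint, of \<beta> "Suc i" i i k]
      by (intro Lp_norm_cong) simp
    also have "\<dots> \<le> Lp_norm p (weighted_deviation \<beta> (\<lambda>x. t (Suc i) x - t i x) k) + Lp_norm p (weighted_deviation \<beta> (t i) k)"
      using tL p by (intro Lp_norm_add_le in_Lp_weighted_deviation in_Lp_diff) auto
    also have "\<dots> \<le> D * (2 ^ i) powr \<gamma> + C0 * (2 ^ i) powr \<gamma>"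
      using Suc block[of i k] by (intro add_mono) auto
    also have "\<dots> \<le> C0 * (2 powr \<gamma> - 1) * (2 ^ i) powr \<gamma> + C0 * (2 ^ i) powr \<gamma>"
      using C0 by (intro add_mono mult_right_mono) auto
    also have "\<dots> = C0 * (2 ^ Suc i) powr \<gamma>"
      by (simp add: powr_mult algebra_simps)
    finally show ?case .
  qed
  \<comment> \<open>8 M is for the remainder f - t_i, C0 for t_i; the last summand covers k = 0,
    where no power of 2 lies below k.\<close>
  define C where "C = 8 * M + C0 + Lp_norm p (weighted_deviation \<beta> f 0)"
  have C: "C \<ge> 0" using M C0 Lp_norm_nonneg[of p "weighted_deviation \<beta> f 0"] by (simp add: C_def)
  have "Lp_norm p (weighted_deviation \<beta> f k) \<le> C * (real k + 1) powr \<gamma>" for k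
  proof (cases "k = 0")
    case True
    then show ?thesis using M C0 by (simp add: C_def)
  next
    case False
    \<comment> \<open>At the dyadic scale next below k, the crude bound for the remainder f - t_i
      already has the required order.\<close>
    then obtain i where i: "2 ^ i \<le> k" "k < 2 ^ (i + 1)" using ex_power_ivl1[of 2 k] by auto
    have r: "(2::real) ^ i \<le> real k + 1" "(real k + 1) / 2 \<le> 2 ^ i"
    proof -
      have "real (2 ^ i) \<le> real k" using i(1) by (rule of_nat_mono)
      then have "(2::real) ^ i \<le> real k" by (simp only: of_nat_power of_nat_numeral)
      then show "(2::real) ^ i \<le> real k + 1" by linarith
      have "k + 1 \<le> 2 ^ (i + 1)" using i(2) by simp
      then have "real (k + 1) \<le> real (2 ^ (i + 1))" by (rule of_nat_mono)
      then have "real k + 1 \<le> 2 * 2 ^ i" by (simp only: of_nat_power of_nat_numeral of_nat_add of_nat_1 power_add power_one_right of_nat_mult mult.commute)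
      then show "(real k + 1) / 2 \<le> 2 ^ i" by (simp only: pos_divide_le_eq zero_less_numeral mult.commute)
    qed
    have "Lp_norm p (weighted_deviation \<beta> f k) =
       Lp_norm p (\<lambda>x. weighted_deviation \<beta> (\<lambda>x. f x - t i x) k x + weighted_deviation \<beta> (t i) k x)"
      using weighted_deviation_add[OF Bochner_Integration.integrable_diff[OF periodic_Lp_integrable[OF f p] tint] tint, of \<beta> i i k]
      by (intro Lp_norm_cong) simp
    also have "\<dots> \<le> Lp_norm p (weighted_deviation \<beta> (\<lambda>x. f x - t i x) k) + Lp_norm p (weighted_deviation \<beta> (t i) k)"
      using fL tL p by (intro Lp_norm_add_le in_Lp_weighted_deviation in_Lp_diff) auto
    also have "\<dots> \<le> 4 * (real k + 1) powr (\<beta> + 1) * (M * (2 ^ i) powr (- \<alpha>)) + C0 * (2 ^ i) powr \<gamma>"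
    proof (intro add_mono V i)
      have "(\<lambda>x. f x - t i x) \<in> periodic_Lp p"
        using f trig_poly_periodic_Lp[OF t, of p] p by (intro periodic_Lp_diff) auto
      then have "Lp_norm p (weighted_deviation \<beta> (\<lambda>x. f x - t i x) k) \<le> 4 * (real k + 1) powr (\<beta> + 1) * Lp_norm p (\<lambda>x. f x - t i x)"
        using p \<beta> by (intro weighted_deviation_norm_le)
      also have "\<dots> \<le> 4 * (real k + 1) powr (\<beta> + 1) * (M * (2 ^ i) powr (- \<alpha>))"
        using ft by (intro mult_left_mono) auto
      finally show "Lp_norm p (weighted_deviation \<beta> (\<lambda>x. f x - t i x) k) \<le> 4 * (real k + 1) powr (\<beta> + 1) * (M * (2 ^ i) powr (- \<alpha>))" .
    qed
    also have "\<dots> \<le> 4 * (real k + 1) powr (\<beta> + 1) * (M * (2 * (real k + 1) powr (- \<alpha>))) + C0 * (real k + 1) powr \<gamma>"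
    proof (intro add_mono mult_left_mono powr_mono2)
      have "(2 ^ i) powr (- \<alpha>) \<le> ((real k + 1) / 2) powr (- \<alpha>)"
        using \<alpha> r by (intro powr_mono2') auto
      also have "\<dots> = 2 powr \<alpha> * (real k + 1) powr (- \<alpha>)"
        by (simp add: powr_divide powr_minus field_simps)
      also have "\<dots> \<le> 2 powr 1 * (real k + 1) powr (- \<alpha>)"
        using \<alpha> by (intro mult_right_mono powr_mono) auto
      finally show "(2 ^ i) powr (- \<alpha>) \<le> 2 * (real k + 1) powr (- \<alpha>)" by simp
    qed (use r \<gamma>0 M C0 in auto)
    also have "\<dots> = 8 * M * ((real k + 1) powr (\<beta> + 1) * (real k + 1) powr (- \<alpha>)) + C0 * (real k + 1) powr \<gamma>"
      by (simp add: mult_ac)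
    also have "(real k + 1) powr (\<beta> + 1) * (real k + 1) powr (- \<alpha>) = (real k + 1) powr \<gamma>"
      by (simp add: \<gamma>_def powr_add[symmetric])
    also have "8 * M * (real k + 1) powr \<gamma> + C0 * (real k + 1) powr \<gamma> \<le> C * (real k + 1) powr \<gamma>"
      unfolding distrib_right[symmetric] using Lp_norm_nonneg[of p "weighted_deviation \<beta> f 0"]
      by (intro mult_right_mono) (auto simp: C_def)
    finally show ?thesis .
  qed
  with C show ?thesis unfolding \<gamma>_def by blast
qed

section \<open>Matrix means through the variation of their rows\<close>

lemma matrix_mean_diff:
  assumes "(\<Sum>k = 0..n. a n k) = 1"
  shows "matrix_mean a f n x - f x = (\<Sum>k\<le>n. a n k * (fourier_sum f k x - f x))"
proof -
  have "(\<Sum>k\<le>n. a n k * (fourier_sum f k x - f x)) = matrix_mean a f n x - (\<Sum>k\<le>n. a n k) * f x"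
    by (simp add: matrix_mean_def right_diff_distrib sum_subtractf sum_distrib_right atMost_atLeast0)
  then show ?thesis using assms by (simp add: atMost_atLeast0)
qed

text \<open>Abel summation against the weighted deviations: the factor (k + 1)^\<beta> moves from
  the row to the deviations, and only the variation and the last entry of the reduced row
  \<open>b\<close> remain.\<close>

lemma matrix_mean_norm_le_variation:
  assumes f: "f \<in> periodic_Lp p" and p: "1 \<le> p" and hoelder: "Lp_hoelder p \<alpha> L f" and L: "0 < L"
    and \<alpha>: "0 < \<alpha>" "\<alpha> \<le> 1" and \<beta>: "0 \<le> \<beta>" and \<gamma>: "0 < \<beta> + 1 - \<alpha>"
    and row: "\<And>n. (\<Sum>k = 0..n. a n k) = 1" and a: "\<And>n k. a n k = (real k + 1) powr \<beta> * b n k"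
  shows "\<exists>C\<ge>0. \<forall>n. Lp_norm p (\<lambda>x. matrix_mean a f n x - f x)
    \<le> C * (real n + 1) powr (\<beta> + 1 - \<alpha>) * ((\<Sum>k<n. \<bar>b n k - b n (k + 1)\<bar>) + \<bar>b n n\<bar>)"
proof -
  obtain C where C: "C \<ge> 0" "\<And>k. Lp_norm p (weighted_deviation \<beta> f k) \<le> C * (real k + 1) powr (\<beta> + 1 - \<alpha>)"
    using weighted_deviation_bound[OF f p hoelder L \<alpha> \<beta> \<gamma>] by blast
  have "Lp_norm p (\<lambda>x. matrix_mean a f n x - f x)
    \<le> C * (real n + 1) powr (\<beta> + 1 - \<alpha>) * ((\<Sum>k<n. \<bar>b n k - b n (k + 1)\<bar>) + \<bar>b n n\<bar>)" for n
  proof -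
    let ?M = "C * (real n + 1) powr (\<beta> + 1 - \<alpha>)"
    have P: "Lp_norm p (weighted_deviation \<beta> f k) \<le> ?M" if "k \<le> n" for k
    proof -
      have "C * (real k + 1) powr (\<beta> + 1 - \<alpha>) \<le> ?M"
        using that C \<gamma> by (intro mult_left_mono powr_mono2) auto
      with C(2)[of k] show ?thesis by linarith
    qed
    have "matrix_mean a f n x - f x = (\<Sum>k\<le>n. b n k * ((real k + 1) powr \<beta> * (fourier_sum f k x - f x)))" for x
      unfolding matrix_mean_diff[of a n f x, OF row] by (simp add: a mult_ac)
    then have "Lp_norm p (\<lambda>x. matrix_mean a f n x - f x) =
       Lp_norm p (\<lambda>x. \<Sum>k\<le>n. b n k * ((real k + 1) powr \<beta> * (fourier_sum f k x - f x)))" by simp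
    also have "\<dots> \<le> (\<Sum>j<n. \<bar>b n j - b n (j + 1)\<bar> * Lp_norm p (\<lambda>x. \<Sum>i\<le>j. (real i + 1) powr \<beta> * (fourier_sum f i x - f x)))
       + \<bar>b n n\<bar> * Lp_norm p (\<lambda>x. \<Sum>i\<le>n. (real i + 1) powr \<beta> * (fourier_sum f i x - f x))"
      by (rule Lp_norm_abel_le) (use f p in \<open>auto intro!: in_Lp_cmult in_Lp_fourier_sum_diff simp: periodic_Lp_def\<close>)
    also have "\<dots> \<le> (\<Sum>j<n. \<bar>b n j - b n (j + 1)\<bar> * ?M) + \<bar>b n n\<bar> * ?M"
      using P unfolding weighted_deviation_def [abs_def]
      by (intro add_mono sum_mono mult_left_mono) auto
    also have "\<dots> = ?M * ((\<Sum>k<n. \<bar>b n k - b n (k + 1)\<bar>) + \<bar>b n n\<bar>)"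
      unfolding sum_distrib_right[symmetric] by (simp add: algebra_simps)
    finally show ?thesis .
  qed
  with C(1) show ?thesis by blast
qed

section \<open>M. Riesz's theorem on conjugate functions\<close>

text \<open>Near the imaginary axis p |arg z| lies between pi / 2 and pi, because 1 < p \<le> 2, so
  Re (z^p) is negative and comparable in size with |z|^p. Away from the axis Re z is comparable with
  |z|.\<close>

lemma Re_powr_lower_bound:
  fixes p :: real
  assumes p: "1 < p" "p \<le> 2"
  shows "\<exists>A B. 0 \<le> A \<and> 0 \<le> B \<and>
    (\<forall>z. 0 < Re z \<longrightarrow> cmod z powr p \<le> A * Re z powr p - B * Re (exp (of_real p * Ln z)))"
proof -
  \<comment> \<open>Midway between pi / (2 p), where cos (p y) changes sign, and pi / 2: this angle
    separates the two regimes.\<close>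
  define y0 where "y0 = (pi / (2 * p) + pi / 2) / 2"
  have "pi / (2 * p) < pi / 2" using p by (simp add: field_simps)
  then have y0: "pi / (2 * p) < y0" "y0 < pi / 2" by (auto simp: y0_def)
  have "0 < pi / (2 * p)" using p by simp
  then have y0_pos: "0 < y0" using y0 by linarith
  have py0: "pi / 2 < p * y0" "p * y0 < pi"
  proof -
    show "pi / 2 < p * y0" using y0(1) p by (simp add: field_simps)
    have "p * y0 < p * (pi / 2)" using y0(2) p by (intro mult_strict_left_mono) auto
    also have "\<dots> \<le> 2 * (pi / 2)" using p by (intro mult_right_mono) auto
    finally show "p * y0 < pi" by simp
  qed
  define c where "c = - cos (p * y0)"
  have c: "0 < c"
    using cos_monotone_0_pi[of "pi / 2" "p * y0"] py0 by (simp add: c_def)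
  have cy0: "0 < cos y0" using y0 y0_pos by (intro cos_gt_zero_pi) auto
  \<comment> \<open>B makes the cosine term alone reach 1 beyond y0; A compensates, at smaller
    angles, for a cosine term that may cost up to B.\<close>
  define B where "B = 1 / c"
  define A where "A = (1 + B) / cos y0 powr p"
  have B: "0 \<le> B" using c by (simp add: B_def)
  have A: "0 \<le> A" using B cy0 by (simp add: A_def)
  have key: "1 \<le> A * cos y powr p - B * cos (p * y)" if y: "0 \<le> y" "y < pi / 2" for y
  proof (cases "y0 \<le> y")
    case True
    have "p * y \<le> 2 * (pi / 2)" using y p by (intro mult_mono) auto
    then have "cos (p * y) \<le> cos (p * y0)"
      using True py0 p by (intro cos_monotone_0_pi_le) auto
    then have "B * cos (p * y) \<le> B * (- c)" unfolding c_def using B by (intro mult_left_mono) auto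
    also have "\<dots> = -1" using c by (simp add: B_def)
    finally have "B * cos (p * y) \<le> -1" .
    moreover have "0 \<le> A * cos y powr p" using A by simp
    ultimately show ?thesis by linarith
  next
    case False
    have "cos y0 \<le> cos y" using False y y0 by (intro cos_monotone_0_pi_le) auto
    then have "cos y0 powr p \<le> cos y powr p" using cy0 p by (intro powr_mono2) auto
    then have "A * cos y0 powr p \<le> A * cos y powr p" using A by (intro mult_left_mono)
    moreover have "A * cos y0 powr p = 1 + B" using cy0 by (simp add: A_def)
    moreover have "B * cos (p * y) \<le> B * 1" using B by (intro mult_left_mono) auto
    ultimately show ?thesis by linarith
  qed
  have "cmod z powr p \<le> A * Re z powr p - B * Re (exp (of_real p * Ln z))" if z: "0 < Re z" for z
  proof -
    define r where "r = Re (Ln z)"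
    define t where "t = Im (Ln z)"
    have z0: "z \<noteq> 0" using z by auto
    have r: "cmod z = exp r" using z0 by (simp add: r_def)
    have ez: "exp (Ln z) = z" using z0 by simp
    have Rez: "Re z = exp r * cos t"
      using Re_exp[of "Ln z"] unfolding ez r_def t_def by simp
    have Rep: "Re (exp (of_real p * Ln z)) = exp (p * r) * cos (p * t)"
      by (simp add: Re_exp r_def t_def)
    have t: "\<bar>t\<bar> < pi / 2" unfolding t_def using z by (rule Re_Ln_pos_lt_imp)
    have "1 \<le> A * cos \<bar>t\<bar> powr p - B * cos (p * \<bar>t\<bar>)" using t by (intro key) auto
    moreover have "cos \<bar>t\<bar> = cos t" "cos (p * \<bar>t\<bar>) = cos (p * t)" by (auto simp: abs_if)
    ultimately have "exp (p * r) * 1 \<le> exp (p * r) * (A * cos t powr p - B * cos (p * t))"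
      by (intro mult_left_mono) auto
    moreover have "cmod z powr p = exp (p * r)" by (simp add: r powr_def mult.commute)
    moreover have "Re z powr p = exp (p * r) * cos t powr p"
      by (simp add: Rez powr_mult) (simp add: powr_def mult.commute)
    ultimately show ?thesis by (simp add: Rep algebra_simps)
  qed
  with A B show ?thesis by blast
qed

lemma mean_value_circ:
  assumes h: "h holomorphic_on cball 0 1"
  shows "(LINT t|circ. Re (h (cis t))) = 2 * pi * Re (h 0)"
proof -
  have "((\<lambda>u. h u / (u - 0)) has_contour_integral (2 * of_real pi * \<i> * h 0)) (circlepath 0 1)"
    by (rule Cauchy_integral_circlepath_simple[OF h]) simp
  then have "((\<lambda>t. h (cis t) / cis t * \<i> * cis t) has_integral (2 * of_real pi * \<i> * h 0)) {0..2*pi}"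
    unfolding circlepath_def by (simp add: has_contour_integral_part_circlepath_iff)
  then have "((\<lambda>t. (- \<i>) * (h (cis t) / cis t * \<i> * cis t)) has_integral ((- \<i>) * (2 * of_real pi * \<i> * h 0))) {0..2*pi}"
    by (rule has_integral_mult_right)
  moreover have "(- \<i>) * (h (cis t) / cis t * \<i> * cis t) = h (cis t)" for t
    by (simp add: field_simps)
  ultimately have "((\<lambda>t. h (cis t)) has_integral (2 * of_real pi * h 0)) {0..2*pi}"
    by (simp add: mult_ac)
  from has_integral_Re[OF this] have I: "((\<lambda>t. Re (h (cis t))) has_integral (2 * pi * Re (h 0))) {0..2*pi}"
    by simp
  have "continuous_on {0..2*pi} (\<lambda>t. Re (h (cis t)))"
    by (intro continuous_intros continuous_on_compose2[OF holomorphic_on_imp_continuous_on[OF h]]) auto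
  then have "integrable circ (\<lambda>t. Re (h (cis t)))" by (rule continuous_imp_integrable_real)
  from lebesgue_integral_eq_integral[OF this] show ?thesis using I by (simp add: integral_unique)
qed

text \<open>
  For \<open>G\<close> with values in the right half plane, \<open>G powr p\<close> is holomorphic, so the mean of
  \<open>Re (G powr p)\<close> is its value at the centre, which is positive; the pointwise inequality
  above turns this into a bound for \<open>|G|^p\<close>.
\<close>
lemma Riesz_half_plane:
  fixes p :: real
  assumes p: "1 < p" "p \<le> 2"
  shows "\<exists>A\<ge>0. \<forall>G e. G holomorphic_on UNIV \<and> 0 < e \<and> (\<forall>x. e \<le> Re (G (cis x))) \<and> Im (G 0) = 0 \<longrightarrow>
    (LINT x|circ. \<bar>Im (G (cis x))\<bar> powr p) \<le> A * (LINT x|circ. Re (G (cis x)) powr p)"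
proof -
  obtain A B where AB: "0 \<le> A" "0 \<le> B"
    and key: "\<And>z. 0 < Re z \<Longrightarrow> cmod z powr p \<le> A * Re z powr p - B * Re (exp (of_real p * Ln z))"
    using Re_powr_lower_bound[OF p] by blast
  have "(LINT x|circ. \<bar>Im (G (cis x))\<bar> powr p) \<le> A * (LINT x|circ. Re (G (cis x)) powr p)"
    if G: "G holomorphic_on UNIV" and e: "0 < e" and pos: "\<And>x. e \<le> Re (G (cis x))" and im0: "Im (G 0) = 0" for G e
  proof -
    have contG: "continuous_on S G" for S
      using holomorphic_on_imp_continuous_on[OF G] continuous_on_subset by blast
    \<comment> \<open>The boundary bound extends to the disc by the maximum principle for the real
      part of -G, so G avoids the branch cut of \<open>Ln\<close>.\<close>
    have ReG: "e \<le> Re (G z)" if "z \<in> cball 0 1" for z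
    proof -
      have "Re (- G z) \<le> - e"
      proof (rule maximum_real_frontier[of "\<lambda>z. - G z" "cball 0 1"])
        show "(\<lambda>z. - G z) holomorphic_on interior (cball 0 1)"
          using G by (auto intro!: holomorphic_intros intro: holomorphic_on_subset)
        show "continuous_on (closure (cball 0 1)) (\<lambda>z. - G z)"
          by (intro continuous_intros contG)
        fix w :: complex assume "w \<in> frontier (cball 0 1)"
        then have w: "cmod w = 1" by (simp add: sphere_def dist_norm)
        then have "w = cis (Arg w)" using rcis_cmod_Arg[of w] by (simp add: rcis_def)
        then show "Re (- G w) \<le> - e" using pos[of "Arg w"] by simp
      qed (use that in auto)
      then show ?thesis by simp
    qed
    define h where "h z = exp (of_real p * Ln (G z))" for z
    have nonpos: "G z \<notin> \<real>\<^sub>\<le>\<^sub>0" if "z \<in> cball 0 1" for z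
      using ReG[OF that] e by (auto simp: complex_nonpos_Reals_iff)
    have hol: "h holomorphic_on cball 0 1"
      unfolding h_def using nonpos holomorphic_on_subset[OF G]
      by (intro holomorphic_intros) auto
    \<comment> \<open>G 0 is real and positive, hence so is its p-th power.\<close>
    have "Re (h 0) \<ge> 0"
    proof -
      have "G 0 = of_real (Re (G 0))" using im0 by (simp add: complex_eq_iff)
      moreover have "Re (G 0) > 0" using ReG[of 0] e by simp
      ultimately have "Ln (G 0) = of_real (ln (Re (G 0)))" by (metis Ln_of_real)
      then have "h 0 = of_real (exp (p * ln (Re (G 0))))" by (simp add: h_def flip: of_real_mult exp_of_real)
      then show ?thesis by simp
    qed
    then have mv: "0 \<le> (LINT x|circ. Re (h (cis x)))" using mean_value_circ[OF hol] by simp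
    have cG: "continuous_on {0..2*pi} (\<lambda>x. G (cis x))"
      by (intro continuous_on_compose2[OF contG[of UNIV]] continuous_intros) auto
    have ih: "integrable circ (\<lambda>x. Re (h (cis x)))"
      by (intro continuous_imp_integrable_real continuous_intros continuous_on_compose2[OF holomorphic_on_imp_continuous_on[OF hol]]) auto
    have iR: "integrable circ (\<lambda>x. Re (G (cis x)) powr p)"
      using p by (intro continuous_imp_integrable_real continuous_on_powr' continuous_intros cG)
        (use order_trans[OF less_imp_le[OF e] pos] in auto)
    have iI: "integrable circ (\<lambda>x. \<bar>Im (G (cis x))\<bar> powr p)"
      using p by (intro continuous_imp_integrable_real continuous_on_powr' continuous_intros cG) auto
    have "(LINT x|circ. \<bar>Im (G (cis x))\<bar> powr p) \<le> (LINT x|circ. A * Re (G (cis x)) powr p - B * Re (h (cis x)))"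
    proof (rule integral_mono)
      show "integrable circ (\<lambda>x. \<bar>Im (G (cis x))\<bar> powr p)" by (rule iI)
      show "integrable circ (\<lambda>x. A * Re (G (cis x)) powr p - B * Re (h (cis x)))"
        using iR ih by simp
      fix x
      have "\<bar>Im (G (cis x))\<bar> powr p \<le> cmod (G (cis x)) powr p"
        using p abs_Im_le_cmod by (intro powr_mono2) auto
      also have "\<dots> \<le> A * Re (G (cis x)) powr p - B * Re (h (cis x))"
        unfolding h_def using pos[of x] e by (intro key) auto
      finally show "\<bar>Im (G (cis x))\<bar> powr p \<le> A * Re (G (cis x)) powr p - B * Re (h (cis x))" .
    qed
    also have "\<dots> = A * (LINT x|circ. Re (G (cis x)) powr p) - B * (LINT x|circ. Re (h (cis x)))"
      using iR ih by simp
    also have "\<dots> \<le> A * (LINT x|circ. Re (G (cis x)) powr p)"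
      using AB mv by simp
    finally show ?thesis .
  qed
  with AB show ?thesis by blast
qed

section \<open>Conjugate Fejer means\<close>

definition conj_fejer_mean :: "(real \<Rightarrow> real) \<Rightarrow> nat \<Rightarrow> real \<Rightarrow> real" where
  "conj_fejer_mean f n x = (\<Sum>k=1..n. (1 - real k / (real n + 1)) * conj_harmonic f k x)"

lemma conj_fejer_mean_trig_poly: "conj_fejer_mean f n \<in> trig_poly n"
  unfolding conj_fejer_mean_def [abs_def]
  by (intro trig_poly_sum trig_poly_cmult conj_harmonic_trig_poly) auto

lemma conj_fejer_mean_diff:
  assumes "integrable circ f" "integrable circ g"
  shows "conj_fejer_mean (\<lambda>x. f x - g x) n x = conj_fejer_mean f n x - conj_fejer_mean g n x"
  unfolding conj_fejer_mean_def conj_harmonic_def fourier_a_diff[OF assms] fourier_b_diff[OF assms]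
  by (simp add: sum_subtractf[symmetric] algebra_simps)

text \<open>This is the reason for Fejer means in place of partial sums: it makes the real part of
  the analytic polynomial nonnegative.\<close>

lemma fejer_mean_nonneg:
  assumes "integrable circ f" "\<And>x. 0 \<le> f x"
  shows "0 \<le> fejer_mean f n x"
  unfolding fejer_mean_eq_integral[OF assms(1)] using assms(2) fejer_kernel_nonneg
  by (intro mult_nonneg_nonneg integral_nonneg_AE AE_I2) auto

text \<open>Fejer mean and conjugate Fejer mean are, on the unit circle, the real and imaginary
  parts of one polynomial. Adding a small e > 0 keeps it off the imaginary axis, as
  \<open>Riesz_half_plane\<close> demands.\<close>

lemma conj_fejer_mean_nonneg_bound:
  fixes p :: real
  assumes p: "1 < p" "p \<le> 2"
  shows "\<exists>C\<ge>0. \<forall>f n. f \<in> periodic_Lp p \<and> (\<forall>x. 0 \<le> f x) \<longrightarrow> Lp_norm p (conj_fejer_mean f n) \<le> C * Lp_norm p f"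
proof -
  obtain A where A: "0 \<le> A" and R: "\<And>G e. G holomorphic_on UNIV \<Longrightarrow> 0 < e \<Longrightarrow> (\<And>x. e \<le> Re (G (cis x))) \<Longrightarrow> Im (G 0) = 0 \<Longrightarrow>
    (LINT x|circ. \<bar>Im (G (cis x))\<bar> powr p) \<le> A * (LINT x|circ. Re (G (cis x)) powr p)"
    using Riesz_half_plane[OF p] by metis
  have "Lp_norm p (conj_fejer_mean f n) \<le> A powr (1/p) * Lp_norm p f"
    if f: "f \<in> periodic_Lp p" and f0: "\<And>x. 0 \<le> f x" for f n
  proof (rule field_le_epsilon)
    fix d :: real assume d: "0 < d"
    \<comment> \<open>Makes (A^(1/p) + 1) e equal to the permitted excess d; the summand 1 guards
      against A = 0.\<close>
    define e where "e = d / (A powr (1/p) + 1)"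
    have Ap: "0 < A powr (1/p) + 1" using powr_ge_zero[of A "1/p"] by linarith
    have e: "0 < e" using d Ap by (simp add: e_def)
    have fi: "integrable circ f" using periodic_Lp_integrable[OF f] p by simp
    define c where "c k = complex_of_real (1 - real k / (real n + 1)) * Complex (fourier_a f k) (- fourier_b f k)" for k
    define G where "G z = complex_of_real (fourier_a f 0 / 2 + e) + (\<Sum>k=1..n. c k * z ^ k)" for z
    have G: "G (cis x) = Complex (fejer_mean f n x + e) (conj_fejer_mean f n x)" for x
    proof -
      have "c k * cis x ^ k = Complex ((1 - real k / (real n + 1)) * harmonic f k x) ((1 - real k / (real n + 1)) * conj_harmonic f k x)" for k
      proof -
        have "cis x ^ k = Complex (cos (real k * x)) (sin (real k * x))"
          by (simp add: Complex.DeMoivre complex_eq_iff)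
        then show ?thesis
          by (simp add: c_def complex_eq_iff harmonic_def conj_harmonic_def algebra_simps add_divide_distrib diff_divide_distrib)
      qed
      then show ?thesis
        by (simp add: G_def complex_eq_iff fejer_mean_eq conj_fejer_mean_def)
    qed
    have "(LINT x|circ. \<bar>Im (G (cis x))\<bar> powr p) \<le> A * (LINT x|circ. Re (G (cis x)) powr p)"
    proof (rule R[OF _ e])
      show "G holomorphic_on UNIV" unfolding G_def by (intro holomorphic_intros)
      show "e \<le> Re (G (cis x))" for x using fejer_mean_nonneg[OF fi f0, of n x] by (simp add: G)
      show "Im (G 0) = 0" by (simp add: G_def sum.neutral power_0_left)
    qed
    also have "(LINT x|circ. Re (G (cis x)) powr p) = (LINT x|circ. \<bar>fejer_mean f n x + e\<bar> powr p)"
      using fejer_mean_nonneg[OF fi f0, of n] e by (simp add: G)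
    also have "\<dots> \<le> 2 * pi * (Lp_norm p f + e) powr p"
    proof (rule Lp_integral_leI)
      have "Lp_norm p (\<lambda>x. fejer_mean f n x + e) \<le> Lp_norm p (fejer_mean f n) + Lp_norm p (\<lambda>x. e)"
        using p by (intro Lp_norm_add_le in_Lp_trig_poly[OF fejer_mean_trig_poly] in_Lp_const) auto
      also have "\<dots> \<le> Lp_norm p f + e"
        using fejer_mean_norm_le[OF f, of n] p e by (simp add: Lp_norm_const)
      finally show "Lp_norm p (\<lambda>x. fejer_mean f n x + e) \<le> Lp_norm p f + e" .
    qed (use p in auto)
    finally have "(LINT x|circ. \<bar>conj_fejer_mean f n x\<bar> powr p) \<le> A * (2 * pi * (Lp_norm p f + e) powr p)"
      using A by (simp add: G mult_left_mono)
    also have "\<dots> = 2 * pi * (A powr (1/p) * (Lp_norm p f + e)) powr p"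
      using p A by (simp add: powr_mult powr_powr)
    finally have "Lp_norm p (conj_fejer_mean f n) \<le> A powr (1/p) * (Lp_norm p f + e)"
      using p e Lp_norm_nonneg[of p f] by (intro Lp_norm_leI) auto
    also have "\<dots> \<le> A powr (1/p) * Lp_norm p f + (A powr (1/p) + 1) * e"
      using e by (simp add: algebra_simps)
    also have "(A powr (1/p) + 1) * e = d" using Ap by (simp add: e_def)
    finally show "Lp_norm p (conj_fejer_mean f n) \<le> A powr (1/p) * Lp_norm p f + d" .
  qed
  then show ?thesis by (intro exI[of _ "A powr (1/p)"]) auto
qed

lemma conj_fejer_mean_bound_le_2:
  fixes p :: real
  assumes p: "1 < p" "p \<le> 2"
  shows "\<exists>C\<ge>0. \<forall>f n. f \<in> periodic_Lp p \<longrightarrow> Lp_norm p (conj_fejer_mean f n) \<le> C * Lp_norm p f"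
proof -
  obtain C where C: "0 \<le> C" and bound: "\<And>f n. f \<in> periodic_Lp p \<Longrightarrow> (\<And>x. 0 \<le> f x) \<Longrightarrow> Lp_norm p (conj_fejer_mean f n) \<le> C * Lp_norm p f"
    using conj_fejer_mean_nonneg_bound[OF p] by metis
  have "Lp_norm p (conj_fejer_mean f n) \<le> 2 * C * Lp_norm p f" if f: "f \<in> periodic_Lp p" for f n
  proof -
    \<comment> \<open>\<open>g 1\<close> and \<open>g (-1)\<close> are the positive and the negative
      part of f.\<close>
    define g where "g s x = max (s * f x) 0" for s x
    have g: "g s \<in> periodic_Lp p" "Lp_norm p (g s) \<le> Lp_norm p f" "\<And>x. 0 \<le> g s x" if "\<bar>s\<bar> = 1" for s
    proof -
      have [measurable]: "f \<in> borel_measurable borel" using f by (simp add: periodic_Lp_def)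
      have le: "\<bar>g s x\<bar> \<le> \<bar>f x\<bar>" for x
        using that abs_mult[of s "f x"] by (auto simp: g_def max_def)
      have m: "g s \<in> borel_measurable borel" unfolding g_def[abs_def] by measurable
      have "in_Lp p (g s)"
        by (rule in_LpI_dominated[where h="\<lambda>x. \<bar>f x\<bar> powr p"])
           (use m f le p in \<open>auto simp: periodic_Lp_def in_Lp_def intro!: powr_mono2\<close>)
      then show "g s \<in> periodic_Lp p" using m f by (simp add: periodic_Lp_def g_def)
      show "Lp_norm p (g s) \<le> Lp_norm p f"
        using le f p by (intro Lp_norm_mono) (auto simp: periodic_Lp_def)
      show "0 \<le> g s x" for x by (simp add: g_def)
    qed
    have gi: "integrable circ (g 1)" "integrable circ (g (-1))"
      using p by (auto intro!: periodic_Lp_integrable[of _ p] g(1))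
    have "f = (\<lambda>x. g 1 x - g (-1) x)" by (auto simp: g_def max_def)
    then have "Lp_norm p (conj_fejer_mean f n) = Lp_norm p (\<lambda>x. conj_fejer_mean (g 1) n x - conj_fejer_mean (g (-1)) n x)"
      using conj_fejer_mean_diff[OF gi, of n] by (metis (no_types, lifting) Lp_norm_cong)
    also have "\<dots> \<le> Lp_norm p (conj_fejer_mean (g 1) n) + Lp_norm p (conj_fejer_mean (g (-1)) n)"
      using p by (intro Lp_norm_diff_le in_Lp_trig_poly[OF conj_fejer_mean_trig_poly]) auto
    also have "\<dots> \<le> C * Lp_norm p (g 1) + C * Lp_norm p (g (-1))"
      using g by (intro add_mono bound) auto
    also have "\<dots> \<le> C * Lp_norm p f + C * Lp_norm p f"
      using g C by (intro add_mono mult_left_mono) auto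
    finally show ?thesis by simp
  qed
  then show ?thesis using C by (intro exI[of _ "2 * C"]) auto
qed

text \<open>Conjugation is skew-adjoint: at each frequency both integrals reduce to a determinant of
  the coefficients of f and h, antisymmetric in the two functions. This carries a bound from one
  exponent to its conjugate.\<close>

lemma integral_conj_fejer_mean_swap:
  assumes f: "integrable circ f" and h: "integrable circ h"
  shows "(LINT x|circ. conj_fejer_mean f n x * h x) = - (LINT x|circ. f x * conj_fejer_mean h n x)"
proof -
  have *: "(LINT x|circ. g x * conj_harmonic f k x) = pi * (fourier_a f k * fourier_b g k - fourier_b f k * fourier_a g k)"
    if "integrable circ g" for f g k
  proof -
    have "(LINT x|circ. g x * conj_harmonic f k x) =
      (LINT x|circ. fourier_a f k * (g x * sin (real k * x)) - fourier_b f k * (g x * cos (real k * x)))"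
      by (simp add: conj_harmonic_def algebra_simps)
    also have "\<dots> = fourier_a f k * (LINT x|circ. g x * sin (real k * x)) - fourier_b f k * (LINT x|circ. g x * cos (real k * x))"
      using integrable_mult_cos_sin[OF that, of k] by simp
    finally show ?thesis by (simp add: fourier_a_def fourier_b_def algebra_simps)
  qed
  have **: "(LINT x|circ. g x * conj_fejer_mean f n x) = (\<Sum>k=1..n. (1 - real k / (real n + 1)) * (LINT x|circ. g x * conj_harmonic f k x))"
    if "integrable circ g" for f g
  proof -
    have "(LINT x|circ. g x * conj_fejer_mean f n x) = (LINT x|circ. (\<Sum>k=1..n. (1 - real k / (real n + 1)) * (g x * conj_harmonic f k x)))"
      by (simp add: conj_fejer_mean_def sum_distrib_left mult.left_commute)
    also have "\<dots> = (\<Sum>k=1..n. (LINT x|circ. (1 - real k / (real n + 1)) * (g x * conj_harmonic f k x)))"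
      by (intro Bochner_Integration.integral_sum integrable_mult_right integrable_mult_trig_poly[OF that conj_harmonic_trig_poly[OF order_refl]])
    finally show ?thesis by simp
  qed
  have "(LINT x|circ. conj_fejer_mean f n x * h x) = (LINT x|circ. h x * conj_fejer_mean f n x)" by (simp add: mult.commute)
  then show ?thesis
    unfolding **[OF f] **[OF h] *[OF f] *[OF h]
    by (simp add: sum_negf[symmetric] algebra_simps)
qed

text \<open>For p > 2 the conjugate exponent q is below 2. Testing the conjugate mean v against its
  own extremal function gives ||v||^p \<le> C ||f|| ||v||^(p - 1), from which the power of ||v|| is
  cancelled.\<close>

theorem conj_fejer_mean_bound:
  fixes p :: real
  assumes p: "1 < p"
  shows "\<exists>C\<ge>0. \<forall>f n. f \<in> periodic_Lp p \<longrightarrow> Lp_norm p (conj_fejer_mean f n) \<le> C * Lp_norm p f"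
proof (cases "p \<le> 2")
  case True
  then show ?thesis using conj_fejer_mean_bound_le_2[OF p] by blast
next
  case False
  define q where "q = p / (p - 1)"
  have q: "1 < q" "q \<le> 2" "1 / p + 1 / q = 1" "(p - 1) * q = p"
    using False by (auto simp: q_def field_simps)
  obtain C where C: "0 \<le> C" and bound: "\<And>f n. f \<in> periodic_Lp q \<Longrightarrow> Lp_norm q (conj_fejer_mean f n) \<le> C * Lp_norm q f"
    using conj_fejer_mean_bound_le_2[OF q(1,2)] by blast
  have "Lp_norm p (conj_fejer_mean f n) \<le> C * Lp_norm p f" if f: "f \<in> periodic_Lp p" for f n
  proof -
    define v where "v = conj_fejer_mean f n"
    have v: "v \<in> trig_poly n" unfolding v_def by (rule conj_fejer_mean_trig_poly)
    have [measurable]: "v \<in> borel_measurable borel" using trig_poly_measurable[OF v] .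
    \<comment> \<open>The extremal function of Hoelder's inequality: v h = |v|^p and |h|^q = |v|^p.
      It lies in L^q because the polynomial v is bounded.\<close>
    define h where "h x = sgn (v x) * \<bar>v x\<bar> powr (p - 1)" for x
    have absh: "\<bar>h x\<bar> = \<bar>v x\<bar> powr (p - 1)" for x by (simp add: h_def abs_mult abs_sgn_eq)
    have vh: "v x * h x = \<bar>v x\<bar> powr p" for x
    proof (cases "v x = 0")
      case False
      have "v x * h x = \<bar>v x\<bar> * \<bar>v x\<bar> powr (p - 1)" by (simp add: h_def abs_sgn mult_ac)
      also have "\<dots> = \<bar>v x\<bar> powr p" using False by (simp add: powr_diff)
      finally show ?thesis .
    qed simp
    obtain Bv where Bv: "\<And>x. \<bar>v x\<bar> \<le> Bv" using trig_poly_bounded[OF v] by blast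
    have "\<bar>h x\<bar> \<le> Bv powr (p - 1)" for x
      unfolding absh using Bv p by (intro powr_mono2) auto
    moreover have hm: "h \<in> borel_measurable borel" unfolding h_def[abs_def] by measurable
    ultimately have hq: "h \<in> periodic_Lp q"
      using in_Lp_bounded[of h q "Bv powr (p - 1)"] q trig_poly_periodic[OF v]
      by (auto simp: periodic_Lp_def h_def)
    have hn: "Lp_norm q h = Lp_norm p v powr (p - 1)"
    proof -
      have e: "(\<bar>v x\<bar> powr (p - 1)) powr q = \<bar>v x\<bar> powr p" for x
        by (simp add: powr_powr q(4))
      have "1 / p * (p - 1) = 1 / q" by (simp add: q_def)
      then show ?thesis
        unfolding Lp_norm_def absh e by (simp only: powr_powr)
    qed
    have fi: "integrable circ f" using periodic_Lp_integrable[OF f] p by simp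
    have hi: "integrable circ h" using periodic_Lp_integrable[OF hq] q by simp
    have cq: "in_Lp q (conj_fejer_mean h n)" using in_Lp_trig_poly[OF conj_fejer_mean_trig_poly] q by simp
    have fp: "in_Lp p f" using f by (simp add: periodic_Lp_def)
    have "2 * pi * Lp_norm p v powr p = (LINT x|circ. v x * h x)"
      using Lp_integral_eq[of p v] p by (simp add: vh)
    also have "\<dots> = - (LINT x|circ. f x * conj_fejer_mean h n x)"
      unfolding v_def by (rule integral_conj_fejer_mean_swap[OF fi hi])
    also have "\<dots> \<le> \<bar>LINT x|circ. f x * conj_fejer_mean h n x\<bar>" by simp
    also have "\<dots> \<le> (LINT x|circ. \<bar>f x * conj_fejer_mean h n x\<bar>)" by (rule integral_abs_bound)
    also have "\<dots> \<le> 2 * pi * (Lp_norm p f * Lp_norm q (conj_fejer_mean h n))"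
      by (rule Hoelder_circ(2)[OF fp cq p q(1) q(3)])
    also have "\<dots> \<le> 2 * pi * (Lp_norm p f * (C * Lp_norm q h))"
      using bound[OF hq, of n] Lp_norm_nonneg by (intro mult_left_mono) auto
    also have "\<dots> = 2 * pi * (C * Lp_norm p f * Lp_norm p v powr (p - 1))"
      by (simp add: hn)
    finally have main: "Lp_norm p v powr p \<le> C * Lp_norm p f * Lp_norm p v powr (p - 1)" by simp
    have "Lp_norm p v \<le> C * Lp_norm p f"
    proof (cases "Lp_norm p v = 0")
      case True
      then show ?thesis using C Lp_norm_nonneg[of p f] by simp
    next
      case False
      then have v0: "Lp_norm p v > 0" using Lp_norm_nonneg[of p v] by linarith
      have "Lp_norm p v powr p = Lp_norm p v * Lp_norm p v powr (p - 1)"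
        using v0 by (simp add: powr_diff)
      with main have "Lp_norm p v * Lp_norm p v powr (p - 1) \<le> C * Lp_norm p f * Lp_norm p v powr (p - 1)" by simp
      then show ?thesis using v0 by (auto dest: mult_right_le_imp_le)
    qed
    then show ?thesis unfolding v_def .
  qed
  with C show ?thesis by blast
qed

section \<open>Partial sums in \<open>L\<^sup>p\<close>, \<open>p > 1\<close>\<close>

definition conj_sum :: "(real \<Rightarrow> real) \<Rightarrow> nat \<Rightarrow> real \<Rightarrow> real" where
  "conj_sum f n x = (\<Sum>k=1..n. conj_harmonic f k x)"

lemma conj_sum_trig_poly: "conj_sum f n \<in> trig_poly n"
  unfolding conj_sum_def [abs_def] by (intro trig_poly_sum conj_harmonic_trig_poly) auto

text \<open>For fixed g the taper 1 - k / (n + 1) tends to 1 as n grows, while the bound for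
  \<open>conj_fejer_mean\<close> does not depend on n. The constant is therefore uniform in the
  degree.\<close>

lemma conj_sum_bound:
  fixes p :: real
  assumes p: "1 < p"
  shows "\<exists>C\<ge>0. \<forall>d g. g \<in> trig_poly d \<longrightarrow> Lp_norm p (conj_sum g d) \<le> C * Lp_norm p g"
proof -
  obtain C where C: "0 \<le> C" and bound: "\<And>f n. f \<in> periodic_Lp p \<Longrightarrow> Lp_norm p (conj_fejer_mean f n) \<le> C * Lp_norm p f"
    using conj_fejer_mean_bound[OF p] by blast
  have "Lp_norm p (conj_sum g d) \<le> C * Lp_norm p g" if g: "g \<in> trig_poly d" for g d
  proof -
    define R where "R x = (\<Sum>k=1..d. real k * conj_harmonic g k x)" for x
    have R: "R \<in> trig_poly d" unfolding R_def[abs_def]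
      by (intro trig_poly_sum trig_poly_cmult conj_harmonic_trig_poly) auto
    have le: "Lp_norm p (conj_sum g d) \<le> C * Lp_norm p g + (1 / (real n + 1)) * Lp_norm p R" if n: "d \<le> n" for n
    proof -
      have "conj_fejer_mean g n x = (\<Sum>k=1..d. (1 - real k / (real n + 1)) * conj_harmonic g k x)" for x
        unfolding conj_fejer_mean_def
        by (rule sum.mono_neutral_right) (use n fourier_trig_poly_zero[OF g] in \<open>auto simp: conj_harmonic_def\<close>)
      also have "\<dots> x = conj_sum g d x - (1 / (real n + 1)) * R x" for x
        by (simp add: conj_sum_def R_def sum_subtractf left_diff_distrib sum_divide_distrib)
      finally have "conj_sum g d x = conj_fejer_mean g n x + (1 / (real n + 1)) * R x" for x by simp
      then have "Lp_norm p (conj_sum g d) = Lp_norm p (\<lambda>x. conj_fejer_mean g n x + (1 / (real n + 1)) * R x)"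
        by (intro Lp_norm_cong)
      also have "\<dots> \<le> Lp_norm p (conj_fejer_mean g n) + Lp_norm p (\<lambda>x. (1 / (real n + 1)) * R x)"
        using p by (intro Lp_norm_add_le in_Lp_cmult in_Lp_trig_poly[OF conj_fejer_mean_trig_poly] in_Lp_trig_poly[OF R]) auto
      also have "\<dots> \<le> C * Lp_norm p g + (1 / (real n + 1)) * Lp_norm p R"
        using p bound[OF trig_poly_periodic_Lp[OF g], of n] by (subst Lp_norm_cmult) auto
      finally show ?thesis .
    qed
    have "(\<lambda>n. C * Lp_norm p g + (1 / (real n + 1)) * Lp_norm p R) \<longlonglongrightarrow> C * Lp_norm p g + 0 * Lp_norm p R"
    proof (intro tendsto_intros)
      show "(\<lambda>n. 1 / (real n + 1)) \<longlonglongrightarrow> 0"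
        using LIMSEQ_inverse_real_of_nat by (simp add: inverse_eq_divide add.commute)
    qed
    then show ?thesis using le by (intro LIMSEQ_le_const[where a="Lp_norm p (conj_sum g d)"]) auto
  qed
  with C show ?thesis by blast
qed

text \<open>Product-to-sum gives cos ((k - n) s) - cos ((k + n) s). The difference frequencies n -
  1, ..., 0 make up \<open>Z n\<close> and 1, ..., e make up \<open>Z (e + 1) - 1\<close>; the sum
  frequencies n + 1, ..., 2 n + e account for the other two terms.\<close>

lemma conj_kernel_modulation:
  fixes s :: real
  defines "Z \<equiv> \<lambda>m. \<Sum>k<m. cos (real k * s)"
  shows "2 * (\<Sum>k=1..n+e. sin (real k * s) * sin (real n * s)) = Z n + Z (n + 1) + Z (e + 1) - 1 - Z (2 * n + e + 1)"
proof -
  have Z_Suc: "Z (Suc m) = Z m + cos (real m * s)" for m by (simp add: Z_def)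
  \<comment> \<open>Up to k = n the difference frequency is n - k, beyond it k - n; with natural
    frequencies this takes two inductions.\<close>
  have base: "2 * (\<Sum>k=1..m. sin (real k * s) * sin (real n * s)) = Z n - Z (n - m) - Z (n + m + 1) + Z (n + 1)"
    if "m \<le> n" for m
    using that
  proof (induction m)
    case (Suc m)
    have e: "real (Suc m) * s - real n * s = - (real (n - Suc m) * s)" "real (Suc m) * s + real n * s = real (n + m + 1) * s"
      using Suc.prems by (auto simp: algebra_simps)
    have "2 * (sin (real (Suc m) * s) * sin (real n * s)) = cos (real (n - Suc m) * s) - cos (real (n + m + 1) * s)"
      unfolding sin_times_sin e by simp
    moreover have "Z (n - m) = Z (n - Suc m) + cos (real (n - Suc m) * s)"
      using Z_Suc[of "n - Suc m"] Suc.prems by (simp add: Suc_diff_Suc)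
    moreover have "Z (n + Suc m + 1) = Z (n + m + 1) + cos (real (n + m + 1) * s)"
      using Z_Suc[of "n + m + 1"] by simp
    moreover have "2 * (\<Sum>k=1..m. sin (real k * s) * sin (real n * s)) = Z n - Z (n - m) - Z (n + m + 1) + Z (n + 1)"
      using Suc by simp
    moreover have "2 * (\<Sum>k=1..Suc m. sin (real k * s) * sin (real n * s)) =
        2 * (\<Sum>k=1..m. sin (real k * s) * sin (real n * s)) + 2 * (sin (real (Suc m) * s) * sin (real n * s))"
      by (simp only: sum.nat_ivl_Suc' le_add1 plus_1_eq_Suc le_SucI Suc_le_mono le0 One_nat_def distrib_left add.commute)
    ultimately show ?case by linarith
  qed simp
  show ?thesis
  proof (induction e)
    case 0
    have "Z 0 = 0" "Z 1 = 1" by (simp_all add: Z_def)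
    then show ?case
      using base[OF order_refl] unfolding add_0_right add_0 mult_2 diff_self_eq_0 by linarith
  next
    case (Suc e)
    have e: "real (n + Suc e) * s - real n * s = real (e + 1) * s" "real (n + Suc e) * s + real n * s = real (2 * n + e + 1) * s"
      by (auto simp: algebra_simps)
    have "2 * (sin (real (n + Suc e) * s) * sin (real n * s)) = cos (real (e + 1) * s) - cos (real (2 * n + e + 1) * s)"
      unfolding sin_times_sin e by simp
    moreover have "Z (Suc e + 1) = Z (e + 1) + cos (real (e + 1) * s)" "Z (2 * n + Suc e + 1) = Z (2 * n + e + 1) + cos (real (2 * n + e + 1) * s)"
      using Z_Suc[of "e + 1"] Z_Suc[of "2 * n + e + 1"] by simp_all
    moreover have "2 * (\<Sum>k=1..n + Suc e. sin (real k * s) * sin (real n * s)) =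
        2 * (\<Sum>k=1..n + e. sin (real k * s) * sin (real n * s)) + 2 * (sin (real (n + Suc e) * s) * sin (real n * s))"
      unfolding add_Suc_right by (simp only: sum.nat_ivl_Suc' le_add1 plus_1_eq_Suc le_SucI Suc_le_mono le0 One_nat_def distrib_left add.commute)
    ultimately show ?case using Suc by linarith
  qed
qed

text \<open>
  Modulation by frequency \<open>n\<close> moves the jump of the conjugation multiplier from \<open>0\<close> to
  \<open>\<plusminus>n\<close>; the boundary terms of frequency \<open>n\<close> get weight one half.
\<close>
lemma fourier_sum_modulation:
  assumes g: "g \<in> trig_poly d"
  shows "sin (real n * x) * conj_sum (\<lambda>t. g t * cos (real n * t)) (n + d) x
    - cos (real n * x) * conj_sum (\<lambda>t. g t * sin (real n * t)) (n + d) x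
    = fourier_sum g n x - harmonic g n x / 2"
proof -
  have gi: "integrable circ g" by (rule trig_poly_integrable[OF g])
  note gc = integrable_mult_cos_sin(1)[OF gi, of n] and gs = integrable_mult_cos_sin(2)[OF gi, of n]
  define w where "w k t = sin (real k * t) * sin (real n * t)" for k t
  have w: "w k \<in> trig_poly (k + n)" for k
    unfolding w_def[abs_def] by (intro trig_poly_mult trig_poly_sin) auto
  define Z where "Z m t = (\<Sum>k<m. cos (real k * t))" for m t
  have iw: "integrable circ (\<lambda>t. g t * w k (x - t))" for k
    by (rule integrable_mult_translate_trig_poly[OF gi w])
  have ic: "integrable circ (\<lambda>t. g t * cos (real k * (x - t)))" for k
    by (rule integrable_mult_translate_trig_poly[OF gi trig_poly_cos[OF order_refl]])
  \<comment> \<open>By sin (n x) cos (n t) - cos (n x) sin (n t) = sin (n (x - t)), the modulated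
    combination is again a convolution, with kernel sin (k s) sin (n s).\<close>
  have "sin (real n * x) * conj_harmonic (\<lambda>t. g t * cos (real n * t)) k x
    - cos (real n * x) * conj_harmonic (\<lambda>t. g t * sin (real n * t)) k x
    = 1 / pi * (LINT t|circ. g t * w k (x - t))" for k
  proof -
    have i: "integrable circ (\<lambda>t. g t * cos (real n * t) * sin (real k * (x - t)))" "integrable circ (\<lambda>t. g t * sin (real n * t) * sin (real k * (x - t)))"
      using integrable_mult_translate_trig_poly[OF gc trig_poly_sin[OF order_refl, of k]]
        integrable_mult_translate_trig_poly[OF gs trig_poly_sin[OF order_refl, of k]] by auto
    have "(LINT t|circ. g t * w k (x - t)) =
      (LINT t|circ. sin (real n * x) * (g t * cos (real n * t) * sin (real k * (x - t))) - cos (real n * x) * (g t * sin (real n * t) * sin (real k * (x - t))))"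
    proof -
      have "g t * w k (x - t) = sin (real n * x) * (g t * cos (real n * t) * sin (real k * (x - t))) - cos (real n * x) * (g t * sin (real n * t) * sin (real k * (x - t)))" for t
        unfolding w_def right_diff_distrib[of "real n" x t] sin_diff[of "real n * x"] by (simp add: algebra_simps)
      then show ?thesis by simp
    qed
    also have "\<dots> = sin (real n * x) * (LINT t|circ. g t * cos (real n * t) * sin (real k * (x - t))) - cos (real n * x) * (LINT t|circ. g t * sin (real n * t) * sin (real k * (x - t)))"
      using i by simp
    finally show ?thesis
      unfolding conj_harmonic_eq_integral[OF gc] conj_harmonic_eq_integral[OF gs]
      by (simp add: right_diff_distrib mult.left_commute)
  qed
  then have "sin (real n * x) * conj_sum (\<lambda>t. g t * cos (real n * t)) (n + d) x
    - cos (real n * x) * conj_sum (\<lambda>t. g t * sin (real n * t)) (n + d) x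
    = (\<Sum>k=1..n+d. 1 / pi * (LINT t|circ. g t * w k (x - t)))"
    unfolding conj_sum_def by (simp add: sum_distrib_left sum_subtractf[symmetric])
  also have "\<dots> = 1 / pi * (LINT t|circ. (\<Sum>k=1..n+d. g t * w k (x - t)))"
    using iw by (simp add: sum_divide_distrib)
  also have "(\<lambda>t. \<Sum>k=1..n+d. g t * w k (x - t)) =
     (\<lambda>t. (1/2) * (g t * Z n (x - t) + g t * Z (n + 1) (x - t) + g t * Z (d + 1) (x - t) - g t * Z 1 (x - t) - g t * Z (2 * n + d + 1) (x - t)))"
  proof
    fix t
    have "(\<Sum>k=1..n+d. g t * w k (x - t)) = (1/2) * (g t * (2 * (\<Sum>k=1..n+d. w k (x - t))))"
      by (simp add: sum_distrib_left)
    also have "2 * (\<Sum>k=1..n+d. w k (x - t)) = Z n (x - t) + Z (n + 1) (x - t) + Z (d + 1) (x - t) - 1 - Z (2 * n + d + 1) (x - t)"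
      unfolding w_def Z_def by (rule conj_kernel_modulation)
    finally show "(\<Sum>k=1..n+d. g t * w k (x - t)) = (1/2) * (g t * Z n (x - t) + g t * Z (n + 1) (x - t) + g t * Z (d + 1) (x - t) - g t * Z 1 (x - t) - g t * Z (2 * n + d + 1) (x - t))"
      by (simp add: algebra_simps Z_def)
  qed
  also have "1 / pi * (LINT t|circ. (1/2) * (g t * Z n (x - t) + g t * Z (n + 1) (x - t) + g t * Z (d + 1) (x - t) - g t * Z 1 (x - t) - g t * Z (2 * n + d + 1) (x - t)))
     = 1 / 2 * ((\<Sum>k<n. harmonic g k x) + (\<Sum>k<n+1. harmonic g k x) + (\<Sum>k<d+1. harmonic g k x) - (\<Sum>k<1. harmonic g k x) - (\<Sum>k<2*n+d+1. harmonic g k x))"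
  proof -
    have iZ: "integrable circ (\<lambda>t. g t * Z m (x - t))" for m
      using ic by (simp add: Z_def sum_distrib_left)
    have LZ: "(LINT t|circ. g t * Z m (x - t)) = pi * (\<Sum>k<m. harmonic g k x)" for m
      using ic by (simp add: Z_def sum_distrib_left harmonic_eq_integral[OF gi])
    have "(LINT t|circ. (1/2) * (g t * Z n (x - t) + g t * Z (n + 1) (x - t) + g t * Z (d + 1) (x - t) - g t * Z 1 (x - t) - g t * Z (2 * n + d + 1) (x - t)))
      = 1/2 * ((LINT t|circ. g t * Z n (x - t)) + (LINT t|circ. g t * Z (n + 1) (x - t)) + (LINT t|circ. g t * Z (d + 1) (x - t)) - (LINT t|circ. g t * Z 1 (x - t)) - (LINT t|circ. g t * Z (2 * n + d + 1) (x - t)))"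
      using iZ[of n] iZ[of "n + 1"] iZ[of "d + 1"] iZ[of 1] iZ[of "2 * n + d + 1"]
      by (simp only: integral_mult_right_zero Bochner_Integration.integral_add Bochner_Integration.integral_diff
          Bochner_Integration.integrable_add Bochner_Integration.integrable_diff)
    then show ?thesis unfolding LZ by (simp add: field_simps)
  qed
  \<comment> \<open>Degree d kills all frequencies above d, so this sum cancels the one up to
    d.\<close>
  also have "(\<Sum>k<2*n+d+1. harmonic g k x) = (\<Sum>k<d+1. harmonic g k x)"
    by (rule sum.mono_neutral_right) (use fourier_trig_poly_zero[OF g] in \<open>auto simp: harmonic_def\<close>)
  also have "(\<Sum>k<n. harmonic g k x) = (\<Sum>k<n+1. harmonic g k x) - harmonic g n x" by simp
  also have "(\<Sum>k<n+1. harmonic g k x) = fourier_sum g n x + fourier_a g 0 / 2"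
  proof -
    have "{..<n+1} = insert 0 {1..n}" by auto
    then show ?thesis by (simp add: fourier_sum_harmonic harmonic_def)
  qed
  also have "(\<Sum>k<1. harmonic g k x) = fourier_a g 0" by (simp add: harmonic_def)
  finally show ?thesis by (simp add: field_simps)
qed

text \<open>The coefficients are bounded through the L^1 norm. The estimate restores the half of
  frequency n that the modulation identity leaves out.\<close>

lemma harmonic_norm_le:
  assumes f: "in_Lp p f" and p: "1 \<le> p"
  shows "Lp_norm p (harmonic f k) \<le> 4 * Lp_norm p f"
proof -
  have fi: "integrable circ f" using in_Lp_integrable[OF f p] .
  have coeff: "\<bar>1 / pi * (LINT x|circ. f x * c x)\<bar> \<le> 2 * Lp_norm p f"
    if c: "\<And>x. \<bar>c x\<bar> \<le> 1" "integrable circ (\<lambda>x. f x * c x)" for c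
  proof -
    have "\<bar>LINT x|circ. f x * c x\<bar> \<le> (LINT x|circ. \<bar>f x * c x\<bar>)" by (rule integral_abs_bound)
    also have "\<dots> \<le> (LINT x|circ. \<bar>f x\<bar>)"
    proof (rule integral_mono)
      show "integrable circ (\<lambda>x. \<bar>f x * c x\<bar>)" using c(2) by (rule integrable_abs)
      show "integrable circ (\<lambda>x. \<bar>f x\<bar>)" using fi by (rule integrable_abs)
      show "\<bar>f x * c x\<bar> \<le> \<bar>f x\<bar>" for x
        using mult_left_mono[OF c(1)[of x], of "\<bar>f x\<bar>"] by (simp add: abs_mult)
    qed
    also have "\<dots> \<le> 2 * pi * Lp_norm p f" by (rule L1_norm_le_Lp_norm[OF f p])
    finally show ?thesis by (simp add: abs_mult field_simps)
  qed
  have a: "\<bar>fourier_a f k\<bar> \<le> 2 * Lp_norm p f" and b: "\<bar>fourier_b f k\<bar> \<le> 2 * Lp_norm p f"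
    unfolding fourier_a_def fourier_b_def using integrable_mult_cos_sin[OF fi] by (intro coeff; simp)+
  have "Lp_norm p (harmonic f k) \<le> Lp_norm p (\<lambda>x. 4 * Lp_norm p f)"
  proof (rule Lp_norm_mono)
    fix x
    have "\<bar>harmonic f k x\<bar> \<le> \<bar>fourier_a f k\<bar> * \<bar>cos (real k * x)\<bar> + \<bar>fourier_b f k\<bar> * \<bar>sin (real k * x)\<bar>"
      unfolding harmonic_def abs_mult[symmetric] by (rule abs_triangle_ineq)
    also have "\<dots> \<le> 2 * Lp_norm p f * 1 + 2 * Lp_norm p f * 1"
      using a b Lp_norm_nonneg[of p f] by (intro add_mono mult_mono) auto
    finally show "\<bar>harmonic f k x\<bar> \<le> \<bar>4 * Lp_norm p f\<bar>" by simp
  qed (use p in \<open>auto intro: in_Lp_const\<close>)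
  then show ?thesis using p Lp_norm_nonneg[of p f] by (simp add: Lp_norm_const)
qed

text \<open>Multiplying by cos (n t) or sin (n t) does not increase the norm, neither before nor
  after conjugation, so the two modulated terms cost 2 C; half a harmonic adds 2.\<close>

lemma fourier_sum_trig_poly_bound:
  fixes p :: real
  assumes p: "1 < p"
  shows "\<exists>C\<ge>0. \<forall>d g n. g \<in> trig_poly d \<longrightarrow> Lp_norm p (fourier_sum g n) \<le> C * Lp_norm p g"
proof -
  obtain C where C: "0 \<le> C" and bound: "\<And>d g. g \<in> trig_poly d \<Longrightarrow> Lp_norm p (conj_sum g d) \<le> C * Lp_norm p g"
    using conj_sum_bound[OF p] by blast
  have "Lp_norm p (fourier_sum g n) \<le> (2 * C + 2) * Lp_norm p g" if g: "g \<in> trig_poly d" for g d n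
  proof -
    have gL: "in_Lp p g" using in_Lp_trig_poly[OF g] p by simp
    have part: "Lp_norm p (\<lambda>x. w x * conj_sum (\<lambda>t. g t * v t) (n + d) x) \<le> C * Lp_norm p g"
      if "v \<in> trig_poly n" "\<And>x. \<bar>v x\<bar> \<le> 1" "\<And>x. \<bar>w x\<bar> \<le> 1" for v w
    proof -
      have gv: "(\<lambda>t. g t * v t) \<in> trig_poly (n + d)"
        using trig_poly_mult[OF g that(1)] by (simp add: add.commute)
      have "Lp_norm p (\<lambda>x. w x * conj_sum (\<lambda>t. g t * v t) (n + d) x) \<le> Lp_norm p (conj_sum (\<lambda>t. g t * v t) (n + d))"
        using p mult_right_mono[OF that(3)] in_Lp_trig_poly[OF conj_sum_trig_poly]
        by (intro Lp_norm_mono) (auto simp: abs_mult)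
      also have "\<dots> \<le> C * Lp_norm p (\<lambda>t. g t * v t)" by (rule bound[OF gv])
      also have "\<dots> \<le> C * Lp_norm p g"
        using C p gL mult_left_mono[OF that(2)] by (intro mult_left_mono Lp_norm_mono) (auto simp: abs_mult)
      finally show ?thesis .
    qed
    let ?c = "\<lambda>x. sin (real n * x) * conj_sum (\<lambda>t. g t * cos (real n * t)) (n + d) x"
    let ?s = "\<lambda>x. cos (real n * x) * conj_sum (\<lambda>t. g t * sin (real n * t)) (n + d) x"
    have cL: "in_Lp p ?c" "in_Lp p ?s" "in_Lp p (\<lambda>x. (1/2) * harmonic g n x)"
      using p in_Lp_trig_poly[OF trig_poly_mult[OF trig_poly_sin[OF order_refl] conj_sum_trig_poly]]
        in_Lp_trig_poly[OF trig_poly_mult[OF trig_poly_cos[OF order_refl] conj_sum_trig_poly]]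
        in_Lp_cmult[OF in_Lp_trig_poly[OF harmonic_trig_poly[OF order_refl]], of p "1/2"]
      by auto
    have "Lp_norm p (fourier_sum g n) = Lp_norm p (\<lambda>x. (?c x - ?s x) + (1/2) * harmonic g n x)"
      unfolding fourier_sum_modulation[OF g] by simp
    also have "\<dots> \<le> Lp_norm p (\<lambda>x. ?c x - ?s x) + Lp_norm p (\<lambda>x. (1/2) * harmonic g n x)"
      using p cL by (intro Lp_norm_add_le in_Lp_diff) auto
    also have "\<dots> \<le> (Lp_norm p ?c + Lp_norm p ?s) + (1/2) * Lp_norm p (harmonic g n)"
      using p cL Lp_norm_cmult[of p "1/2" "harmonic g n"] by (intro add_mono Lp_norm_diff_le) auto
    also have "\<dots> \<le> (C * Lp_norm p g + C * Lp_norm p g) + (1/2) * (4 * Lp_norm p g)"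
      using p gL by (intro add_mono part mult_left_mono harmonic_norm_le trig_poly_sin trig_poly_cos) auto
    finally show ?thesis by (simp add: algebra_simps)
  qed
  then show ?thesis using C by (intro exI[of _ "2 * C + 2"]) auto
qed

lemma fourier_sum_fejer_mean:
  assumes "n \<le> m"
  shows "fourier_sum (fejer_mean f m) n x = fourier_a f 0 / 2 + (\<Sum>k=1..n. (1 - real k / (real m + 1)) * harmonic f k x)"
proof -
  let ?l = "\<lambda>k. 1 - real k / (real m + 1)"
  define a where "a k = (if k = 0 then fourier_a f 0 / 2 else ?l k * fourier_a f k)" for k
  define b where "b k = ?l k * (if k = 0 then 0 else fourier_b f k)" for k
  have ab: "fejer_mean f m x = (\<Sum>k\<le>m. a k * cos (real k * x) + b k * sin (real k * x))" for x
  proof -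
    have "{..m} = insert 0 {1..m}" by auto
    then show ?thesis by (simp add: fejer_mean_eq a_def b_def harmonic_def distrib_left mult.assoc)
  qed
  show ?thesis
    unfolding fourier_sum_def fourier_a_trig_poly[OF ab] fourier_b_trig_poly[OF ab] harmonic_def
    using assms by (auto simp: a_def b_def distrib_left mult.assoc intro!: sum.cong)
qed

text \<open>To pass from polynomials to all f, the polynomial bound is applied to a de la
  Vallee-Poussin mean \<open>v\<close>: it has the same Fourier coefficients as f up to frequency n,
  and at most three times its norm.\<close>

theorem fourier_sum_bound:
  fixes p :: real
  assumes p: "1 < p"
  shows "\<exists>C\<ge>0. \<forall>f n. f \<in> periodic_Lp p \<longrightarrow> Lp_norm p (fourier_sum f n) \<le> C * Lp_norm p f"
proof -
  obtain C where C: "0 \<le> C" and bound: "\<And>d g n. g \<in> trig_poly d \<Longrightarrow> Lp_norm p (fourier_sum g n) \<le> C * Lp_norm p g"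
    using fourier_sum_trig_poly_bound[OF p] by blast
  have "Lp_norm p (fourier_sum f n) \<le> 3 * C * Lp_norm p f" if f: "f \<in> periodic_Lp p" for f n
  proof -
    let ?m = "2 * n + 1"
    define v where "v x = 2 * fejer_mean f ?m x - fejer_mean f n x" for x
    have v: "v \<in> trig_poly ?m" unfolding v_def[abs_def]
      using trig_poly_mono[OF fejer_mean_trig_poly[of f n], of ?m]
      by (intro trig_poly_diff trig_poly_cmult fejer_mean_trig_poly) auto
    have "fourier_sum v n x = fourier_sum f n x" for x
    proof -
      have i: "integrable circ (\<lambda>x. 2 * fejer_mean f ?m x)" "integrable circ (fejer_mean f n)"
        using trig_poly_integrable[OF fejer_mean_trig_poly] by auto
      \<comment> \<open>\<open>?m + 1\<close> is exactly twice n + 1, so the two tapers combine to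
        1.\<close>
      have coef: "2 * (1 - real k / (real ?m + 1)) - (1 - real k / (real n + 1)) = 1" for k
      proof -
        have "real ?m + 1 = 2 * (real n + 1)" by simp
        moreover have "2 * (1 - a / (2 * c)) - (1 - a / c) = 1" for a c :: real
          by (simp add: right_diff_distrib)
        ultimately show ?thesis by metis
      qed
      have "fourier_sum v n x = 2 * fourier_sum (fejer_mean f ?m) n x - fourier_sum (fejer_mean f n) n x"
        by (simp only: v_def[abs_def] fourier_sum_diff[OF i] fourier_sum_cmult)
      also have "\<dots> = fourier_a f 0 / 2 + (\<Sum>k=1..n. (2 * (1 - real k / (real ?m + 1)) - (1 - real k / (real n + 1))) * harmonic f k x)"
      proof -
        have comb: "2 * (a + (\<Sum>k=1..n. l k * u k)) - (a + (\<Sum>k=1..n. l' k * u k)) = a + (\<Sum>k=1..n. (2 * l k - l' k) * u k)"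
          for a :: real and l l' u :: "nat \<Rightarrow> real"
          by (simp add: distrib_left sum_distrib_left left_diff_distrib sum_subtractf mult.assoc)
        have "n \<le> ?m" by simp
        then show ?thesis
          unfolding fourier_sum_fejer_mean[OF order_refl] by (simp only: fourier_sum_fejer_mean comb)
      qed
      also have "\<dots> = fourier_sum f n x" unfolding coef by (simp add: fourier_sum_harmonic)
      finally show ?thesis .
    qed
    then have "Lp_norm p (fourier_sum f n) = Lp_norm p (fourier_sum v n)" by (intro Lp_norm_cong) simp
    also have "\<dots> \<le> C * Lp_norm p v" by (rule bound[OF v])
    also have "Lp_norm p v \<le> Lp_norm p (\<lambda>x. 2 * fejer_mean f ?m x) + Lp_norm p (fejer_mean f n)"
      unfolding v_def[abs_def] using p
      by (intro Lp_norm_diff_le in_Lp_cmult in_Lp_trig_poly[OF fejer_mean_trig_poly]) auto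
    also have "\<dots> \<le> 2 * Lp_norm p f + Lp_norm p f"
      using p fejer_mean_norm_le[OF f, of ?m] fejer_mean_norm_le[OF f, of n]
      by (subst Lp_norm_cmult) auto
    finally show ?thesis using C by (simp add: mult_left_mono mult.assoc mult.left_commute)
  qed
  then show ?thesis using C by (intro exI[of _ "3 * C"]) auto
qed

text \<open>Lebesgue's argument: S_n reproduces the approximant t, so the error for f equals the
  error for f - t, and boundedness of S_n is applied to this small function.\<close>

lemma fourier_sum_error:
  assumes f: "f \<in> periodic_Lp p" and p: "1 < p" and hoelder: "Lp_hoelder p \<alpha> L f" and L: "0 < L"
    and \<alpha>: "0 < \<alpha>" "\<alpha> \<le> 1"
  shows "\<exists>C\<ge>0. \<forall>n. Lp_norm p (\<lambda>x. fourier_sum f n x - f x) \<le> C * (real n + 1) powr (- \<alpha>)"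
proof -
  obtain C where C: "0 \<le> C" and bound: "\<And>f n. f \<in> periodic_Lp p \<Longrightarrow> Lp_norm p (fourier_sum f n) \<le> C * Lp_norm p f"
    using fourier_sum_bound[OF p] by blast
  have "Lp_norm p (\<lambda>x. fourier_sum f n x - f x) \<le> (C + 1) * (8 * pi * L) * (real n + 1) powr (- \<alpha>)" for n
  proof -
    obtain t where t: "t \<in> trig_poly n" "Lp_norm p (\<lambda>x. f x - t x) \<le> 8 * pi * L * (real n + 1) powr (- \<alpha>)"
      using Jackson'[OF f _ hoelder L \<alpha>, of n] p by auto
    have d: "(\<lambda>x. f x - t x) \<in> periodic_Lp p"
      using f trig_poly_periodic_Lp[OF t(1), of p] p by (intro periodic_Lp_diff) auto
    have "fourier_sum f n x - f x = fourier_sum (\<lambda>x. f x - t x) n x - (f x - t x)" for x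
      using fourier_sum_diff[OF periodic_Lp_integrable[OF f] trig_poly_integrable[OF t(1)], of n x]
        fourier_sum_trig_poly_eq[OF t(1) order_refl, of x] p by simp
    then have "Lp_norm p (\<lambda>x. fourier_sum f n x - f x) = Lp_norm p (\<lambda>x. fourier_sum (\<lambda>x. f x - t x) n x - (f x - t x))"
      by (intro Lp_norm_cong)
    also have "\<dots> \<le> Lp_norm p (fourier_sum (\<lambda>x. f x - t x) n) + Lp_norm p (\<lambda>x. f x - t x)"
      using d p by (intro Lp_norm_diff_le in_Lp_trig_poly[OF fourier_sum_trig_poly[OF order_refl]]) (auto simp: periodic_Lp_def)
    also have "\<dots> \<le> (C + 1) * Lp_norm p (\<lambda>x. f x - t x)"
      using bound[OF d, of n] by (simp add: distrib_right)
    also have "\<dots> \<le> (C + 1) * (8 * pi * L * (real n + 1) powr (- \<alpha>))"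
      using C t by (intro mult_left_mono) auto
    finally show ?thesis by (simp add: mult.assoc)
  qed
  then show ?thesis using C L by (intro exI[of _ "(C + 1) * (8 * pi * L)"]) auto
qed

section \<open>Derivatives of partial sums\<close>

lemma trig_poly_has_derivative:
  "g \<in> trig_poly n \<Longrightarrow> \<exists>g'\<in>trig_poly n. \<forall>x. (g has_real_derivative g' x) (at x)"
proof (induction g rule: trig_poly_induct)
  case (cos k)
  then show ?case
    by (intro bexI[of _ "\<lambda>x. (- real k) * sin (real k * x)"] trig_poly_cmult trig_poly_sin)
       (auto intro!: derivative_eq_intros)
next
  case (sin k)
  then show ?case
    by (intro bexI[of _ "\<lambda>x. real k * cos (real k * x)"] trig_poly_cmult trig_poly_cos)
       (auto intro!: derivative_eq_intros)
next
  case (add g h)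
  then obtain g' h' where "g' \<in> trig_poly n" "h' \<in> trig_poly n"
    "\<And>x. (g has_real_derivative g' x) (at x)" "\<And>x. (h has_real_derivative h' x) (at x)" by blast
  then show ?case
    by (intro bexI[of _ "\<lambda>x. g' x + h' x"] trig_poly_add) (auto intro!: derivative_eq_intros)
next
  case (cmult c g)
  then obtain g' where "g' \<in> trig_poly n" "\<And>x. (g has_real_derivative g' x) (at x)" by blast
  then show ?case
    by (intro bexI[of _ "\<lambda>x. c * g' x"] trig_poly_cmult) (auto intro!: derivative_eq_intros)
qed

lemma fourier_sum_translate:
  assumes f: "f \<in> periodic_Lp p" and p: "1 \<le> p"
  shows "fourier_sum (\<lambda>x. f (x + h)) n x = fourier_sum f n (x + h)"
  unfolding fourier_sum_eq_integral'[OF f p] fourier_sum_eq_integral'[OF periodic_Lp_translate[OF f] p]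
  by (simp add: algebra_simps)

text \<open>S_n commutes with translation, so a difference quotient of S_n f is S_n applied to that
  of f, and its norm is at most C |L| for every step h. Only the polynomial S_n f is differentiated,
  never f.\<close>

lemma fourier_sum_derivative_bound:
  assumes f: "f \<in> periodic_Lp p" and p: "1 < p" and hoelder: "Lp_hoelder p 1 L f"
  shows "\<exists>C\<ge>0. \<forall>n s'. s' \<in> trig_poly n \<longrightarrow> (\<forall>x. (fourier_sum f n has_real_derivative s' x) (at x)) \<longrightarrow> Lp_norm p s' \<le> C"
proof -
  obtain C where C: "0 \<le> C" and bound: "\<And>f n. f \<in> periodic_Lp p \<Longrightarrow> Lp_norm p (fourier_sum f n) \<le> C * Lp_norm p f"
    using fourier_sum_bound[OF p] by blast
  have "Lp_norm p s' \<le> C * \<bar>L\<bar>" if s': "s' \<in> trig_poly n" "\<And>x. (fourier_sum f n has_real_derivative s' x) (at x)" for n s'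
  proof -
    obtain s'' where s'': "s'' \<in> trig_poly n" "\<And>x. (s' has_real_derivative s'' x) (at x)"
      using trig_poly_has_derivative[OF s'(1)] by blast
    \<comment> \<open>This bound depends on n, which is harmless: it enters only multiplied by the
      step h, which tends to 0.\<close>
    obtain B where B: "0 \<le> B" "\<And>x. \<bar>s'' x\<bar> \<le> B" using trig_poly_bounded[OF s''(1)] by blast
    define s where "s = fourier_sum f n"
    have le: "Lp_norm p s' \<le> C * \<bar>L\<bar> + B * (1 / (real j + 1))" for j
    proof -
      define h where "h = 1 / (real j + 1)"
      have h: "0 < h" "h \<le> 1" by (auto simp: h_def)
      then have "h \<le> pi" using pi_gt3 by linarith
      note h = h this
      define q where "q x = (1 / h) * (s (x + h) - s x)" for x
      have q: "q \<in> trig_poly n" unfolding q_def[abs_def] s_def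
        by (intro trig_poly_cmult trig_poly_diff trig_poly_translate fourier_sum_trig_poly order_refl)
      have fh: "(\<lambda>x. f (x + h) - f x) \<in> periodic_Lp p"
        using p f by (intro periodic_Lp_diff periodic_Lp_translate) auto
      have "s (x + h) - s x = fourier_sum (\<lambda>x. f (x + h) - f x) n x" for x
        using p fourier_sum_diff[OF periodic_Lp_integrable[OF periodic_Lp_translate[OF f]] periodic_Lp_integrable[OF f], of h n x]
          fourier_sum_translate[OF f, of h n x] by (simp add: s_def)
      then have "Lp_norm p q = (1 / h) * Lp_norm p (fourier_sum (\<lambda>x. f (x + h) - f x) n)"
        unfolding q_def[abs_def] using p h by (simp add: Lp_norm_cmult del: times_divide_eq_left)
      also have "\<dots> \<le> (1 / h) * (C * (\<bar>L\<bar> * h))"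
      proof -
        have "Lp_norm p (\<lambda>x. f (x + h) - f x) \<le> L * \<bar>h\<bar> powr 1"
          using hoelder[unfolded Lp_hoelder_def, rule_format, of h] h by simp
        also have "\<dots> \<le> \<bar>L\<bar> * h" using h by (auto intro: mult_right_mono)
        finally have "C * Lp_norm p (\<lambda>x. f (x + h) - f x) \<le> C * (\<bar>L\<bar> * h)" using C by (intro mult_left_mono)
        then have "Lp_norm p (fourier_sum (\<lambda>x. f (x + h) - f x) n) \<le> C * (\<bar>L\<bar> * h)"
          using bound[OF fh, of n] by linarith
        then show ?thesis using h by (intro mult_left_mono) auto
      qed
      also have "\<dots> = C * \<bar>L\<bar>" using h by simp
      finally have qn: "Lp_norm p q \<le> C * \<bar>L\<bar>" .
      have close: "\<bar>s' x - q x\<bar> \<le> B * h" for x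
      proof -
        obtain y where y: "x < y" "y < x + h" "s (x + h) - s x = (x + h - x) * s' y"
          using MVT2[of x "x + h" s s'] h s'(2) by (auto simp: s_def)
        obtain z where z: "x < z" "z < y" "s' y - s' x = (y - x) * s'' z"
          using MVT2[of x y s' s''] y s''(2) by auto
        have "\<bar>s' x - q x\<bar> = \<bar>s' y - s' x\<bar>" using y(3) h by (simp add: q_def abs_minus_commute)
        also have "\<dots> = \<bar>s'' z\<bar> * (y - x)" using z y by (simp add: abs_mult)
        also have "\<dots> \<le> B * h" using B y by (intro mult_mono) auto
        finally show ?thesis .
      qed
      have "Lp_norm p s' = Lp_norm p (\<lambda>x. q x + (s' x - q x))" by simp
      also have "\<dots> \<le> Lp_norm p q + Lp_norm p (\<lambda>x. s' x - q x)"
        using p by (intro Lp_norm_add_le in_Lp_diff in_Lp_trig_poly[OF q] in_Lp_trig_poly[OF s'(1)]) auto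
      also have "Lp_norm p (\<lambda>x. s' x - q x) \<le> Lp_norm p (\<lambda>x. B * h)"
        using p close B h by (intro Lp_norm_mono in_Lp_const) auto
      also have "\<dots> = B * h" using p B h by (simp add: Lp_norm_const)
      finally show ?thesis using qn by (simp add: h_def)
    qed
    have "(\<lambda>j. C * \<bar>L\<bar> + B * (1 / (real j + 1))) \<longlonglongrightarrow> C * \<bar>L\<bar> + B * 0"
    proof (intro tendsto_intros)
      show "(\<lambda>n. 1 / (real n + 1)) \<longlonglongrightarrow> 0"
        using LIMSEQ_inverse_real_of_nat by (simp add: inverse_eq_divide add.commute)
    qed
    then show ?thesis using le by (intro LIMSEQ_le_const[where a="Lp_norm p s'"]) auto
  qed
  then show ?thesis using C by (intro exI[of _ "C * \<bar>L\<bar>"]) auto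
qed

text \<open>The sum \<open>\<Sum> k U\<^sub>k\<close> is the conjugate of the derivative of the partial sum.\<close>
lemma sum_k_harmonic_bound:
  assumes f: "f \<in> periodic_Lp p" and p: "1 < p" and hoelder: "Lp_hoelder p 1 L f"
  shows "\<exists>C\<ge>0. \<forall>n. Lp_norm p (\<lambda>x. \<Sum>k=1..n. real k * harmonic f k x) \<le> C"
proof -
  obtain C where C: "0 \<le> C" and bound: "\<And>d g. g \<in> trig_poly d \<Longrightarrow> Lp_norm p (conj_sum g d) \<le> C * Lp_norm p g"
    using conj_sum_bound[OF p] by blast
  obtain C' where C': "0 \<le> C'" and bound': "\<And>n s'. s' \<in> trig_poly n \<Longrightarrow> (\<And>x. (fourier_sum f n has_real_derivative s' x) (at x)) \<Longrightarrow> Lp_norm p s' \<le> C'"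
    using fourier_sum_derivative_bound[OF f p hoelder] by blast
  have "Lp_norm p (\<lambda>x. \<Sum>k=1..n. real k * harmonic f k x) \<le> C * C'" for n
  proof -
    define a where "a k = real k * fourier_b f k" for k
    define b where "b k = - real k * fourier_a f k" for k
    define s' where "s' x = (\<Sum>k\<le>n. a k * cos (real k * x) + b k * sin (real k * x))" for x
    have s': "s' \<in> trig_poly n" by (rule trig_polyI) (rule s'_def)
    have "(fourier_sum f n has_real_derivative (\<Sum>k=1..n. a k * cos (real k * x) + b k * sin (real k * x))) (at x)" for x
      unfolding fourier_sum_def[abs_def] a_def b_def
      by (auto intro!: derivative_eq_intros simp: algebra_simps)
    moreover have "(\<Sum>k=1..n. a k * cos (real k * x) + b k * sin (real k * x)) = s' x" for x
      unfolding s'_def by (rule sum.mono_neutral_left) (auto simp: a_def b_def not_le)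
    ultimately have der: "(fourier_sum f n has_real_derivative s' x) (at x)" for x by simp
    have "conj_sum s' n x = (\<Sum>k=1..n. real k * harmonic f k x)" for x
      unfolding conj_sum_def conj_harmonic_def fourier_a_trig_poly[OF s'_def] fourier_b_trig_poly[OF s'_def] harmonic_def
      by (intro sum.cong) (auto simp: a_def b_def algebra_simps)
    then have "Lp_norm p (\<lambda>x. \<Sum>k=1..n. real k * harmonic f k x) = Lp_norm p (conj_sum s' n)"
      by (intro Lp_norm_cong) simp
    also have "\<dots> \<le> C * Lp_norm p s'" by (rule bound[OF s'])
    also have "\<dots> \<le> C * C'" using C bound'[OF s' der] by (intro mult_left_mono)
    finally show ?thesis .
  qed
  then show ?thesis using C C' by (intro exI[of _ "C * C'"]) auto
qed

section \<open>Borel representatives and the Lipschitz classes\<close>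

lemma AE_circ_negligible: "negligible E \<Longrightarrow> AE x in circ. x \<notin> E"
  using AE_not_in[of E lebesgue]
  by (subst AE_restrict_space_iff) (auto simp: negligible_iff_null_sets elim: eventually_mono)

text \<open>f is corrected to a Borel function on one period, which is then extended by reducing the
  argument with the floor function; the exceptional set is covered by countably many translates of
  one null set.\<close>

lemma periodic_Lp_representative:
  assumes f: "in_Lp p f" and per: "\<And>x. f (x + 2 * pi) = f x"
  obtains g where "g \<in> periodic_Lp p" "negligible {x. f x \<noteq> g x}"
proof -
  define f1 where "f1 x = (if x \<in> {0..2*pi} then f x else 0)" for x
  have "f1 \<in> borel_measurable lebesgue"
    using f unfolding f1_def[abs_def] by (subst borel_measurable_if) (auto simp: in_Lp_def)
  from completion_ex_borel_measurable_real[OF this]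
  obtain g1 where g1: "g1 \<in> borel_measurable lborel" "AE x in lborel. f1 x = g1 x" by blast
  then obtain N where N: "{x. f1 x \<noteq> g1 x} \<subseteq> N" "N \<in> null_sets lborel"
    by (auto simp: eventually_ae_filter)
  have neg: "negligible N" using N(2) by (simp add: negligible_iff_null_sets null_sets_completionI)
  define m where "m x = \<lfloor>x / (2*pi)\<rfloor>" for x :: real
  define g where "g x = g1 (x - 2 * pi * of_int (m x))" for x
  have [measurable]: "g1 \<in> borel_measurable borel" using g1 by simp
  have gm: "g \<in> borel_measurable borel" unfolding g_def[abs_def] m_def[abs_def] by measurable
  have "m (x + 2 * pi) = m x + 1" for x
  proof -
    have "(x + 2 * pi) / (2 * pi) = x / (2 * pi) + 1" by (simp add: field_simps)
    then show ?thesis by (simp add: m_def)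
  qed
  then have gper: "g (x + 2 * pi) = g x" for x by (simp add: g_def algebra_simps)
  have "{x. f x \<noteq> g x} \<subseteq> (\<Union>k::int. (+) (2 * pi * of_int k) ` N)"
  proof
    fix x assume x: "x \<in> {x. f x \<noteq> g x}"
    define y where "y = x - 2 * pi * of_int (m x)"
    have "of_int (m x) \<le> x / (2*pi)" "x / (2*pi) < of_int (m x) + 1"
      unfolding m_def by linarith+
    then have "0 \<le> y" "y < 2 * pi" by (auto simp: y_def field_simps)
    then have "f1 y = f y" by (simp add: f1_def)
    also have "f y = f x" using periodic_real_int[of f y "m x", OF per] by (simp add: y_def)
    finally have "f1 y \<noteq> g1 y" using x by (simp add: g_def y_def)
    then have "y \<in> N" using N(1) by blast
    moreover have "x = 2 * pi * of_int (m x) + y" by (simp add: y_def)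
    ultimately show "x \<in> (\<Union>k::int. (+) (2 * pi * of_int k) ` N)" by blast
  qed
  moreover have "negligible (\<Union>k::int. (+) (2 * pi * of_int k) ` N)"
    using negligible_translation[OF neg] by (intro negligible_countable_Union) auto
  ultimately have E: "negligible {x. f x \<noteq> g x}" by (rule negligible_subset[rotated])
  have "AE x in circ. f x = g x" using AE_circ_negligible[OF E] by simp
  then have "in_Lp p g" by (rule in_Lp_cong_AE[OF _ f borel_measurable_circI[OF gm]])
  then have "g \<in> periodic_Lp p" using gm gper by (simp add: periodic_Lp_def)
  then show ?thesis using E by (rule that)
qed

text \<open>Membership in L^p speaks about [0, 2 pi] only, and a shift leaves this interval. The
  exceptional set is null on the whole line, so every translate of f inherits measurability from
  g.\<close>

lemma
  fixes f g :: "real \<Rightarrow> real"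
  assumes g: "g \<in> borel_measurable borel" and E: "negligible {x. f x \<noteq> g x}"
  shows measurable_circ_translate: "(\<lambda>x. f (x + h)) \<in> borel_measurable circ"
    and AE_circ_translate: "AE x in circ. f (x + h) = g (x + h)"
proof -
  have sub: "{x. f (x + h) \<noteq> g (x + h)} = (+) (- h) ` {x. f x \<noteq> g x}"
    by (force simp: image_iff)
  have Eh: "negligible {x. f (x + h) \<noteq> g (x + h)}"
    unfolding sub by (rule negligible_translation[OF E])
  then show "AE x in circ. f (x + h) = g (x + h)"
    using AE_circ_negligible[OF Eh] by simp
  have "AE x in lebesgue. g (x + h) = f (x + h)"
    using AE_not_in[of _ lebesgue] Eh unfolding negligible_iff_null_sets by (force elim: eventually_mono)
  moreover have "(\<lambda>x. g (x + h)) \<in> borel_measurable lebesgue"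
  proof (rule measurable_completion)
    have "(\<lambda>x. g (x + h)) \<in> borel_measurable borel"
      by (rule measurable_compose[OF _ g]) simp
    then show "(\<lambda>x. g (x + h)) \<in> borel_measurable lborel" by simp
  qed
  ultimately have "(\<lambda>x. f (x + h)) \<in> borel_measurable lebesgue"
    by (rule borel_measurable_AE[rotated])
  then show "(\<lambda>x. f (x + h)) \<in> borel_measurable circ"
    by (rule measurable_restrict_space1)
qed

text \<open>The O condition at 0 controls only shifts shorter than some d; longer ones are bounded
  by 2 ||g||, which the second summand of \<open>L\<close> absorbs.\<close>

lemma Lip_representative:
  assumes f: "f \<in> Lip \<alpha> p" and p: "1 \<le> p" and \<alpha>: "0 < \<alpha>"
  obtains g L where "g \<in> periodic_Lp p" "negligible {x. f x \<noteq> g x}" "0 < L" "Lp_hoelder p \<alpha> L g"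
proof -
  have per: "\<And>x. f (x + 2 * pi) = f x" and fL: "in_Lp p f"
    and big: "Lp_modulus p f \<in> O[at_right 0](\<lambda>\<delta>. \<delta> powr \<alpha>)"
    using f by (auto simp: Lip_def)
  obtain g where g: "g \<in> periodic_Lp p" and E: "negligible {x. f x \<noteq> g x}"
    using periodic_Lp_representative[OF fL per] by blast
  have gb: "g \<in> borel_measurable borel" using g by (simp add: periodic_Lp_def)
  have eq: "Lp_norm p (\<lambda>x. f (x + h) - f x) = Lp_norm p (\<lambda>x. g (x + h) - g x)" for h
  proof (rule Lp_norm_cong_AE)
    show "AE x in circ. f (x + h) - f x = g (x + h) - g x"
      using AE_circ_translate[OF gb E, of h] AE_circ_translate[OF gb E, of 0]
      by eventually_elim simp
    show "(\<lambda>x. f (x + h) - f x) \<in> borel_measurable circ"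
      using measurable_circ_translate[OF gb E, of h] measurable_circ_translate[OF gb E, of 0] by simp
    show "(\<lambda>x. g (x + h) - g x) \<in> borel_measurable circ"
      using periodic_LpD(3)[OF periodic_Lp_translate[OF g, of h]] periodic_LpD(3)[OF g] p
      by (intro in_Lp_measurable[of p] in_Lp_diff) auto
  qed
  have le2: "Lp_norm p (\<lambda>x. g (x + h) - g x) \<le> 2 * Lp_norm p g" for h
  proof -
    have "Lp_norm p (\<lambda>x. g (x + h) - g x) \<le> Lp_norm p (\<lambda>x. g (x + h)) + Lp_norm p g"
      using periodic_LpD(3)[OF periodic_Lp_translate[OF g, of h]] periodic_LpD(3)[OF g] p
      by (intro Lp_norm_diff_le) auto
    then show ?thesis using Lp_norm_translate[OF g, of h] by simp
  qed
  from big obtain c where c: "c > 0" "eventually (\<lambda>\<delta>. norm (Lp_modulus p f \<delta>) \<le> c * norm (\<delta> powr \<alpha>)) (at_right 0)"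
    by (auto elim: landau_o.bigE)
  then obtain d where d: "d > 0" "\<And>\<delta>. 0 < \<delta> \<Longrightarrow> \<delta> < d \<Longrightarrow> \<bar>Lp_modulus p f \<delta>\<bar> \<le> c * \<delta> powr \<alpha>"
    by (auto simp: eventually_at_right[of 0 "1::real", simplified])
  define L where "L = c + 2 * Lp_norm p g / d powr \<alpha>"
  have L: "0 < L" using c d Lp_norm_nonneg[of p g] by (auto simp: L_def intro!: add_pos_nonneg)
  have "Lp_norm p (\<lambda>x. g (x + h) - g x) \<le> L * \<bar>h\<bar> powr \<alpha>" for h
  proof (cases "h = 0")
    case True
    then show ?thesis using p by (simp add: Lp_norm_const)
  next
    case False
    show ?thesis
    proof (cases "\<bar>h\<bar> < d")
      case True
      have "Lp_norm p (\<lambda>x. f (x + h) - f x) \<le> Lp_modulus p f \<bar>h\<bar>"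
        unfolding Lp_modulus_def
      proof (rule cSUP_upper)
        show "h \<in> {h'. 0 < \<bar>h'\<bar> \<and> \<bar>h'\<bar> \<le> \<bar>h\<bar>}" using False by simp
        \<comment> \<open>A real supremum dominates its members only over a set that is bounded
          above; 2 ||g|| is such a bound.\<close>
        show "bdd_above ((\<lambda>h. Lp_norm p (\<lambda>x. f (x + h) - f x)) ` {h'. 0 < \<bar>h'\<bar> \<and> \<bar>h'\<bar> \<le> \<bar>h\<bar>})"
          unfolding eq using le2 by (intro bdd_aboveI2)
      qed
      also have "\<dots> \<le> c * \<bar>h\<bar> powr \<alpha>" using d(2)[of "\<bar>h\<bar>"] True False by simp
      also have "\<dots> \<le> L * \<bar>h\<bar> powr \<alpha>"
        using Lp_norm_nonneg[of p g] by (intro mult_right_mono) (auto simp: L_def)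
      finally show ?thesis by (simp add: eq)
    next
      case False
      have "2 * Lp_norm p g * 1 \<le> 2 * Lp_norm p g * (\<bar>h\<bar> powr \<alpha> / d powr \<alpha>)"
      proof (intro mult_left_mono)
        have "d powr \<alpha> \<le> \<bar>h\<bar> powr \<alpha>" using False d \<alpha> by (intro powr_mono2) auto
        then show "1 \<le> \<bar>h\<bar> powr \<alpha> / d powr \<alpha>" using d by simp
      qed (simp add: Lp_norm_nonneg)
      also have "\<dots> \<le> L * \<bar>h\<bar> powr \<alpha>"
        using c by (simp add: L_def distrib_right)
      finally show ?thesis using le2[of h] by simp
    qed
  qed
  then have "Lp_hoelder p \<alpha> L g" by (simp add: Lp_hoelder_def)
  with g E L show ?thesis by (rule that)
qed

lemma fourier_sum_cong_AE:
  assumes "AE x in circ. f x = g x" "f \<in> borel_measurable circ" "g \<in> borel_measurable circ"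
  shows "fourier_sum f n x = fourier_sum g n x"
proof -
  have "(\<lambda>x. cos (real k * x)) \<in> borel_measurable circ" "(\<lambda>x. sin (real k * x)) \<in> borel_measurable circ" for k
    by auto
  note m = this
  have "(LINT x|circ. f x * c x) = (LINT x|circ. g x * c x)" if [measurable]: "c \<in> borel_measurable circ" for c
    using assms by (intro integral_cong_AE) (auto elim: eventually_mono)
  then have "(LINT x|circ. f x * cos (real k * x)) = (LINT x|circ. g x * cos (real k * x))"
    "(LINT x|circ. f x * sin (real k * x)) = (LINT x|circ. g x * sin (real k * x))" for k
    using m by auto
  then show ?thesis
    unfolding fourier_sum_def fourier_a_def fourier_b_def by (simp only:)
qed

section \<open>Row averages\<close>

text \<open>Comparison with the integral of x^(-\<alpha>) in discrete form: the induction step is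
  the concavity of x^(1 - \<alpha>) between n + 1 and n + 2, obtained from Young's
  inequality.\<close>

lemma sum_powr_neg_le:
  assumes "0 < \<alpha>" "\<alpha> < 1"
  shows "(\<Sum>j\<le>n. (real j + 1) powr (- \<alpha>)) \<le> (real n + 1) powr (1 - \<alpha>) / (1 - \<alpha>)"
proof (induction n)
  case 0
  then show ?case using assms by simp
next
  case (Suc n)
  define x where "x = real n + 1"
  define y where "y = real n + 2"
  have xy: "0 < x" "0 < y" "y = x + 1" by (auto simp: x_def y_def)
  have "x powr (1 - \<alpha>) * y powr \<alpha> \<le> (1 - \<alpha>) * x + \<alpha> * y"
    using assms xy by (intro Youngs_inequality_0) auto
  then have "x powr (1 - \<alpha>) * y powr \<alpha> * y powr (- \<alpha>) \<le> (y - (1 - \<alpha>)) * y powr (- \<alpha>)"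
    using xy by (intro mult_right_mono) (auto simp: algebra_simps)
  then have "x powr (1 - \<alpha>) \<le> y powr (1 - \<alpha>) - (1 - \<alpha>) * y powr (- \<alpha>)"
  proof -
    have "y powr \<alpha> * y powr (- \<alpha>) = 1" using xy by (simp add: powr_minus)
    moreover have "y * y powr (- \<alpha>) = y powr (1 - \<alpha>)" using xy by (simp add: powr_diff powr_minus field_simps)
    ultimately show ?thesis
      using \<open>_ \<le> (y - (1 - \<alpha>)) * y powr (- \<alpha>)\<close> by (simp only: mult.assoc mult_1_right left_diff_distrib[of y])
  qed
  then have "x powr (1 - \<alpha>) / (1 - \<alpha>) + y powr (- \<alpha>) \<le> y powr (1 - \<alpha>) / (1 - \<alpha>)"
  proof -
    have "x powr (1 - \<alpha>) / (1 - \<alpha>) \<le> (y powr (1 - \<alpha>) - (1 - \<alpha>) * y powr (- \<alpha>)) / (1 - \<alpha>)"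
      using assms \<open>x powr (1 - \<alpha>) \<le> _\<close> by (intro divide_right_mono) auto
    then show ?thesis using assms by (simp add: diff_divide_distrib)
  qed
  moreover have "real (Suc n) + 1 = y" by (simp add: y_def)
  ultimately show ?case using Suc by (simp add: x_def)
qed

text \<open>Abel summation shows that decreasing weights see a row only through its partial sums.
  These are replaced by those of a constant row \<open>M\<close>, and the summation is
  undone.\<close>

lemma sum_decreasing_le_row_avg:
  fixes c :: "nat \<Rightarrow> real"
  assumes M: "\<And>j. j \<le> n \<Longrightarrow> row_avg a n j \<le> M" and c: "\<And>j. c (j + 1) \<le> c j" "\<And>j. 0 \<le> c j"
  shows "(\<Sum>k\<le>n. c k * a n k) \<le> M * (\<Sum>k\<le>n. c k)"
proof -
  have A: "(\<Sum>i\<le>j. a n i) \<le> M * (real j + 1)" if "j \<le> n" for j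
    using M[OF that] by (simp add: row_avg_def atMost_atLeast0 field_simps)
  have "(\<Sum>k\<le>n. c k * a n k) = (\<Sum>j<n. (c j - c (j + 1)) * (\<Sum>i\<le>j. a n i)) + c n * (\<Sum>i\<le>n. a n i)"
    by (rule abel_summation)
  also have "\<dots> \<le> (\<Sum>j<n. (c j - c (j + 1)) * (M * (real j + 1))) + c n * (M * (real n + 1))"
    using A c by (intro add_mono sum_mono mult_left_mono) auto
  also have "\<dots> = M * ((\<Sum>j<n. (c j - c (j + 1)) * (\<Sum>i\<le>j. 1)) + c n * (\<Sum>i\<le>n. 1))"
    by (simp add: sum_distrib_left algebra_simps)
  also have "(\<Sum>j<n. (c j - c (j + 1)) * (\<Sum>i\<le>j. 1)) + c n * (\<Sum>i\<le>n. 1) = (\<Sum>k\<le>n. c k * 1)"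
    by (rule abel_summation[symmetric])
  finally show ?thesis by simp
qed

text \<open>Common core of the two classes of monotone averages, each of which yields averages O(1 /
  (n + 1)). The triangle inequality keeps the order, since \<alpha> < 1 makes the sum of (k +
  1)^(-\<alpha>) of order (n + 1)^(1 - \<alpha>).\<close>

lemma matrix_mean_norm_le_row_avg:
  assumes f: "f \<in> periodic_Lp p" and p: "1 < p" and hoelder: "Lp_hoelder p \<alpha> L f" and L: "0 < L"
    and \<alpha>: "0 < \<alpha>" "\<alpha> < 1"
    and nonneg: "\<And>n k. k \<le> n \<Longrightarrow> 0 \<le> a n k" and row: "\<And>n. (\<Sum>k = 0..n. a n k) = 1"
    and M: "\<And>n j. 1 \<le> n \<Longrightarrow> j \<le> n \<Longrightarrow> row_avg a n j \<le> M / (real n + 1)" and M0: "0 \<le> M"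
  shows "\<exists>C. \<forall>n\<ge>1. Lp_norm p (\<lambda>x. matrix_mean a f n x - f x) \<le> C * (real n + 1) powr (- \<alpha>)"
proof -
  obtain C where C: "0 \<le> C" "\<And>n. Lp_norm p (\<lambda>x. fourier_sum f n x - f x) \<le> C * (real n + 1) powr (- \<alpha>)"
    using fourier_sum_error[OF f p hoelder L] \<alpha> by auto
  have fL: "in_Lp p f" using f by (simp add: periodic_Lp_def)
  have "Lp_norm p (\<lambda>x. matrix_mean a f n x - f x) \<le> C * M / (1 - \<alpha>) * (real n + 1) powr (- \<alpha>)" if n: "1 \<le> n" for n
  proof -
    have "Lp_norm p (\<lambda>x. matrix_mean a f n x - f x) \<le> (\<Sum>k\<le>n. Lp_norm p (\<lambda>x. a n k * (fourier_sum f k x - f x)))"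
      unfolding matrix_mean_diff[of a n f, OF row] using p fL
      by (intro Lp_norm_sum_le in_Lp_cmult in_Lp_fourier_sum_diff) auto
    also have "\<dots> \<le> (\<Sum>k\<le>n. C * ((real k + 1) powr (- \<alpha>) * a n k))"
    proof (rule sum_mono)
      fix k assume "k \<in> {..n}"
      then have "Lp_norm p (\<lambda>x. a n k * (fourier_sum f k x - f x)) = a n k * Lp_norm p (\<lambda>x. fourier_sum f k x - f x)"
        using p nonneg by (subst Lp_norm_cmult) auto
      also have "\<dots> \<le> a n k * (C * (real k + 1) powr (- \<alpha>))"
        using C \<open>k \<in> {..n}\<close> nonneg by (intro mult_left_mono) auto
      finally show "Lp_norm p (\<lambda>x. a n k * (fourier_sum f k x - f x)) \<le> C * ((real k + 1) powr (- \<alpha>) * a n k)"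
        by (simp add: mult_ac)
    qed
    also have "\<dots> = C * (\<Sum>k\<le>n. (real k + 1) powr (- \<alpha>) * a n k)" by (simp add: sum_distrib_left)
    also have "\<dots> \<le> C * (M / (real n + 1) * (\<Sum>k\<le>n. (real k + 1) powr (- \<alpha>)))"
      using C M[OF n] \<alpha> by (intro mult_left_mono sum_decreasing_le_row_avg) (auto intro!: powr_mono2')
    also have "\<dots> \<le> C * (M / (real n + 1) * ((real n + 1) powr (1 - \<alpha>) / (1 - \<alpha>)))"
      using C M0 sum_powr_neg_le[OF \<alpha>] by (intro mult_left_mono) auto
    also have "(real n + 1) powr (1 - \<alpha>) = (real n + 1) * (real n + 1) powr (- \<alpha>)"
      by (simp add: powr_diff powr_minus field_simps)
    finally show ?thesis by simp
  qed
  then show ?thesis by blast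
qed

text \<open>Two Abel summations. The first turns differences of consecutive partial sums into
  harmonics weighted by k times a row average; the second puts the variation on the averages and
  leaves the bounded sums of k U_k.\<close>

lemma matrix_mean_norm_le_row_avg_variation:
  assumes f: "f \<in> periodic_Lp p" and p: "1 < p" and hoelder: "Lp_hoelder p 1 L f" and L: "0 < L"
    and nonneg: "\<And>n k. k \<le> n \<Longrightarrow> 0 \<le> a n k" and row: "\<And>n. (\<Sum>k = 0..n. a n k) = 1"
    and M: "\<And>n. 1 \<le> n \<Longrightarrow> (\<Sum>k<n. \<bar>row_avg a n k - row_avg a n (k + 1)\<bar>) \<le> M / real n"
  shows "\<exists>C. \<forall>n\<ge>1. Lp_norm p (\<lambda>x. matrix_mean a f n x - f x) \<le> C / real n"
proof -
  obtain C where C: "0 \<le> C" "\<And>n. Lp_norm p (\<lambda>x. fourier_sum f n x - f x) \<le> C * (real n + 1) powr (- 1)"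
    using fourier_sum_error[OF f p hoelder L] by auto
  obtain D where D: "0 \<le> D" "\<And>n. Lp_norm p (\<lambda>x. \<Sum>k=1..n. real k * harmonic f k x) \<le> D"
    using sum_k_harmonic_bound[OF f p hoelder] by blast
  have fL: "in_Lp p f" using f by (simp add: periodic_Lp_def)
  have "Lp_norm p (\<lambda>x. matrix_mean a f n x - f x) \<le> (C + D * M + D) / real n" if n: "1 \<le> n" for n
  proof -
    \<comment> \<open>The first summation produces the harmonics 1, ..., n, indexed below by j + 1
      with j \<le> m = n - 1.\<close>
    obtain m where m: "n = Suc m" using n by (cases n) auto
    let ?A = "row_avg a n"
    let ?s = "\<lambda>k x. real (k + 1) * harmonic f (k + 1) x"
    have sL: "in_Lp p (?s k)" for k
      using p by (intro in_Lp_cmult in_Lp_trig_poly[OF harmonic_trig_poly[OF order_refl]]) auto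
    have part: "(\<Sum>i\<le>j. a n i) = (real j + 1) * ?A j" for j
      by (simp add: row_avg_def atMost_atLeast0)
    have "matrix_mean a f n x - f x = (\<Sum>k\<le>n. (fourier_sum f k x - f x) * a n k)" for x
      unfolding matrix_mean_diff[of a n f, OF row] by (simp add: mult.commute)
    also have "\<dots> x = (\<Sum>j<n. (fourier_sum f j x - f x - (fourier_sum f (j + 1) x - f x)) * (\<Sum>i\<le>j. a n i)) + (fourier_sum f n x - f x) * (\<Sum>i\<le>n. a n i)" for x
      by (rule abel_summation)
    also have "\<dots> x = (fourier_sum f n x - f x) - (\<Sum>j\<le>m. ?A j * ?s j x)" for x
    proof -
      have "(\<Sum>j<n. (fourier_sum f j x - f x - (fourier_sum f (j + 1) x - f x)) * (\<Sum>i\<le>j. a n i)) = (\<Sum>j<n. - (?A j * ?s j x))"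
        unfolding part by (intro sum.cong) (auto simp: fourier_sum_Suc algebra_simps)
      moreover have "(\<Sum>i\<le>n. a n i) = 1" using row[of n] by (simp add: atMost_atLeast0)
      moreover have "{..<n} = {..m}" using m by auto
      ultimately show ?thesis by (simp add: sum_negf)
    qed
    finally have "Lp_norm p (\<lambda>x. matrix_mean a f n x - f x) = Lp_norm p (\<lambda>x. (fourier_sum f n x - f x) - (\<Sum>j\<le>m. ?A j * ?s j x))"
      by (intro Lp_norm_cong)
    also have "\<dots> \<le> Lp_norm p (\<lambda>x. fourier_sum f n x - f x) + Lp_norm p (\<lambda>x. \<Sum>j\<le>m. ?A j * ?s j x)"
      using p fL
      by (intro Lp_norm_diff_le in_Lp_fourier_sum_diff in_Lp_sum in_Lp_cmult in_Lp_trig_poly[OF harmonic_trig_poly[OF order_refl]]) auto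
    also have "\<dots> \<le> C / real n + (D * M / real n + D / real n)"
    proof (rule add_mono)
      have "(real n + 1) powr (- 1) \<le> 1 / real n" using n by (simp add: powr_minus_divide field_simps)
      then have "C * (real n + 1) powr (- 1) \<le> C * (1 / real n)" using C by (intro mult_left_mono)
      then show "Lp_norm p (\<lambda>x. fourier_sum f n x - f x) \<le> C / real n" using C(2)[of n] by simp
      have W: "Lp_norm p (\<lambda>x. \<Sum>i\<le>j. ?s i x) \<le> D" for j
      proof -
        have "(\<Sum>i\<le>j. ?s i x) = (\<Sum>k=1..Suc j. real k * harmonic f k x)" for x
          using sum.shift_bounds_cl_Suc_ivl[of "\<lambda>k. real k * harmonic f k x" 0 j] by (simp add: atMost_atLeast0)
        then show ?thesis using D(2)[of "Suc j"] by simp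
      qed
      have "Lp_norm p (\<lambda>x. \<Sum>j\<le>m. ?A j * ?s j x) \<le> (\<Sum>j<m. \<bar>?A j - ?A (j + 1)\<bar> * Lp_norm p (\<lambda>x. \<Sum>i\<le>j. ?s i x)) + \<bar>?A m\<bar> * Lp_norm p (\<lambda>x. \<Sum>i\<le>m. ?s i x)"
        using sL p by (intro Lp_norm_abel_le) auto
      also have "\<dots> \<le> (\<Sum>j<m. \<bar>?A j - ?A (j + 1)\<bar> * D) + \<bar>?A m\<bar> * D"
        using W by (intro add_mono sum_mono mult_left_mono) auto
      also have "(\<Sum>j<m. \<bar>?A j - ?A (j + 1)\<bar> * D) = (\<Sum>j<m. \<bar>?A j - ?A (j + 1)\<bar>) * D"
        by (simp add: sum_distrib_right)
      also have "\<dots> \<le> (M / real n) * D"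
      proof (rule mult_right_mono)
        have "(\<Sum>j<m. \<bar>?A j - ?A (j + 1)\<bar>) \<le> (\<Sum>j<n. \<bar>?A j - ?A (j + 1)\<bar>)"
          by (intro sum_mono2) (auto simp: m)
        then show "(\<Sum>j<m. \<bar>?A j - ?A (j + 1)\<bar>) \<le> M / real n" using M[OF n] by linarith
      qed (rule D)
      \<comment> \<open>The denominator of the average at m = n - 1 is exactly n, and a partial row
        sum is at most 1.\<close>
      also have "\<bar>?A m\<bar> * D \<le> (1 / real n) * D"
      proof (rule mult_right_mono)
        have "(\<Sum>k=0..m. a n k) \<le> (\<Sum>k=0..n. a n k)" "0 \<le> (\<Sum>k=0..m. a n k)"
          using nonneg m by (auto intro!: sum_mono2 sum_nonneg)
        then show "\<bar>?A m\<bar> \<le> 1 / real n"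
          unfolding row m row_avg_def by (simp add: abs_mult divide_right_mono add.commute)
      qed (rule D)
      finally show "Lp_norm p (\<lambda>x. \<Sum>j\<le>m. ?A j * ?s j x) \<le> D * M / real n + D / real n"
        by (simp add: mult.commute)
    qed
    also have "\<dots> = (C + D * M + D) / real n" by (simp add: add_divide_distrib)
    finally show ?thesis .
  qed
  then show ?thesis by blast
qed

section \<open>Rates for the matrix means under the six conditions\<close>

lemma bigo_ge1_iff: "bigo_ge1 u v \<longleftrightarrow> (\<exists>C. \<forall>n\<ge>1. \<bar>u n\<bar> \<le> C * \<bar>v n\<bar>)"
proof
  assume "bigo_ge1 u v"
  then obtain c where "\<forall>\<^sub>F n in principal {1..}. norm (u n) \<le> c * norm (v n)"
    by (auto elim: landau_o.bigE)
  then show "\<exists>C. \<forall>n\<ge>1. \<bar>u n\<bar> \<le> C * \<bar>v n\<bar>" by (auto simp: eventually_principal)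
next
  assume "\<exists>C. \<forall>n\<ge>1. \<bar>u n\<bar> \<le> C * \<bar>v n\<bar>"
  then obtain C where "\<forall>n\<ge>1. \<bar>u n\<bar> \<le> C * \<bar>v n\<bar>" by blast
  moreover have "C * \<bar>v n\<bar> \<le> (\<bar>C\<bar> + 1) * \<bar>v n\<bar>" for n
    by (intro mult_right_mono) auto
  ultimately have "\<forall>n\<ge>1. \<bar>u n\<bar> \<le> (\<bar>C\<bar> + 1) * \<bar>v n\<bar>" by (meson order_trans)
  then show "bigo_ge1 u v"
    by (intro landau_o.bigI[where c="\<bar>C\<bar> + 1"]) (auto simp: eventually_principal)
qed

text \<open>The exponents \<beta> + 1 - \<alpha> and -\<beta> - 1 add up to -\<alpha>. Each
  condition with p = 1 is brought to this bound on the reduced row.\<close>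

lemma matrix_mean_rate_variation:
  assumes f: "f \<in> periodic_Lp p" and p: "1 \<le> p" and hoelder: "Lp_hoelder p \<alpha> L f" and L: "0 < L"
    and \<alpha>: "0 < \<alpha>" "\<alpha> \<le> 1" and \<beta>: "0 \<le> \<beta>" and \<gamma>: "0 < \<beta> + 1 - \<alpha>"
    and row: "\<And>n. (\<Sum>k = 0..n. a n k) = 1" and a: "\<And>n k. a n k = (real k + 1) powr \<beta> * b n k"
    and M: "\<And>n. 1 \<le> n \<Longrightarrow> (\<Sum>k<n. \<bar>b n k - b n (k + 1)\<bar>) + \<bar>b n n\<bar> \<le> M * (real n + 1) powr (- \<beta> - 1)"
  shows "\<exists>C. \<forall>n\<ge>1. Lp_norm p (\<lambda>x. matrix_mean a f n x - f x) \<le> C * (real n + 1) powr (- \<alpha>)"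
proof -
  obtain C where C: "0 \<le> C" "\<And>n. Lp_norm p (\<lambda>x. matrix_mean a f n x - f x)
    \<le> C * (real n + 1) powr (\<beta> + 1 - \<alpha>) * ((\<Sum>k<n. \<bar>b n k - b n (k + 1)\<bar>) + \<bar>b n n\<bar>)"
    using matrix_mean_norm_le_variation[OF f p hoelder L \<alpha> \<beta> \<gamma> row a] by blast
  have "Lp_norm p (\<lambda>x. matrix_mean a f n x - f x) \<le> C * M * (real n + 1) powr (- \<alpha>)" if n: "1 \<le> n" for n
  proof -
    have "Lp_norm p (\<lambda>x. matrix_mean a f n x - f x) \<le> C * (real n + 1) powr (\<beta> + 1 - \<alpha>) * (M * (real n + 1) powr (- \<beta> - 1))"
      using C(2)[of n] mult_left_mono[OF M[OF n], of "C * (real n + 1) powr (\<beta> + 1 - \<alpha>)"] C(1) by simp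
    also have "\<dots> = C * M * ((real n + 1) powr (\<beta> + 1 - \<alpha>) * (real n + 1) powr (- \<beta> - 1))" by simp
    also have "(real n + 1) powr (\<beta> + 1 - \<alpha>) * (real n + 1) powr (- \<beta> - 1) = (real n + 1) powr (- \<alpha>)"
      by (simp add: powr_add[symmetric])
    finally show ?thesis .
  qed
  then show ?thesis by blast
qed

text \<open>The exponent \<open>- 0 - 1\<close> is the instance \<beta> = 0 of the bound in
  \<open>matrix_mean_rate_variation\<close>. Passing from 1 / n to 1 / (n + 1) costs the factor
  2.\<close>

lemma variation_condition:
  fixes a :: "nat \<Rightarrow> nat \<Rightarrow> real"
  assumes V: "bigo_ge1 (\<lambda>n. \<Sum>k<n. \<bar>a n k - a n (k + 1)\<bar>) (\<lambda>n. 1 / real n)"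
    and E: "bigo_ge1 (\<lambda>n. (real n + 1) * a n n) (\<lambda>n. 1)"
  shows "\<exists>M. \<forall>n\<ge>1. (\<Sum>k<n. \<bar>a n k - a n (k + 1)\<bar>) + \<bar>a n n\<bar> \<le> M * (real n + 1) powr (- 0 - 1)"
proof -
  obtain C where C: "\<And>n. 1 \<le> n \<Longrightarrow> (\<Sum>k<n. \<bar>a n k - a n (k + 1)\<bar>) \<le> C / real n"
    using V unfolding bigo_ge1_iff by (auto simp: sum_nonneg)
  obtain D where D: "\<And>n. 1 \<le> n \<Longrightarrow> (real n + 1) * \<bar>a n n\<bar> \<le> D"
    using E unfolding bigo_ge1_iff by (auto simp: abs_mult)
  have "(\<Sum>k<n. \<bar>a n k - a n (k + 1)\<bar>) + \<bar>a n n\<bar> \<le> (2 * \<bar>C\<bar> + D) * (real n + 1) powr (- 0 - 1)" if n: "1 \<le> n" for n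
  proof -
    have "C / real n \<le> \<bar>C\<bar> / real n" by (simp add: divide_right_mono)
    also have "\<dots> \<le> 2 * \<bar>C\<bar> / (real n + 1)"
    proof -
      have "\<bar>C\<bar> * (real n + 1) \<le> \<bar>C\<bar> * (2 * real n)" using n by (intro mult_left_mono) auto
      then show ?thesis using n by (simp add: field_simps)
    qed
    finally have "C / real n \<le> 2 * \<bar>C\<bar> / (real n + 1)" .
    moreover have "\<bar>a n n\<bar> \<le> D / (real n + 1)" using D[OF n] by (simp add: field_simps)
    ultimately show ?thesis using C[OF n] by (simp add: powr_minus_divide add_divide_distrib)
  qed
  then show ?thesis by blast
qed

theorem theorem5:
  fixes f :: "real \<Rightarrow> real" and a :: "nat \<Rightarrow> nat \<Rightarrow> real" and \<alpha> p :: real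
  assumes f: "f \<in> Lip \<alpha> p"
    and nonneg: "\<And>n k. k \<le> n \<Longrightarrow> 0 \<le> a n k"
    and triangular: "\<And>n k. n < k \<Longrightarrow> a n k = 0"
    and row_sum: "\<And>n. (\<Sum>k = 0..n. a n k) = 1"
    and cond:
      "(p > 1 \<and> 0 < \<alpha> \<and> \<alpha> < 1 \<and> a \<in> AMIMS)
     \<or> (p > 1 \<and> 0 < \<alpha> \<and> \<alpha> < 1 \<and> a \<in> AMDMS
          \<and> bigo_ge1 (\<lambda>n. (real n + 1) * a n 0) (\<lambda>n. 1))
     \<or> (p > 1 \<and> \<alpha> = 1
          \<and> bigo_ge1 (\<lambda>n. \<Sum>k<n. \<bar>row_avg a n k - row_avg a n (k + 1)\<bar>) (\<lambda>n. 1 / real n))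
     \<or> (p = 1 \<and> 0 < \<alpha> \<and> \<alpha> < 1
          \<and> bigo_ge1 (\<lambda>n. \<Sum>k<n. \<bar>a n k - a n (k + 1)\<bar>) (\<lambda>n. 1 / real n)
          \<and> bigo_ge1 (\<lambda>n. (real n + 1) * a n n) (\<lambda>n. 1))
     \<or> (p = 1 \<and> 0 < \<alpha> \<and> \<alpha> < 1 \<and> a \<in> RBVS
          \<and> bigo_ge1 (\<lambda>n. (real n + 1) * a n 0) (\<lambda>n. 1))
     \<or> (p = 1 \<and> \<alpha> = 1
          \<and> (\<exists>\<beta>>0. (\<lambda>n k. (real k + 1) powr (- \<beta>) * a n k) \<in> HBVS)
          \<and> bigo_ge1 (\<lambda>n. (real n + 1) * a n n) (\<lambda>n. 1))"
  shows "bigo_ge1 (\<lambda>n. Lp_norm p (\<lambda>x. matrix_mean a f n x - f x)) (\<lambda>n. real n powr (- \<alpha>))"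
proof -
  have p: "1 \<le> p" and \<alpha>: "0 < \<alpha>" "\<alpha> \<le> 1" using cond by auto
  obtain g L where g: "g \<in> periodic_Lp p" and E: "negligible {x. f x \<noteq> g x}"
    and L: "0 < L" and hoelder: "Lp_hoelder p \<alpha> L g"
    using Lip_representative[OF f p \<alpha>(1)] by blast
  have gb: "g \<in> borel_measurable borel" using g by (simp add: periodic_Lp_def)
  have ae: "AE x in circ. f x = g x" and fm: "f \<in> borel_measurable circ"
    using AE_circ_translate[OF gb E, of 0] measurable_circ_translate[OF gb E, of 0] by auto
  \<comment> \<open>Neither Fourier coefficients nor norms see the null set where f and g
    differ.\<close>
  have transfer: "Lp_norm p (\<lambda>x. matrix_mean a f n x - f x) = Lp_norm p (\<lambda>x. matrix_mean a g n x - g x)" for n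
  proof -
    have mm: "matrix_mean a f n = matrix_mean a g n"
      using fourier_sum_cong_AE[OF ae fm borel_measurable_circI[OF gb]]
      by (simp add: matrix_mean_def fun_eq_iff)
    have "matrix_mean a g n \<in> trig_poly n"
      unfolding matrix_mean_def[abs_def] by (intro trig_poly_sum trig_poly_cmult fourier_sum_trig_poly) auto
    then have [measurable]: "matrix_mean a g n \<in> borel_measurable circ"
      using trig_poly_measurable borel_measurable_circI by blast
    show ?thesis unfolding mm
      using ae fm borel_measurable_circI[OF gb] by (intro Lp_norm_cong_AE) (auto elim: eventually_mono)
  qed
  have row_avg_n: "row_avg a n n = 1 / (real n + 1)" for n
    using row_sum[of n] by (simp add: row_avg_def)
  have row_avg_0: "row_avg a n 0 = a n 0" for n by (simp add: row_avg_def)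
  \<comment> \<open>The case p > 1, \<alpha> = 1 is set apart because its estimate comes in the form
    C / n.\<close>
  have main: "\<exists>C. \<forall>n\<ge>1. Lp_norm p (\<lambda>x. matrix_mean a g n x - g x) \<le> C * (real n + 1) powr (- \<alpha>)"
    if "\<not> (p > 1 \<and> \<alpha> = 1)"
    using cond
  proof (elim disjE conjE exE)
    assume H: "1 < p" "0 < \<alpha>" "\<alpha> < 1" "a \<in> AMIMS"
    obtain K where K: "\<And>n m l. m \<le> l \<Longrightarrow> l \<le> n \<Longrightarrow> row_avg a n m \<le> K * row_avg a n l"
      using H(4) unfolding AMIMS_def by blast
    have "row_avg a n j \<le> \<bar>K\<bar> / (real n + 1)" if "j \<le> n" for n j
    proof -
      \<comment> \<open>Comparison with the full average, which is 1 / (n + 1) because the row sums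
        to 1.\<close>
      have "row_avg a n j \<le> K / (real n + 1)"
        using K[of j n n] that by (simp add: row_avg_n)
      also have "\<dots> \<le> \<bar>K\<bar> / (real n + 1)" by (intro divide_right_mono) auto
      finally show ?thesis .
    qed
    then show ?thesis
      by (intro matrix_mean_norm_le_row_avg[OF g H(1) hoelder L H(2,3) nonneg row_sum, of "\<bar>K\<bar>"]) auto
  next
    assume H: "1 < p" "0 < \<alpha>" "\<alpha> < 1" "a \<in> AMDMS" "bigo_ge1 (\<lambda>n. (real n + 1) * a n 0) (\<lambda>n. 1)"
    obtain K where K: "\<And>n m l. m \<le> l \<Longrightarrow> l \<le> n \<Longrightarrow> row_avg a n l \<le> K * row_avg a n m"
      using H(4) unfolding AMDMS_def by blast
    obtain C where C: "\<And>n. 1 \<le> n \<Longrightarrow> (real n + 1) * a n 0 \<le> C"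
      using H(5) nonneg unfolding bigo_ge1_iff by (auto simp: abs_mult)
    have "row_avg a n j \<le> \<bar>K\<bar> * \<bar>C\<bar> / (real n + 1)" if "1 \<le> n" "j \<le> n" for n j
    proof -
      \<comment> \<open>Comparison with the first average, which is the entry \<open>a n 0\<close>
        itself.\<close>
      have "row_avg a n j \<le> K * a n 0" using K[of 0 j n] that by (simp add: row_avg_0)
      also have "\<dots> \<le> \<bar>K\<bar> * a n 0" using nonneg by (intro mult_right_mono) auto
      also have "\<dots> \<le> \<bar>K\<bar> * (\<bar>C\<bar> / (real n + 1))"
        using C[OF that(1)] by (intro mult_left_mono) (auto simp: field_simps)
      finally show ?thesis by simp
    qed
    then show ?thesis
      by (intro matrix_mean_norm_le_row_avg[OF g H(1) hoelder L H(2,3) nonneg row_sum, of "\<bar>K\<bar> * \<bar>C\<bar>"]) auto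
  next
    assume "1 < p" "\<alpha> = 1"
    with that show ?thesis by simp
  next
    assume H: "p = 1" "0 < \<alpha>" "\<alpha> < 1" "bigo_ge1 (\<lambda>n. \<Sum>k<n. \<bar>a n k - a n (k + 1)\<bar>) (\<lambda>n. 1 / real n)"
      "bigo_ge1 (\<lambda>n. (real n + 1) * a n n) (\<lambda>n. 1)"
    obtain M where "\<And>n. 1 \<le> n \<Longrightarrow> (\<Sum>k<n. \<bar>a n k - a n (k + 1)\<bar>) + \<bar>a n n\<bar> \<le> M * (real n + 1) powr (- 0 - 1)"
      using variation_condition[OF H(4,5)] by blast
    then show ?thesis
      using H by (intro matrix_mean_rate_variation[OF g p hoelder L \<alpha>, of 0 a a M] row_sum) auto
  next
    assume H: "p = 1" "0 < \<alpha>" "\<alpha> < 1" "a \<in> RBVS" "bigo_ge1 (\<lambda>n. (real n + 1) * a n 0) (\<lambda>n. 1)"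
    obtain K where K: "\<And>n m. m \<le> n \<Longrightarrow> (\<Sum>k. \<bar>a n (m + k) - a n (m + k + 1)\<bar>) \<le> K * a n m"
      using H(4) unfolding RBVS_def by blast
    have V: "(\<Sum>k<n. \<bar>a n k - a n (k + 1)\<bar>) + \<bar>a n n\<bar> \<le> K * a n 0" for n
    proof -
      \<comment> \<open>The series includes the jump from \<open>a n n\<close> to the zero entry
        after it, which supplies the boundary term.\<close>
      have "(\<Sum>k. \<bar>a n (0 + k) - a n (0 + k + 1)\<bar>) = (\<Sum>k<Suc n. \<bar>a n (0 + k) - a n (0 + k + 1)\<bar>)"
        by (rule suminf_finite) (auto simp: triangular)
      then show ?thesis using K[of 0 n] triangular[of n "n + 1"] by simp
    qed
    obtain C where C: "\<And>n. 1 \<le> n \<Longrightarrow> (real n + 1) * a n 0 \<le> C"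
      using H(5) nonneg unfolding bigo_ge1_iff by (auto simp: abs_mult)
    have "(\<Sum>k<n. \<bar>a n k - a n (k + 1)\<bar>) + \<bar>a n n\<bar> \<le> \<bar>K\<bar> * C * (real n + 1) powr (- 0 - 1)" if n: "1 \<le> n" for n
    proof -
      have "K * a n 0 \<le> \<bar>K\<bar> * a n 0" using nonneg by (intro mult_right_mono) auto
      also have "\<dots> \<le> \<bar>K\<bar> * (C / (real n + 1))"
        using C[OF n] by (intro mult_left_mono) (auto simp: field_simps)
      finally show ?thesis using V[of n] by (simp add: powr_minus_divide)
    qed
    then show ?thesis
      using H by (intro matrix_mean_rate_variation[OF g p hoelder L \<alpha>, of 0 a a "\<bar>K\<bar> * C"] row_sum) auto
  next
    fix \<beta> :: real
    assume H: "p = 1" "\<alpha> = 1" "bigo_ge1 (\<lambda>n. (real n + 1) * a n n) (\<lambda>n. 1)"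
      "0 < \<beta>" "(\<lambda>n k. (real k + 1) powr (- \<beta>) * a n k) \<in> HBVS"
    \<comment> \<open>The reduced row of the HBVS condition. Its variation is taken at m = n, where
      the last entry is O((n + 1)^(-\<beta> - 1)).\<close>
    define b where "b n k = (real k + 1) powr (- \<beta>) * a n k" for n k
    have ab: "a n k = (real k + 1) powr \<beta> * b n k" for n k
      by (simp add: b_def powr_minus)
    obtain K where K: "\<And>n m. m \<le> n \<Longrightarrow> (\<Sum>k<m. \<bar>b n k - b n (k + 1)\<bar>) \<le> K * b n m"
      using H(5) unfolding HBVS_def b_def by auto
    obtain C where C: "\<And>n. 1 \<le> n \<Longrightarrow> (real n + 1) * a n n \<le> C"
      using H(3) nonneg unfolding bigo_ge1_iff by (auto simp: abs_mult)
    have "(\<Sum>k<n. \<bar>b n k - b n (k + 1)\<bar>) + \<bar>b n n\<bar> \<le> (\<bar>K\<bar> + 1) * C * (real n + 1) powr (- \<beta> - 1)" if n: "1 \<le> n" for n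
    proof -
      have b0: "0 \<le> b n n" using nonneg by (simp add: b_def)
      have "(\<Sum>k<n. \<bar>b n k - b n (k + 1)\<bar>) + \<bar>b n n\<bar> \<le> K * b n n + b n n" using K[of n n] b0 by simp
      also have "\<dots> \<le> \<bar>K\<bar> * b n n + b n n" using b0 by (intro add_mono mult_right_mono) auto
      also have "\<dots> = (\<bar>K\<bar> + 1) * (real n + 1) powr (- \<beta>) * a n n" by (simp add: b_def algebra_simps)
      also have "\<dots> \<le> (\<bar>K\<bar> + 1) * (real n + 1) powr (- \<beta>) * (C / (real n + 1))"
        using C[OF n] by (intro mult_left_mono) (auto simp: field_simps)
      also have "\<dots> = (\<bar>K\<bar> + 1) * C * (real n + 1) powr (- \<beta> - 1)"
        by (simp add: powr_diff)
      finally show ?thesis .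
    qed
    then show ?thesis
      using H ab by (intro matrix_mean_rate_variation[OF g p hoelder L \<alpha>, of \<beta> a b "(\<bar>K\<bar> + 1) * C"] row_sum) auto
  qed
  have "\<exists>C. \<forall>n\<ge>1. Lp_norm p (\<lambda>x. matrix_mean a g n x - g x) \<le> C * real n powr (- \<alpha>)"
  proof (cases "p > 1 \<and> \<alpha> = 1")
    case True
    then have "bigo_ge1 (\<lambda>n. \<Sum>k<n. \<bar>row_avg a n k - row_avg a n (k + 1)\<bar>) (\<lambda>n. 1 / real n)"
      using cond by auto
    then obtain M where "\<And>n. 1 \<le> n \<Longrightarrow> (\<Sum>k<n. \<bar>row_avg a n k - row_avg a n (k + 1)\<bar>) \<le> M / real n"
      unfolding bigo_ge1_iff by (auto simp: sum_nonneg)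
    then obtain C where C: "\<And>n. 1 \<le> n \<Longrightarrow> Lp_norm p (\<lambda>x. matrix_mean a g n x - g x) \<le> C / real n"
      using matrix_mean_norm_le_row_avg_variation[OF g _ _ L nonneg row_sum, of M] True hoelder by blast
    have "C / real n = C * real n powr (- \<alpha>)" if "1 \<le> n" for n
      using True that by (simp add: powr_minus_divide)
    then show ?thesis using C by metis
  next
    case False
    obtain C where C: "\<And>n. 1 \<le> n \<Longrightarrow> Lp_norm p (\<lambda>x. matrix_mean a g n x - g x) \<le> C * (real n + 1) powr (- \<alpha>)"
      using main[OF False] by blast
    have "Lp_norm p (\<lambda>x. matrix_mean a g n x - g x) \<le> \<bar>C\<bar> * real n powr (- \<alpha>)" if n: "1 \<le> n" for n
    proof -
      have "C * (real n + 1) powr (- \<alpha>) \<le> \<bar>C\<bar> * (real n + 1) powr (- \<alpha>)"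
        by (intro mult_right_mono) auto
      also have "\<dots> \<le> \<bar>C\<bar> * real n powr (- \<alpha>)"
        using n \<alpha> by (intro mult_left_mono powr_mono2') auto
      finally show ?thesis using C[OF n] by linarith
    qed
    then show ?thesis by blast
  qed
  then show ?thesis
    unfolding bigo_ge1_iff transfer by (simp add: Lp_norm_nonneg)
qed

end
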